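(* Let $n\ge 1$ be an integer, $Q=2n+2$, $q^*=\frac{Q+2}{Q-2}$, and let $1<q<q^*$. Then the equation $$-\triangle_{\mathbb{H}^n}u=2n^2u^{q}\quad\text{in }\mathbb{H}^n$$ has no positive smooth solution $u:\mathbb{H}^n\to\mathbb{R}$; namely, every smooth nonnegative solution $u$ on the whole of $\mathbb{H}^n$ is identically zero.
   Context: The Heisenberg group $\mathbb{H}^n$ is the set $\mathbb{C}^n\times\mathbb{R}$ with coordinates $(z,t)$, $z=(z^1,\dots,z^n)$. Put $Z_\alpha=\frac{\partial}{\partial z^\alpha}+\sqrt{-1}\,\overline{z}^{\alpha}\frac{\partial}{\partial t}$ for $\alpha=1,\dots,n$, and $Z_{\overline{\alpha}}=\overline{Z_\alpha}=\frac{\partial}{\partial\overline{z}^\alpha}-\sqrt{-1}\,z^{\alpha}\frac{\partial}{\partial t}$. The Heisenberg Laplacian of a smooth real function $u$ is $\triangle_{\mathbb{H}^n}u=\sum_{\alpha=1}^n\big(u_{\alpha\overline{\alpha}}+u_{\overline{\alpha}\alpha}\big)=\sum_{\alpha=1}^n\big(Z_{\overline{\alpha}}Z_\alpha u+Z_\alpha Z_{\overline{\alpha}}u\big)$. The number $Q=2n+2$ is the homogeneous dimension of $\mathbb{H}^n$. *)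

theory Defs
  imports "HOL-Analysis.Analysis"
begin

text \<open>The points of the Heisenberg group are pairs (z, t) with z in C^n and t real; the
  dimension n is the cardinality of the index type. Only the underlying manifold and the vector
  fields below are needed, so the group law is not defined.\<close>

type_synonym 'n heis = "(complex ^ 'n) \<times> real"

definition hom_dim :: "'n::finite itself \<Rightarrow> nat" where
  "hom_dim _ = 2 * CARD('n) + 2"

text \<open>C^k, by recursion: for k + 1 the map is everywhere differentiable and all its directional
  derivatives are C^k. On a finite-dimensional domain this is the usual notion.\<close>

primrec Ck :: "nat \<Rightarrow> ('a::euclidean_space \<Rightarrow> 'b::real_normed_vector) \<Rightarrow> bool" where
  "Ck 0 f \<longleftrightarrow> continuous_on UNIV f"
| "Ck (Suc k) f \<longleftrightarrow>
     (\<forall>p. f differentiable (at p)) \<and> (\<forall>v. Ck k (\<lambda>p. frechet_derivative f (at p) v))"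

definition smooth :: "('a::euclidean_space \<Rightarrow> 'b::real_normed_vector) \<Rightarrow> bool" where
  "smooth f \<longleftrightarrow> (\<forall>k. Ck k f)"

text \<open>With z = x + i y in the coordinate with index a, the Wirtinger operators are
  d/dz = (d/dx - i d/dy) / 2 and d/dzbar = (d/dx + i d/dy) / 2; the real directions
  d/dx and d/dy are the vectors 1 and i in that coordinate.\<close>

definition d_z :: "'n \<Rightarrow> ('n::finite heis \<Rightarrow> complex) \<Rightarrow> 'n heis \<Rightarrow> complex" where
  "d_z a f p = (frechet_derivative f (at p) (axis a 1, 0)
                - \<i> * frechet_derivative f (at p) (axis a \<i>, 0)) / 2"

definition d_zbar :: "'n \<Rightarrow> ('n::finite heis \<Rightarrow> complex) \<Rightarrow> 'n heis \<Rightarrow> complex" where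
  "d_zbar a f p = (frechet_derivative f (at p) (axis a 1, 0)
                   + \<i> * frechet_derivative f (at p) (axis a \<i>, 0)) / 2"

definition d_t :: "('n::finite heis \<Rightarrow> complex) \<Rightarrow> 'n heis \<Rightarrow> complex" where
  "d_t f p = frechet_derivative f (at p) (0, 1)"

definition Z :: "'n \<Rightarrow> ('n::finite heis \<Rightarrow> complex) \<Rightarrow> 'n heis \<Rightarrow> complex" where
  "Z a f p = d_z a f p + \<i> * cnj (fst p $ a) * d_t f p"

definition Zbar :: "'n \<Rightarrow> ('n::finite heis \<Rightarrow> complex) \<Rightarrow> 'n heis \<Rightarrow> complex" where
  "Zbar a f p = d_zbar a f p - \<i> * (fst p $ a) * d_t f p"

text \<open>The Laplacian is kept complex-valued, so that no real part has to be taken; the equation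
  below is an equation between complex numbers.\<close>

definition heis_laplacian :: "('n::finite heis \<Rightarrow> real) \<Rightarrow> 'n heis \<Rightarrow> complex" where
  "heis_laplacian u p =
     (let f = (\<lambda>x. complex_of_real (u x))
      in \<Sum>a\<in>UNIV. Zbar a (Z a f) p + Z a (Zbar a f) p)"

text \<open>For nonnegative u and q > 0, powr is the usual power, including 0 powr q = 0.\<close>

definition solves_heis_eq :: "real \<Rightarrow> ('n::finite heis \<Rightarrow> real) \<Rightarrow> bool" where
  "solves_heis_eq q u \<longleftrightarrow>
     (\<forall>p. - heis_laplacian u p = complex_of_real (2 * (real CARD('n))\<^sup>2 * u p powr q))"

end

theory Submission
  imports Defs
begin

text \<open>A nonnegative solution which is positive at one point is positive everywhere: it is
  superharmonic, hence bounded below outside a gauge ball by a multiple of exp (- k rho), with rho the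
  fourth power of the (translated) gauge, by the weak maximum principle.

  A positive solution is written as u = exp (n f), with p = n (q - 1) - 2, so that - 2 < p < 0.
  Put e = exp ((2 + p) f), a = sum |f_x|^2 and b = T f. A Jerison-Lee type identity exhibits a vector field whose
  divergence is exp (2 (n - 1) f) times a positive definite expression in the tensors D, E, G
  built from the second derivatives of f, plus |p| e (a^2 + a e + b^2). Adding small multiples of the
  fields a^2 f_x, - e^2 f_x and - i b |b| f_x, all weighted by exp (2 (n - 1) f), yields a field W with
  div W >= c X and |W| <= C X^(1 - 1/m), where
  X = exp (2 (n - 1) f) (|D|^2 + |E|^2 + |G|^2 + a^3 + |b|^3 + e^3) is positive
  and m = 2 (2 (n - 1) / (2 + p) + 3) exceeds Q = 2 n + 2. Testing with cutoffs at scale R and absorbing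
  by Young's inequality bounds the integral of X over a gauge ball by a multiple of R^(Q - m), which
  tends to 0.\<close>

text \<open>Origin of the tensors: for p = 0 a model solution is f = - ln |t + i (|z|^2 + 1)|, and
  there \<open>D2\<close>, \<open>E2\<close> and \<open>G\<close> all vanish; the identity measures
  the distance from this model. Obstacle: the identity controls a^2, a e and b^2 only together with
  the factor e, for which no lower bound is known, while the field contains products such as a |D|
  and |b| |G|. It cannot be bounded by a power of its own divergence until the pure cubes a^3, |b|^3
  and e^3 are available; each added field supplies one of them. The factor b |b| instead of b^2
  yields |b|^3 instead of b^3, at the price of a field that is only C^1. Origin of m: under the
  dilations (z, t) -> (r z, r^2 t), which preserve the equation, f_x has weight 1, a, b, e have
  weight 2 and D, E, G have weight 3. Since exp (2 (n - 1) f) = e^\<nu> with \<nu> = 2 (n - 1) / (2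
  + p), X has weight 2 \<nu> + 6 = m and W has weight m - 1; hence the exponent 1 - 1/m. From 2 + p
  < 2 it follows that m >= Q + 2.\<close>

section \<open>The Jerison-Lee type identity\<close>

text \<open>The ring stands for the smooth complex functions on the Heisenberg group, \<open>c\<close> for
  complex conjugation and \<open>ii\<close> for the imaginary unit.\<close>

locale cr_calculus =
  fixes Z Zb :: "'n::finite \<Rightarrow> 'r::comm_ring_1 \<Rightarrow> 'r" and T c :: "'r \<Rightarrow> 'r" and ii :: 'r
  assumes Z_add: "Z a (x + y) = Z a x + Z a y"
    and Z_mult: "Z a (x * y) = Z a x * y + x * Z a y"
    and T_add: "T (x + y) = T x + T y"
    and T_mult: "T (x * y) = T x * y + x * T y"
    and c_add [simp]: "c (x + y) = c x + c y"
    and c_mult [simp]: "c (x * y) = c x * c y"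
    and c_c [simp]: "c (c x) = x"
    and c_Z [simp]: "c (Z a x) = Zb a (c x)"
    and c_T [simp]: "c (T x) = T (c x)"
    and ii_sq: "ii * ii = - 1"
    and c_ii [simp]: "c ii = - ii"
    and Z_ii [simp]: "Z a ii = 0"
    and T_ii [simp]: "T ii = 0"
    and Zb_Z: "Zb b (Z a x) = Z a (Zb b x) + (if a = b then 2 * ii * T x else 0)"
    and Z_Z: "Z a (Z b x) = Z b (Z a x)"
    and T_Z: "T (Z a x) = Z a (T x)"
begin

lemma ii_ii: "ii * (ii * x) = - x"
  by (simp flip: mult.assoc add: ii_sq)

text \<open>Multiplicativity at the product c 1 * 1, combined with c being an involution.\<close>

lemma c_one [simp]: "c 1 = 1"
  using c_mult[of "c 1" 1] by (simp del: c_mult)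

lemma c_zero [simp]: "c 0 = 0"
  using c_add[of 0 0] by (simp del: c_add)

lemma c_minus [simp]: "c (- x) = - c x"
  using c_add[of x "- x"] by (simp del: c_add add: minus_unique)

lemma c_diff [simp]: "c (x - y) = c x - c y"
  using c_add[of x "- y"] by (simp del: c_add)

lemma c_Zb [simp]: "c (Zb a x) = Z a (c x)"
  using c_c[of "Z a (c x)"] unfolding c_Z unfolding c_c[of x] .

lemma c_of_nat [simp]: "c (of_nat k) = of_nat k"
  by (induction k) auto

lemma c_numeral [simp]: "c (numeral k) = numeral k"
  using c_of_nat[of "numeral k"] by simp

lemma c_sum [simp]: "c (sum x A) = (\<Sum>a\<in>A. c (x a))"
  by (induction A rule: infinite_finite_induct) auto

lemma Z_zero [simp]: "Z a 0 = 0"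
  using Z_add[of a 0 0] by simp

lemma Z_minus [simp]: "Z a (- x) = - Z a x"
  using Z_add[of a x "- x"] by (simp add: minus_unique)

lemma Z_diff: "Z a (x - y) = Z a x - Z a y"
  using Z_add[of a x "- y"] by simp

lemma Z_one [simp]: "Z a 1 = 0"
  using Z_mult[of a 1 1] by simp

lemma Z_of_nat [simp]: "Z a (of_nat k) = 0"
  by (induction k) (auto simp: Z_add)

lemma Z_numeral [simp]: "Z a (numeral k) = 0"
  using Z_of_nat[of a "numeral k"] by simp

lemma Z_sum: "Z a (sum x A) = (\<Sum>b\<in>A. Z a (x b))"
  by (induction A rule: infinite_finite_induct) (auto simp: Z_add)

lemma T_zero [simp]: "T 0 = 0"
  using T_add[of 0 0] by simp

lemma T_minus [simp]: "T (- x) = - T x"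
  using T_add[of x "- x"] by (simp add: minus_unique)

lemma T_diff: "T (x - y) = T x - T y"
  using T_add[of x "- y"] by simp

lemma T_one [simp]: "T 1 = 0"
  using T_mult[of 1 1] by simp

lemma T_of_nat [simp]: "T (of_nat k) = 0"
  by (induction k) (auto simp: T_add)

lemma T_sum: "T (sum x A) = (\<Sum>b\<in>A. T (x b))"
  by (induction A rule: infinite_finite_induct) (auto simp: T_add)

lemma Zb_conv: "Zb a x = c (Z a (c x))"
  by simp

lemma Zb_add: "Zb a (x + y) = Zb a x + Zb a y"
  by (simp only: Zb_conv Z_add c_add)

lemma Zb_mult: "Zb a (x * y) = Zb a x * y + x * Zb a y"
  by (simp only: Zb_conv Z_mult c_add c_mult c_c)

lemma Zb_zero [simp]: "Zb a 0 = 0"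
  by (simp only: Zb_conv Z_zero c_zero)

lemma Zb_ii [simp]: "Zb a ii = 0"
  using c_Z[of a "- ii"] by simp

lemma Zb_minus [simp]: "Zb a (- x) = - Zb a x"
  by (simp only: Zb_conv Z_minus c_minus)

lemma Zb_diff: "Zb a (x - y) = Zb a x - Zb a y"
  by (simp only: Zb_conv Z_diff c_diff)

lemma Zb_of_nat [simp]: "Zb a (of_nat k) = 0"
  by (simp only: Zb_conv Z_of_nat c_of_nat c_zero)

lemma Zb_numeral [simp]: "Zb a (numeral k) = 0"
  using Zb_of_nat[of a "numeral k"] by simp

lemma Zb_sum: "Zb a (sum x A) = (\<Sum>b\<in>A. Zb a (x b))"
  by (simp only: Zb_conv Z_sum c_sum)

lemma T_Zb: "T (Zb a x) = Zb a (T x)"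
  using arg_cong[OF T_Z[of a "c x"], of c] by simp

end

lemma sum_if_eq:
  fixes x y :: "'n::finite \<Rightarrow> 'r::comm_ring_1"
  shows "(\<Sum>b\<in>UNIV. (if a = b then x b else 0) * y b) = x a * y a"
    and "(\<Sum>b\<in>UNIV. (if b = a then x b else 0) * y b) = x a * y a"
    and "(\<Sum>b\<in>UNIV. y b * (if a = b then x b else 0)) = y a * x a"
    and "(\<Sum>b\<in>UNIV. y b * (if b = a then x b else 0)) = y a * x a"
  by (auto simp: if_distrib[of "\<lambda>t. t * _"] if_distrib[of "\<lambda>t. _ * t"] cong: if_cong)

text \<open>\<open>F\<close> is the logarithm f of the header; \<open>e\<close> and \<open>\<Psi>\<close> stand for exp ((2 + p) f) and
  exp (2 (n - 1) f). In this form the differential equation fixes the trace of the mixed second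
  derivatives, its imaginary part being the commutator relation.\<close>

locale cr_equation = cr_calculus Z Zb T c ii
  for Z Zb :: "'n::finite \<Rightarrow> 'r::comm_ring_1 \<Rightarrow> 'r" and T c ii +
  fixes F e \<Psi> p n :: 'r
  assumes n_eq: "n = of_nat CARD('n)"
    and c_F [simp]: "c F = F" and c_e [simp]: "c e = e" and c_p [simp]: "c p = p"
    and c_\<Psi> [simp]: "c \<Psi> = \<Psi>"
    and Z_p [simp]: "Z a p = 0"
    and Z_e: "Z a e = (2 + p) * e * Z a F"
    and T_e: "T e = (2 + p) * e * T F"
    and Z_\<Psi>: "Z a \<Psi> = 2 * (n - 1) * \<Psi> * Z a F"
    and equation: "(\<Sum>a\<in>UNIV. Zb a (Z a F)) =
      - n * ((\<Sum>a\<in>UNIV. Z a F * Zb a F) + e - ii * T F)"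
begin

text \<open>In index notation, with f_xy = Z_y Z_x f and y' for a conjugate index: \<open>D2 x y\<close> is
  f_xy - 2 f_x f_y, and \<open>E2 x y\<close> is the trace-free part of f_xy'.\<close>

abbreviation f where "f a \<equiv> Z a F"
abbreviation fb where "fb a \<equiv> Zb a F"
abbreviation b :: 'r where "b \<equiv> T F"
definition A :: 'r where "A = (\<Sum>a\<in>UNIV. f a * fb a)"
text \<open>The equation says that - n \<open>g\<close> is the trace of the mixed second
  derivatives, so adding \<open>g\<close> on the diagonal makes \<open>E2\<close> trace-free. The
  summand - i b records that Z and Zb do not commute.\<close>

definition g :: 'r where "g = A + e - ii * b"
definition D2 where "D2 x y = Z y (f x) - 2 * f x * f y"
definition E2 where "E2 x y = Zb y (f x) + (if x = y then g else 0)"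
definition D where "D x = (\<Sum>y\<in>UNIV. D2 x y * fb y)"
definition E where "E x = (\<Sum>y\<in>UNIV. E2 x y * f y)"
text \<open>The summand g f_x is chosen so that in \<open>Zb_g\<close> every multiple of the
  gradient cancels except the one carrying the factor p.\<close>

definition G where "G x = ii * Z x b + g * f x"
definition d :: 'r where "d = (\<Sum>x\<in>UNIV. D x * fb x)"
definition \<epsilon> :: 'r where "\<epsilon> = (\<Sum>x\<in>UNIV. E x * fb x)"
definition \<gamma> :: 'r where "\<gamma> = (\<Sum>x\<in>UNIV. G x * fb x)"

section \<open>Symmetries, traces and first derivatives of the tensors\<close>

lemma c_n [simp]: "c n = n" and Z_n [simp]: "Z a n = 0" and Zb_n [simp]: "Zb a n = 0"
    and T_n [simp]: "T n = 0"
  by (simp_all add: n_eq)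

lemma of_nat_card [simp]: "of_nat CARD('n) = n"
  by (simp add: n_eq)

lemma c_A [simp]: "c A = A"
  by (simp add: A_def mult.commute)

lemma c_g: "c g = A + e + ii * b"
  by (simp add: g_def)

lemma trace: "(\<Sum>a\<in>UNIV. Zb a (f a)) = - n * g"
  by (simp add: equation g_def A_def)

lemma D2_sym: "D2 x y = D2 y x"
  by (simp add: D2_def Z_Z[of y] algebra_simps)

text \<open>Conjugation exchanges the order of the two derivatives. On the diagonal the commutator
  contributes 2 i b, which is exactly c g - g.\<close>

lemma E2_herm: "c (E2 x y) = E2 y x"
  by (simp add: E2_def Zb_Z[of x y] c_g g_def algebra_simps)

lemma trace_E2: "(\<Sum>x\<in>UNIV. E2 x x) = 0"
  by (simp add: E2_def sum.distrib trace)

lemma Zb_f: "Zb y (f x) = E2 x y - (if x = y then g else 0)"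
  by (simp add: E2_def)

lemma Zb_fb: "Zb y (fb x) = c (D2 x y) + 2 * fb x * fb y"
  by (simp add: D2_def)

lemma Zb_e: "Zb a e = (2 + p) * e * fb a"
  using arg_cong[OF Z_e[of a], of c] by simp

lemma Zb_\<Psi>: "Zb a \<Psi> = 2 * (n - 1) * \<Psi> * fb a"
  using arg_cong[OF Z_\<Psi>[of a], of c] by simp

lemma c_D: "c (D x) = (\<Sum>y\<in>UNIV. c (D2 x y) * f y)"
  by (simp add: D_def)

lemma c_E: "c (E x) = (\<Sum>y\<in>UNIV. E2 y x * fb y)"
  by (simp add: E_def E2_herm)

lemma ii_Z_b: "ii * Z x b = G x - g * f x"
  by (simp add: G_def)

lemma ii_Zb_b: "ii * Zb x b = c g * fb x - c (G x)"
  by (simp add: G_def)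

lemma Z_b: "Z x b = ii * (g * f x - G x)"
proof -
  have "Z x b = - (ii * (ii * Z x b))" by (simp add: ii_ii)
  then show ?thesis unfolding ii_Z_b by (simp add: algebra_simps)
qed

text \<open>In f_x fb_x one factor yields a mixed second derivative, hence \<open>E2\<close> and
  \<open>g\<close>; the other a pure one, hence \<open>D2\<close> and the quadratic term 2 A
  fb.\<close>

lemma Zb_A: "Zb a A = c (D a) + c (E a) - g * fb a + 2 * A * fb a"
proof -
  have "Zb a A = (\<Sum>x\<in>UNIV. E2 x a * fb x - (if x = a then g else 0) * fb x
      + (c (D2 a x) * f x + 2 * f x * fb x * fb a))"
    unfolding A_def Zb_sum Zb_mult Zb_f Zb_fb
    by (intro sum.cong refl) (simp add: algebra_simps D2_sym)
  also have "\<dots> = c (E a) - g * fb a + (c (D a) + 2 * A * fb a)"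
    by (simp add: sum.distrib sum_subtractf c_E c_D sum_if_eq A_def sum_distrib_left sum_distrib_right mult.assoc)
  finally show ?thesis by (simp add: algebra_simps)
qed

lemma Z_A: "Z a A = D a + E a - c g * f a + 2 * A * f a"
  using arg_cong[OF Zb_A[of a], of c] by simp

text \<open>The multiples of fb add up to 2 A + (2 + p) e - (g + c g), and g + c g = 2 (A + e), so
  only p e survives.\<close>

lemma Zb_g: "Zb a g = c (D a) + c (E a) + c (G a) + p * e * fb a"
proof -
  have "Zb a g = Zb a A + Zb a e - ii * Zb a b"
    by (simp add: g_def Zb_add Zb_diff Zb_mult)
  also have "\<dots> = c (D a) + c (E a) - g * fb a + 2 * A * fb a + (2 + p) * e * fb a - (c g * fb a - c (G a))"
    by (simp only: Zb_A Zb_e ii_Zb_b)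
  also have "\<dots> = c (D a) + c (E a) + c (G a) + p * e * fb a"
    unfolding c_g g_def by (simp add: algebra_simps)
  finally show ?thesis .
qed

lemma Z_g: "Z a g = D a + E a - G a + 2 * g * f a + p * e * f a"
proof -
  have "Z a g = Z a A + Z a e - ii * Z a b"
    by (simp add: g_def Z_add Z_diff Z_mult)
  also have "\<dots> = D a + E a - c g * f a + 2 * A * f a + (2 + p) * e * f a - (G a - g * f a)"
    by (simp only: Z_A Z_e ii_Z_b)
  also have "\<dots> = D a + E a - G a + 2 * g * f a + p * e * f a"
    unfolding c_g g_def by (simp add: algebra_simps)
  finally show ?thesis .
qed

section \<open>Divergences of the second-order tensors and of their contractions\<close>

lemma f_E2: "(\<Sum>x\<in>UNIV. f x * E2 y x) = E y"
  by (simp add: E_def mult.commute)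

text \<open>Moving the conjugate derivative inwards past Z_y turns the divergence of the second
  derivatives into the gradient of the trace - n g plus one commutator 2 i Z_y b; \<open>Z_g\<close>
  and \<open>ii_Z_b\<close> express both through \<open>D\<close>, \<open>E\<close>,
  \<open>G\<close>. All multiples of f other than the one with factor p cancel.\<close>

lemma div_D2: "(\<Sum>x\<in>UNIV. Zb x (D2 x y)) = - n * D y - (n + 2) * E y + (n + 2) * G y - n * p * e * f y"
proof -
  have "Zb x (Z y (f x)) = Z y (Zb x (f x)) + (if x = y then 2 * ii * T (f y) else 0)" for x
    by (simp add: Zb_Z eq_commute)
  then have 1: "(\<Sum>x\<in>UNIV. Zb x (Z y (f x))) = Z y (- n * g) + 2 * ii * T (f y)"
    by (simp add: sum.distrib trace flip: Z_sum)
  have 2: "(\<Sum>x\<in>UNIV. Zb x (2 * f x * f y)) = 2 * (- n * g * f y) + 2 * (E y - g * f y)"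
  proof -
    have "(\<Sum>x\<in>UNIV. Zb x (2 * f x * f y)) = 2 * ((\<Sum>x\<in>UNIV. Zb x (f x)) * f y)
        + 2 * (\<Sum>x\<in>UNIV. f x * Zb x (f y))"
      by (simp add: Zb_mult sum.distrib sum_distrib_left sum_distrib_right mult.assoc)
    also have "(\<Sum>x\<in>UNIV. f x * Zb x (f y)) = E y - g * f y"
      by (simp add: Zb_f right_diff_distrib sum_subtractf f_E2 sum_if_eq mult.commute)
    finally show ?thesis by (simp add: trace)
  qed
  have "(\<Sum>x\<in>UNIV. Zb x (D2 x y)) = - n * Z y g + 2 * (ii * Z y b) - (2 * (- n * g * f y) + 2 * (E y - g * f y))"
    unfolding D2_def Zb_diff sum_subtractf 1 2 by (simp add: Z_mult T_Z algebra_simps)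
  then show ?thesis
    unfolding Z_g ii_Z_b by (simp add: algebra_simps)
qed

text \<open>The mixed derivatives are first reordered to Zb Z, which costs n commutators, then Z_y
  is moved outwards as in \<open>div_D2\<close>, which returns one; hence the factor 1 - n.\<close>

lemma div_E2_left: "(\<Sum>x\<in>UNIV. Z x (E2 y x)) = - (n - 1) * (D y + E y + G y + p * e * f y)"
proof -
  have "Zb x (Z x (f y)) = Z x (Zb x (f y)) + 2 * ii * T (f y)" for x
    by (simp add: Zb_Z)
  then have "(\<Sum>x\<in>UNIV. Z x (Zb x (f y))) = (\<Sum>x\<in>UNIV. Zb x (Z x (f y))) - n * (2 * ii * T (f y))"
    by (simp add: sum.distrib)
  also have "(\<Sum>x\<in>UNIV. Zb x (Z x (f y))) = (\<Sum>x\<in>UNIV. Zb x (Z y (f x)))"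
    by (simp add: Z_Z[of y])
  also have "\<dots> = Z y (- n * g) + 2 * ii * T (f y)"
  proof -
    have "Zb x (Z y (f x)) = Z y (Zb x (f x)) + (if x = y then 2 * ii * T (f y) else 0)" for x
      by (simp add: Zb_Z eq_commute)
    then show ?thesis by (simp add: sum.distrib trace flip: Z_sum)
  qed
  finally have 1: "(\<Sum>x\<in>UNIV. Z x (Zb x (f y))) = - n * Z y g + 2 * (1 - n) * (ii * Z y b)"
    by (simp add: Z_mult T_Z algebra_simps)
  have "(\<Sum>x\<in>UNIV. Z x (E2 y x)) = (\<Sum>x\<in>UNIV. Z x (Zb x (f y))) + Z y g"
    by (simp add: E2_def Z_add sum.distrib if_distrib[of "Z _"] cong: if_cong)
  then show ?thesis unfolding 1 Z_g ii_Z_b by (simp add: algebra_simps)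
qed

lemma div_E2: "(\<Sum>x\<in>UNIV. Zb x (E2 x y)) = - (n - 1) * (c (D y) + c (E y) + c (G y) + p * e * fb y)"
proof -
  have "(\<Sum>x\<in>UNIV. Zb x (E2 x y)) = c (\<Sum>x\<in>UNIV. Z x (E2 y x))"
    by (simp add: E2_herm)
  then show ?thesis by (simp add: div_E2_left)
qed

definition ND :: 'r where "ND = (\<Sum>x\<in>UNIV. \<Sum>y\<in>UNIV. D2 x y * c (D2 x y))"
definition NE :: 'r where "NE = (\<Sum>x\<in>UNIV. \<Sum>y\<in>UNIV. E2 x y * c (E2 x y))"

text \<open>The second derivatives of f that meet \<open>D2\<close> are c \<open>D2\<close> + 2 fb
  fb: the first part gives the squared norm \<open>ND\<close>, the second 2
  \<open>d\<close>.\<close>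

lemma div_D: "(\<Sum>x\<in>UNIV. Zb x (D x)) = ND + (2 - n) * d - (n + 2) * \<epsilon> + (n + 2) * \<gamma> - n * p * e * A"
proof -
  have "(\<Sum>x\<in>UNIV. Zb x (D x)) = (\<Sum>x\<in>UNIV. \<Sum>y\<in>UNIV. Zb x (D2 x y) * fb y)
     + (\<Sum>x\<in>UNIV. \<Sum>y\<in>UNIV. D2 x y * Zb x (fb y))"
    by (simp add: D_def Zb_sum Zb_mult sum.distrib)
  also have "(\<Sum>x\<in>UNIV. \<Sum>y\<in>UNIV. Zb x (D2 x y) * fb y) = (\<Sum>y\<in>UNIV. (\<Sum>x\<in>UNIV. Zb x (D2 x y)) * fb y)"
    by (subst sum.swap) (simp add: sum_distrib_right)
  also have "\<dots> = - n * d - (n + 2) * \<epsilon> + (n + 2) * \<gamma> - n * p * e * A"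
    by (simp add: div_D2 d_def \<epsilon>_def \<gamma>_def A_def algebra_simps sum.distrib sum_subtractf sum_negf sum_distrib_left)
  also have "(\<Sum>x\<in>UNIV. \<Sum>y\<in>UNIV. D2 x y * Zb x (fb y)) = ND + 2 * d"
    by (simp add: ND_def d_def D_def Zb_fb algebra_simps sum.distrib sum_distrib_left D2_sym)
  finally show ?thesis by (simp add: algebra_simps)
qed

text \<open>The second derivatives of f that meet \<open>E2\<close> are \<open>E2\<close> minus g on
  the diagonal; the diagonal part sees only the trace of \<open>E2\<close>, which is zero.\<close>

lemma div_E: "(\<Sum>x\<in>UNIV. Zb x (E x)) = NE - (n - 1) * (c d + \<epsilon> + c \<gamma> + p * e * A)"
proof -
  have c_\<epsilon>: "\<epsilon> = (\<Sum>x\<in>UNIV. c (E x) * f x)"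
    unfolding \<epsilon>_def c_E unfolding E_def sum_distrib_right
    by (subst sum.swap) (simp add: mult.commute mult.left_commute)
  have "(\<Sum>x\<in>UNIV. Zb x (E x)) = (\<Sum>x\<in>UNIV. \<Sum>y\<in>UNIV. Zb x (E2 x y) * f y)
     + (\<Sum>x\<in>UNIV. \<Sum>y\<in>UNIV. E2 x y * Zb x (f y))"
    by (simp add: E_def Zb_sum Zb_mult sum.distrib)
  also have "(\<Sum>x\<in>UNIV. \<Sum>y\<in>UNIV. Zb x (E2 x y) * f y) = (\<Sum>y\<in>UNIV. (\<Sum>x\<in>UNIV. Zb x (E2 x y)) * f y)"
    by (subst sum.swap) (simp add: sum_distrib_right)
  also have "\<dots> = - (n - 1) * (c d + \<epsilon> + c \<gamma> + p * e * A)"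
    by (simp add: div_E2 d_def c_\<epsilon> \<gamma>_def A_def algebra_simps sum.distrib sum_subtractf sum_negf sum_distrib_left)
  also have "(\<Sum>x\<in>UNIV. \<Sum>y\<in>UNIV. E2 x y * Zb x (f y)) = NE - g * (\<Sum>x\<in>UNIV. E2 x x)"
    by (simp add: NE_def Zb_f E2_herm right_diff_distrib sum_subtractf sum_if_eq sum_distrib_left mult.commute)
  finally show ?thesis by (simp add: trace_E2 algebra_simps)
qed

lemma c_\<epsilon> [simp]: "c \<epsilon> = \<epsilon>"
  unfolding \<epsilon>_def c_sum c_mult c_E unfolding E_def sum_distrib_right
  by (subst sum.swap) (simp add: mult.commute mult.left_commute)

lemma T_A: "T A = - ii * \<gamma> + ii * c \<gamma> + 2 * b * A"
proof -
  have "T A = (\<Sum>x\<in>UNIV. Z x b * fb x) + c (\<Sum>x\<in>UNIV. Z x b * fb x)"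
    by (simp add: A_def T_sum T_mult T_Z T_Zb sum.distrib mult.commute)
  also have "(\<Sum>x\<in>UNIV. Z x b * fb x) = ii * g * A - ii * \<gamma>"
    by (simp add: Z_b A_def \<gamma>_def sum_distrib_left algebra_simps sum_subtractf)
  also have "ii * g * A - ii * \<gamma> + c (ii * g * A - ii * \<gamma>) = ii * (g - c g) * A - ii * \<gamma> + ii * c \<gamma>"
    by (simp add: algebra_simps)
  also have "ii * (g - c g) = 2 * b"
    by (simp add: c_g g_def algebra_simps ii_ii)
  finally show ?thesis by (simp add: algebra_simps)
qed

text \<open>T commutes with Z and Zb, so the divergence of Z b is T applied to the trace - n g. The
  resulting term - n T b is real and therefore drops out of \<open>div_V\<close>, where it is
  multiplied by i b and added to its conjugate.\<close>

lemma div_G: "(\<Sum>x\<in>UNIV. Zb x (G x)) = - (ii * n) * (T A + (2 + p) * e * b - ii * T b)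
   + c d + \<epsilon> + c \<gamma> + p * e * A - n * g * g"
proof -
  have c_\<epsilon>': "(\<Sum>x\<in>UNIV. c (E x) * f x) = \<epsilon>"
    using c_\<epsilon> unfolding \<epsilon>_def by (simp del: c_\<epsilon>)
  have "(\<Sum>x\<in>UNIV. Zb x (Z x b)) = T (\<Sum>x\<in>UNIV. Zb x (f x))"
    by (simp add: T_sum T_Z T_Zb)
  then have 1: "(\<Sum>x\<in>UNIV. Zb x (Z x b)) = - n * T g"
    by (simp add: trace T_mult)
  have "(\<Sum>x\<in>UNIV. Zb x (G x)) = ii * (\<Sum>x\<in>UNIV. Zb x (Z x b)) + (\<Sum>x\<in>UNIV. Zb x g * f x)
      + g * (\<Sum>x\<in>UNIV. Zb x (f x))"
    by (simp add: G_def Zb_add Zb_mult sum.distrib sum_distrib_left algebra_simps)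
  also have "(\<Sum>x\<in>UNIV. Zb x g * f x) = c d + \<epsilon> + c \<gamma> + p * e * A"
    by (simp add: Zb_g d_def \<gamma>_def A_def distrib_right sum.distrib c_\<epsilon>' mult.assoc sum_distrib_left)
      (simp add: mult.commute)
  finally show ?thesis unfolding 1 trace
    by (simp add: g_def T_add T_diff T_mult T_e algebra_simps)
qed

section \<open>Divergences of weighted multiples of the gradient\<close>

lemma c_E_f: "(\<Sum>x\<in>UNIV. c (E x) * f x) = \<epsilon>"
  using c_\<epsilon> unfolding \<epsilon>_def by (simp del: c_\<epsilon>)

text \<open>It will be applied with w = A^2, w = e^2 and w = 1 to the fields that are added to
  \<open>V\<close>.\<close>

lemma div_weighted_gradient:
  "(\<Sum>x\<in>UNIV. Zb x (\<Psi> * w * f x)) = \<Psi> * ((2 * (n - 1) * A - n * g) * w + (\<Sum>x\<in>UNIV. Zb x w * f x))"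
proof -
  have "Zb x (\<Psi> * w * f x) = \<Psi> * (2 * (n - 1)) * w * (f x * fb x) + \<Psi> * (Zb x w * f x) + \<Psi> * w * Zb x (f x)" for x
    by (simp add: Zb_mult Zb_\<Psi> algebra_simps)
  then have "(\<Sum>x\<in>UNIV. Zb x (\<Psi> * w * f x)) = \<Psi> * (2 * (n - 1)) * w * A
      + \<Psi> * (\<Sum>x\<in>UNIV. Zb x w * f x) + \<Psi> * w * (- n * g)"
    by (simp only: sum.distrib A_def flip: sum_distrib_left trace)
  then show ?thesis by (simp add: algebra_simps)
qed

lemma Zb_A_f: "(\<Sum>x\<in>UNIV. Zb x A * f x) = c d + \<epsilon> - g * A + 2 * A * A"
proof -
  have "Zb x A * f x = c (D x * fb x) + c (E x) * f x - g * (f x * fb x) + 2 * A * (f x * fb x)" for x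
    unfolding Zb_A by (simp add: algebra_simps)
  then show ?thesis
    by (simp only: sum.distrib sum_subtractf c_E_f flip: sum_distrib_left c_sum A_def d_def)
qed

lemma Zb_e_f: "(\<Sum>x\<in>UNIV. Zb x e * f x) = (2 + p) * e * A"
  unfolding Zb_e A_def sum_distrib_left by (simp add: mult_ac)

lemma ii_Zb_b_f: "ii * (\<Sum>x\<in>UNIV. Zb x b * f x) = c g * A - c \<gamma>"
proof -
  have "ii * (Zb x b * f x) = c g * (f x * fb x) - c (G x * fb x)" for x
    unfolding mult.assoc[symmetric] ii_Zb_b by (simp add: algebra_simps)
  then show ?thesis
    by (simp only: sum_distrib_left[of ii] sum_subtractf A_def \<gamma>_def c_sum flip: sum_distrib_left[of "c g"])
qed

text \<open>The coefficients (1, -2), (1, 2) and (0, -3) of A + e and i b, together with the exponent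
  2 (n - 1) in the weight, are those for which all terms linear in \<open>d\<close>, \<open>\<epsilon>\<close> and \<open>\<gamma>\<close> cancel
  when p = 0.\<close>

definition V where "V x = \<Psi> * ((A + e - 2 * ii * b) * D x + (A + e + 2 * ii * b) * E x - 3 * ii * b * G x)"

lemma div_V:
  defines "X \<equiv> (\<Sum>x\<in>UNIV. Zb x (V x))"
  shows "X + c X = \<Psi> * (2 * (A + e) * (ND + NE)
    + 2 * (\<Sum>x\<in>UNIV. D x * c (D x)) + 2 * (\<Sum>x\<in>UNIV. E x * c (E x)) + 6 * (\<Sum>x\<in>UNIV. G x * c (G x))
    + 2 * (\<Sum>x\<in>UNIV. D x * c (E x) + E x * c (D x))
    + 2 * (\<Sum>x\<in>UNIV. D x * c (G x) + G x * c (D x))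
    - 2 * (\<Sum>x\<in>UNIV. E x * c (G x) + G x * c (E x))
    - p * e * (2 * (2 * n - 1) * A * (A + e) + 6 * n * b * b - d - c d - 2 * \<epsilon>))"
proof -
  define DD EE GG where "DD = (\<Sum>x\<in>UNIV. D x * c (D x))" "EE = (\<Sum>x\<in>UNIV. E x * c (E x))"
    "GG = (\<Sum>x\<in>UNIV. G x * c (G x))"
  define DE ED DG GD EG GE where "DE = (\<Sum>x\<in>UNIV. D x * c (E x))" "ED = (\<Sum>x\<in>UNIV. E x * c (D x))"
    "DG = (\<Sum>x\<in>UNIV. D x * c (G x))" "GD = (\<Sum>x\<in>UNIV. G x * c (D x))"
    "EG = (\<Sum>x\<in>UNIV. E x * c (G x))" "GE = (\<Sum>x\<in>UNIV. G x * c (E x))"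
  have c': "c DD = DD" "c EE = EE" "c GG = GG" "c DE = ED" "c DG = GD" "c EG = GE"
     "c ED = DE" "c GD = DG" "c GE = EG"  "c ND = ND" "c NE = NE"
    by (simp_all add: DD_EE_GG_def DE_ED_DG_GD_EG_GE_def ND_def NE_def mult.commute)
  let ?k = "2 * (n - 1)"
  have h: "Zb x (A + e) = c (D x) + c (E x) + c g * fb x + p * e * fb x" for x
    unfolding Zb_add Zb_A Zb_e c_g by (simp add: g_def algebra_simps)
  have ib: "Zb x (ii * b) = c g * fb x - c (G x)" for x
    by (simp add: Zb_mult flip: ii_Zb_b)
  define YD where "YD = (A + e - 2 * ii * b) * (?k * d + (\<Sum>x\<in>UNIV. Zb x (D x)))
        + DD + DE + (c g + p * e) * d - 2 * (c g * d - DG)"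
  define YE where "YE = (A + e + 2 * ii * b) * (?k * \<epsilon> + (\<Sum>x\<in>UNIV. Zb x (E x)))
        + ED + EE + (c g + p * e) * \<epsilon> + 2 * (c g * \<epsilon> - EG)"
  define YG where "YG = ii * b * (?k * \<gamma> + (\<Sum>x\<in>UNIV. Zb x (G x))) + c g * \<gamma> - GG"
  have VD: "(\<Sum>x\<in>UNIV. Zb x (\<Psi> * (A + e - 2 * ii * b) * D x))
     = \<Psi> * ((A + e - 2 * ii * b) * (?k * d + (\<Sum>x\<in>UNIV. Zb x (D x)))
        + DD + DE + (c g + p * e) * d - 2 * (c g * d - DG))"
  proof -
    have "Zb x (\<Psi> * (A + e - 2 * ii * b) * D x) = \<Psi> * (A + e - 2 * ii * b) * ?k * (D x * fb x)
       + \<Psi> * (A + e - 2 * ii * b) * Zb x (D x) + \<Psi> * (D x * c (D x)) + \<Psi> * (D x * c (E x))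
       + \<Psi> * (c g + p * e) * (D x * fb x) - \<Psi> * 2 * c g * (D x * fb x) + \<Psi> * 2 * (D x * c (G x))" for x
    proof -
      have *: "Zb x (A + e - 2 * ii * b) = c (D x) + c (E x) + c g * fb x + p * e * fb x - 2 * (c g * fb x - c (G x))"
        using h[of x] ib[of x] by (simp add: Zb_diff Zb_mult mult.assoc)
      show ?thesis unfolding Zb_mult[of _ "\<Psi> * _"] Zb_mult[of _ \<Psi>] Zb_\<Psi> *
        by (simp add: algebra_simps)
    qed
    then show ?thesis
      unfolding DD_EE_GG_def DE_ED_DG_GD_EG_GE_def d_def
      by (simp only: sum.distrib sum_subtractf flip: sum_distrib_left) (simp add: algebra_simps)
  qed
  have VE: "(\<Sum>x\<in>UNIV. Zb x (\<Psi> * (A + e + 2 * ii * b) * E x))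
     = \<Psi> * ((A + e + 2 * ii * b) * (?k * \<epsilon> + (\<Sum>x\<in>UNIV. Zb x (E x)))
        + ED + EE + (c g + p * e) * \<epsilon> + 2 * (c g * \<epsilon> - EG))"
  proof -
    have "Zb x (\<Psi> * (A + e + 2 * ii * b) * E x) = \<Psi> * (A + e + 2 * ii * b) * ?k * (E x * fb x)
       + \<Psi> * (A + e + 2 * ii * b) * Zb x (E x) + \<Psi> * (E x * c (D x)) + \<Psi> * (E x * c (E x))
       + \<Psi> * (c g + p * e) * (E x * fb x) + \<Psi> * 2 * c g * (E x * fb x) - \<Psi> * 2 * (E x * c (G x))" for x
    proof -
      have *: "Zb x (A + e + 2 * ii * b) = c (D x) + c (E x) + c g * fb x + p * e * fb x + 2 * (c g * fb x - c (G x))"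
        using h[of x] ib[of x] unfolding Zb_add[of x "A + e"] by (simp add: Zb_mult mult.assoc)
      show ?thesis unfolding Zb_mult[of _ "\<Psi> * _"] Zb_mult[of _ \<Psi>] Zb_\<Psi> *
        by (simp add: algebra_simps)
    qed
    then show ?thesis
      unfolding DD_EE_GG_def DE_ED_DG_GD_EG_GE_def \<epsilon>_def
      by (simp only: sum.distrib sum_subtractf flip: sum_distrib_left) (simp add: algebra_simps)
  qed
  have VG: "(\<Sum>x\<in>UNIV. Zb x (\<Psi> * (ii * b) * G x))
     = \<Psi> * (ii * b * (?k * \<gamma> + (\<Sum>x\<in>UNIV. Zb x (G x))) + c g * \<gamma> - GG)"
  proof -
    have "Zb x (\<Psi> * (ii * b) * G x) = \<Psi> * (ii * b) * ?k * (G x * fb x)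
       + \<Psi> * (ii * b) * Zb x (G x) + \<Psi> * c g * (G x * fb x) - \<Psi> * (G x * c (G x))" for x
      unfolding Zb_mult[of _ "\<Psi> * _"] Zb_mult[of _ \<Psi>] Zb_\<Psi> ib
      by (simp add: algebra_simps)
    then show ?thesis
      unfolding DD_EE_GG_def \<gamma>_def
      by (simp only: sum.distrib sum_subtractf flip: sum_distrib_left) (simp add: algebra_simps)
  qed
  have "V x = \<Psi> * (A + e - 2 * ii * b) * D x + \<Psi> * (A + e + 2 * ii * b) * E x - 3 * (\<Psi> * (ii * b) * G x)" for x
    by (simp add: V_def algebra_simps)
  then have "X = (\<Sum>x\<in>UNIV. Zb x (\<Psi> * (A + e - 2 * ii * b) * D x))
      + (\<Sum>x\<in>UNIV. Zb x (\<Psi> * (A + e + 2 * ii * b) * E x)) - 3 * (\<Sum>x\<in>UNIV. Zb x (\<Psi> * (ii * b) * G x))"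
    by (simp add: X_def Zb_add Zb_diff Zb_mult[of _ 3] sum.distrib sum_subtractf sum_negf sum_distrib_left)
  also have "\<dots> = \<Psi> * (YD + YE - 3 * YG)"
    unfolding VD VE VG YD_def YE_def YG_def by (simp add: algebra_simps)
  finally have X: "X = \<Psi> * (YD + YE - 3 * YG)" .
  \<comment> \<open>In terms of h = A + e and P = p e, the exponent p occurs only inside P, which
    separates the critical identity from the terms due to p.\<close>
  define P h where "P = p * e" and "h = A + e"
  have cP [simp]: "c P = P" "c h = h" and g: "g = h - ii * b" "c g = h + ii * b"
    and e: "(2 + p) * e = 2 * (h - A) + P"
    by (simp_all add: P_def h_def g_def algebra_simps)
  have 1: "YD + c YD = 2 * h * ND + 2 * DD + DE + ED + 2 * DG + 2 * GD + P * (d + c d) - 2 * n * P * A * h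
      - 2 * (n + 2) * h * \<epsilon> + (n + 2) * h * (\<gamma> + c \<gamma>) + (n - 1) * h * (d + c d)
      - (2 * n + 1) * ii * b * (d - c d) - 2 * (n + 2) * ii * b * (\<gamma> - c \<gamma>)"
    unfolding YD_def div_D P_def[symmetric] h_def[symmetric] mult.assoc[of n p e] mult.assoc[of n P] g
    by (simp add: c' algebra_simps ii_ii ii_sq)
  have 2: "YE + c YE = 2 * h * NE + 2 * EE + DE + ED - 2 * EG - 2 * GE + 2 * P * \<epsilon> - 2 * (n - 1) * P * A * h
      + 2 * (n + 2) * h * \<epsilon> - (n - 1) * h * (\<gamma> + c \<gamma>) - (n - 1) * h * (d + c d)
      + 2 * (n - 1) * ii * b * (d - c d) + 2 * (n - 1) * ii * b * (\<gamma> - c \<gamma>)"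
    unfolding YE_def div_E P_def[symmetric] h_def[symmetric] g
    by (simp add: c' algebra_simps ii_ii ii_sq)
  have 3: "YG + c YG = - 2 * ii * b * (\<gamma> - c \<gamma>) + h * (\<gamma> + c \<gamma>) - ii * b * (d - c d) - 2 * GG + 2 * n * P * b * b"
    unfolding YG_def div_G T_A P_def[symmetric] h_def[symmetric] g e
    by (simp add: c' algebra_simps ii_ii ii_sq)
  \<comment> \<open>The linear terms cancel here: h (\<gamma> + c \<gamma>) has the coefficients n +
    2, - (n - 1), - 3; i b (d - c d) has - (2 n + 1), 2 (n - 1), 3; i b (\<gamma> - c \<gamma>) has
    - 2 (n + 2), 2 (n - 1), 6; those of h \<epsilon> and h (d + c d) cancel between \<open>D\<close>
    and \<open>E\<close>.\<close>
  have "X + c X = \<Psi> * ((YD + c YD) + (YE + c YE) - 3 * (YG + c YG))"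
    unfolding X by (simp add: algebra_simps)
  also have "\<dots> = \<Psi> * (2 * (A + e) * (ND + NE) + 2 * DD + 2 * EE + 6 * GG
    + 2 * (DE + ED) + 2 * (DG + GD) - 2 * (EG + GE)
    - p * e * (2 * (2 * n - 1) * A * (A + e) + 6 * n * b * b - d - c d - 2 * \<epsilon>))"
    unfolding 1 2 3 P_def[symmetric] h_def[symmetric] by (simp add: algebra_simps)
  finally show ?thesis
    unfolding DD_EE_GG_def DE_ED_DG_GD_EG_GE_def by (simp add: sum.distrib)
qed

end

section \<open>Smooth functions\<close>

lemma frechet_derivative_apply:
  "(f has_derivative f') (at p) \<Longrightarrow> frechet_derivative f (at p) v = f' v"
  by (metis frechet_derivative_at)

lemma has_derivative_frechet:
  "f differentiable (at p) \<Longrightarrow> (f has_derivative (\<lambda>v. frechet_derivative f (at p) v)) (at p)"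
  by (simp add: frechet_derivative_works)

lemma Ck_Suc_imp_Ck: "Ck (Suc k) f \<Longrightarrow> Ck k f"
proof (induction k arbitrary: f)
  case 0
  then show ?case
    by (auto intro!: continuous_at_imp_continuous_on differentiable_imp_continuous_within)
next
  case (Suc k)
  then show ?case by (metis Ck.simps(2))
qed

lemma Ck_differentiable: "Ck (Suc k) f \<Longrightarrow> f differentiable (at p)"
  by simp

text \<open>With a free choice of the derivative family, the inductions below can work with explicit
  formulas in place of \<open>frechet_derivative\<close>.\<close>

lemma Ck_SucI:
  assumes "\<And>p. (f has_derivative f' p) (at p)" "\<And>v. Ck k (\<lambda>p. f' p v)"
  shows "Ck (Suc k) f"
proof -
  have "(\<lambda>p. frechet_derivative f (at p) v) = (\<lambda>p. f' p v)" for v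
    using frechet_derivative_apply[OF assms(1)] by auto
  then show ?thesis using assms by (auto simp: differentiable_def)
qed

lemma Ck_SucD:
  assumes "Ck (Suc k) f"
  obtains f' where "\<And>p. (f has_derivative f' p) (at p)" "\<And>v. Ck k (\<lambda>p. f' p v)"
  using assms that[of "\<lambda>p. frechet_derivative f (at p)"] by (simp add: frechet_derivative_works)

lemma Ck_const [simp]: "Ck k (\<lambda>p. c)"
proof (induction k arbitrary: c)
  case (Suc k)
  show ?case by (rule Ck_SucI[where f' = "\<lambda>p v. 0"]) (auto simp: Suc)
qed simp

lemma Ck_bounded_linear: "bounded_linear f \<Longrightarrow> Ck k f"
proof (cases k)
  case (Suc k)
  assume f: "bounded_linear f"
  show ?thesis unfolding Suc
    by (rule Ck_SucI[where f' = "\<lambda>p. f"]) (auto simp: bounded_linear_imp_has_derivative f)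
qed (simp add: linear_continuous_on)

lemma Ck_bounded_linear_compose:
  assumes h: "bounded_linear h"
  shows "Ck k f \<Longrightarrow> Ck k (\<lambda>p. h (f p))"
proof (induction k arbitrary: f)
  case 0
  then show ?case
    using bounded_linear.continuous_on[OF h] by simp
next
  case (Suc k)
  from Suc.prems obtain f' where f': "\<And>p. (f has_derivative f' p) (at p)" "\<And>v. Ck k (\<lambda>p. f' p v)"
    by (rule Ck_SucD) auto
  show ?case
    by (intro Ck_SucI[where f' = "\<lambda>p v. h (f' p v)"] bounded_linear.has_derivative[OF h] f' Suc.IH)
qed

lemma Ck_add: "Ck k f \<Longrightarrow> Ck k g \<Longrightarrow> Ck k (\<lambda>p. f p + g p)"
proof (induction k arbitrary: f g)
  case 0
  then show ?case by (simp add: continuous_on_add)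
next
  case (Suc k)
  obtain f' where f': "\<And>p. (f has_derivative f' p) (at p)" "\<And>v. Ck k (\<lambda>p. f' p v)"
    by (rule Ck_SucD[OF Suc.prems(1)]) auto
  obtain g' where g': "\<And>p. (g has_derivative g' p) (at p)" "\<And>v. Ck k (\<lambda>p. g' p v)"
    by (rule Ck_SucD[OF Suc.prems(2)]) auto
  show ?case
    by (intro Ck_SucI[where f' = "\<lambda>p v. f' p v + g' p v"] has_derivative_add f' g' Suc.IH)
qed

lemma Ck_mult:
  fixes f g :: "'a::euclidean_space \<Rightarrow> 'b::real_normed_algebra"
  shows "Ck k f \<Longrightarrow> Ck k g \<Longrightarrow> Ck k (\<lambda>p. f p * g p)"
proof (induction k arbitrary: f g)
  case 0
  then show ?case by (simp add: continuous_on_mult)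
next
  case (Suc k)
  obtain f' where f': "\<And>p. (f has_derivative f' p) (at p)" "\<And>v. Ck k (\<lambda>p. f' p v)"
    by (rule Ck_SucD[OF Suc.prems(1)]) auto
  obtain g' where g': "\<And>p. (g has_derivative g' p) (at p)" "\<And>v. Ck k (\<lambda>p. g' p v)"
    by (rule Ck_SucD[OF Suc.prems(2)]) auto
  show ?case
    by (intro Ck_SucI[where f' = "\<lambda>p v. f p * g' p v + f' p v * g p"]
        has_derivative_mult Ck_add f' g' Suc.IH Ck_Suc_imp_Ck[OF Suc.prems(1)] Ck_Suc_imp_Ck[OF Suc.prems(2)])
qed

lemma Ck_minus: "Ck k f \<Longrightarrow> Ck k (\<lambda>p. - f p)"
  using Ck_bounded_linear_compose[OF bounded_linear_minus[OF bounded_linear_ident]] .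

lemma Ck_diff: "Ck k f \<Longrightarrow> Ck k g \<Longrightarrow> Ck k (\<lambda>p. f p - g p)"
  using Ck_add[OF _ Ck_minus, of k f g] by simp

lemma Ck_power:
  fixes f :: "'a::euclidean_space \<Rightarrow> 'b::{real_normed_algebra_1}"
  shows "Ck k f \<Longrightarrow> Ck k (\<lambda>p. f p ^ m)"
  by (induction m) (auto intro: Ck_mult)

lemma has_derivative_field_compose:
  fixes h :: "'b::real_normed_field \<Rightarrow> 'b"
  assumes "(f has_derivative f') (at p)" "(h has_field_derivative h') (at (f p))"
  shows "((\<lambda>p. h (f p)) has_derivative (\<lambda>v. h' * f' v)) (at p)"
  using has_derivative_compose[OF assms(1), of h "(*) h'"] assms(2)
  by (simp add: has_field_derivative_def)

text \<open>Only the values of f matter for h, so that \<open>inverse\<close>, \<open>ln\<close> and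
  t |t| are covered. Regularity of h' along f is a hypothesis because each instance obtains it in
  its own way.\<close>

lemma Ck_Suc_compose:
  fixes h :: "'b::real_normed_field \<Rightarrow> 'b"
  assumes f: "Ck (Suc k) f" and h: "\<And>p. (h has_field_derivative h' (f p)) (at (f p))"
    and h': "Ck k (\<lambda>p. h' (f p))"
  shows "Ck (Suc k) (\<lambda>p. h (f p))"
proof -
  obtain f' where f': "\<And>p. (f has_derivative f' p) (at p)" "\<And>v. Ck k (\<lambda>p. f' p v)"
    by (rule Ck_SucD[OF f]) auto
  show ?thesis
    by (intro Ck_SucI[where f' = "\<lambda>p v. h' (f p) * f' p v"] has_derivative_field_compose f' h Ck_mult h')
qed

lemma Ck_exp:
  fixes f :: "'a::euclidean_space \<Rightarrow> 'b::{real_normed_field,banach}"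
  shows "Ck k f \<Longrightarrow> Ck k (\<lambda>p. exp (f p))"
proof (induction k arbitrary: f)
  case (Suc k)
  show ?case
    by (rule Ck_Suc_compose[where h' = exp, OF Suc.prems DERIV_exp Suc.IH[OF Ck_Suc_imp_Ck[OF Suc.prems]]])
qed (simp add: continuous_on_exp)

lemma Ck_inverse:
  fixes f :: "'a::euclidean_space \<Rightarrow> 'b::real_normed_field"
  shows "Ck k f \<Longrightarrow> (\<And>p. f p \<noteq> 0) \<Longrightarrow> Ck k (\<lambda>p. inverse (f p))"
proof (induction k arbitrary: f)
  case (Suc k)
  have "Ck k (\<lambda>p. inverse (f p))"
    using Suc.IH[OF Ck_Suc_imp_Ck[OF Suc.prems(1)]] Suc.prems(2) by blast
  then have 1: "Ck k (\<lambda>p. - (inverse (f p) ^ Suc (Suc 0)))"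
    by (rule Ck_minus[OF Ck_power])
  show ?case
    by (rule Ck_Suc_compose[where h' = "\<lambda>x. - (inverse x ^ Suc (Suc 0))", OF Suc.prems(1) _ 1])
      (rule DERIV_inverse[OF Suc.prems(2)])
qed (simp add: continuous_on_inverse)

lemma Ck_ln:
  fixes f :: "'a::euclidean_space \<Rightarrow> real"
  assumes "Ck k f" "\<And>p. f p > 0"
  shows "Ck k (\<lambda>p. ln (f p))"
proof (cases k)
  case 0
  then show ?thesis using assms by (auto intro!: continuous_on_ln simp: less_imp_neq[symmetric])
next
  case (Suc k')
  have pos: "f p > 0" "f p \<noteq> 0" for p using assms(2)[of p] by auto
  have f: "Ck (Suc k') f" using assms(1) by (simp only: Suc)
  have "Ck k' (\<lambda>p. inverse (f p))" by (rule Ck_inverse[OF Ck_Suc_imp_Ck[OF f] pos(2)])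
  then show ?thesis unfolding Suc
    by (rule Ck_Suc_compose[where h' = inverse, OF f DERIV_ln[OF pos(1)]])
qed

lemma smooth_imp_Ck: "smooth f \<Longrightarrow> Ck k f"
  by (simp add: smooth_def)

lemma smooth_frechet: "smooth f \<Longrightarrow> smooth (\<lambda>p. frechet_derivative f (at p) v)"
  unfolding smooth_def by (metis Ck.simps(2))

lemma smooth_differentiable: "smooth f \<Longrightarrow> f differentiable (at p)"
  unfolding smooth_def by (metis Ck_differentiable)

lemma smooth_continuous: "smooth f \<Longrightarrow> continuous_on UNIV f"
  unfolding smooth_def by (metis Ck.simps(1))

lemma
  shows smooth_const: "smooth (\<lambda>p. c)"
    and smooth_bounded_linear: "bounded_linear h \<Longrightarrow> smooth h"
    and smooth_bounded_linear_compose: "bounded_linear h' \<Longrightarrow> smooth f \<Longrightarrow> smooth (\<lambda>p. h' (f p))"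
    and smooth_add: "smooth f \<Longrightarrow> smooth g \<Longrightarrow> smooth (\<lambda>p. f p + g p)"
    and smooth_diff: "smooth f \<Longrightarrow> smooth g \<Longrightarrow> smooth (\<lambda>p. f p - g p)"
    and smooth_minus: "smooth f \<Longrightarrow> smooth (\<lambda>p. - f p)"
  by (auto simp: smooth_def intro: Ck_bounded_linear Ck_bounded_linear_compose Ck_add Ck_diff Ck_minus)

lemma smooth_mult:
  fixes f g :: "'a::euclidean_space \<Rightarrow> 'b::real_normed_algebra"
  shows "smooth f \<Longrightarrow> smooth g \<Longrightarrow> smooth (\<lambda>p. f p * g p)"
  by (auto simp: smooth_def intro: Ck_mult)

lemma smooth_exp:
  fixes f :: "'a::euclidean_space \<Rightarrow> 'b::{real_normed_field,banach}"
  shows "smooth f \<Longrightarrow> smooth (\<lambda>p. exp (f p))"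
  by (auto simp: smooth_def intro: Ck_exp)

lemma smooth_ln:
  fixes f :: "'a::euclidean_space \<Rightarrow> real"
  shows "smooth f \<Longrightarrow> (\<And>p. f p > 0) \<Longrightarrow> smooth (\<lambda>p. ln (f p))"
  by (auto simp: smooth_def intro: Ck_ln)

section \<open>Symmetry of second derivatives\<close>

lemma has_real_derivative_along_line:
  fixes f :: "'a::real_normed_vector \<Rightarrow> real"
  assumes "\<And>p. f differentiable (at p)"
  shows "((\<lambda>s. f (p + s *\<^sub>R v)) has_real_derivative frechet_derivative f (at (p + s *\<^sub>R v)) v) (at s)"
proof -
  have f: "(f has_derivative frechet_derivative f (at (p + s *\<^sub>R v))) (at (p + s *\<^sub>R v))"
    using assms frechet_derivative_works by blast
  have "((\<lambda>s. p + s *\<^sub>R v) has_derivative (\<lambda>s. s *\<^sub>R v)) (at s)"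
    by (auto intro!: derivative_eq_intros)
  from has_derivative_compose[OF this f]
  have "((\<lambda>s. f (p + s *\<^sub>R v)) has_derivative (\<lambda>r. frechet_derivative f (at (p + s *\<^sub>R v)) (r *\<^sub>R v))) (at s)" .
  moreover have "(\<lambda>r. frechet_derivative f (at (p + s *\<^sub>R v)) (r *\<^sub>R v)) = (*) (frechet_derivative f (at (p + s *\<^sub>R v)) v)"
    using linear_frechet_derivative[OF assms, of "p + s *\<^sub>R v"] by (auto simp: linear_scale)
  ultimately show ?thesis by (simp add: has_field_derivative_def)
qed

text \<open>The mean value theorem, once along v and once along w, makes the second difference
  quotient a value of the mixed derivative at a point within h (|v| + |w|) of p; continuity of that
  derivative does the rest.\<close>

lemma second_difference_limit:
  fixes f :: "'a::euclidean_space \<Rightarrow> real"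
  assumes f: "Ck 2 f" and "\<epsilon> > 0"
  shows "\<exists>\<delta>>0. \<forall>h. 0 < h \<and> h < \<delta> \<longrightarrow>
    \<bar>(f (p + h *\<^sub>R v + h *\<^sub>R w) - f (p + h *\<^sub>R v) - f (p + h *\<^sub>R w) + f p) / h\<^sup>2
      - frechet_derivative (\<lambda>p. frechet_derivative f (at p) v) (at p) w\<bar> < \<epsilon>"
proof -
  let ?D = "\<lambda>p. frechet_derivative f (at p) v"
  let ?DD = "\<lambda>p. frechet_derivative ?D (at p) w"
  have f2: "Ck (Suc (Suc 0)) f" using f by (simp add: numeral_2_eq_2)
  then have d1: "\<And>p. f differentiable (at p)" and d2: "\<And>p. ?D differentiable (at p)"
    and "continuous_on UNIV ?DD"
    by auto
  then have "isCont ?DD p" by (simp add: continuous_on_eq_continuous_at)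
  then obtain r where r: "r > 0" "\<And>x. dist x p < r \<Longrightarrow> dist (?DD x) (?DD p) < \<epsilon>"
    using \<open>\<epsilon> > 0\<close> unfolding continuous_at_eps_delta by blast
  define \<delta> where "\<delta> = r / (norm v + norm w + 1)"
  have "\<delta> > 0" using r by (auto simp: \<delta>_def intro!: divide_pos_pos add_nonneg_pos)
  moreover have "\<bar>(f (p + h *\<^sub>R v + h *\<^sub>R w) - f (p + h *\<^sub>R v) - f (p + h *\<^sub>R w) + f p) / h\<^sup>2 - ?DD p\<bar> < \<epsilon>"
    if h: "0 < h" "h < \<delta>" for h
  proof -
    have "\<exists>s>0. s < h \<and> (f (p + h *\<^sub>R w + h *\<^sub>R v) - f (p + h *\<^sub>R v)) - (f (p + h *\<^sub>R w + 0 *\<^sub>R v) - f (p + 0 *\<^sub>R v))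
        = (h - 0) * (?D (p + h *\<^sub>R w + s *\<^sub>R v) - ?D (p + s *\<^sub>R v))"
      by (rule MVT2[OF h(1)]) (intro DERIV_diff has_real_derivative_along_line d1)
    then obtain s where s: "0 < s" "s < h"
      "(f (p + h *\<^sub>R w + h *\<^sub>R v) - f (p + h *\<^sub>R v)) - (f (p + h *\<^sub>R w) - f p)
        = h * (?D (p + h *\<^sub>R w + s *\<^sub>R v) - ?D (p + s *\<^sub>R v))"
      by auto
    have "\<exists>t>0. t < h \<and> ?D (p + s *\<^sub>R v + h *\<^sub>R w) - ?D (p + s *\<^sub>R v + 0 *\<^sub>R w) = (h - 0) * ?DD (p + s *\<^sub>R v + t *\<^sub>R w)"
      by (rule MVT2[OF h(1)]) (intro has_real_derivative_along_line d2)
    then obtain t where t: "0 < t" "t < h"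
      "?D (p + s *\<^sub>R v + h *\<^sub>R w) - ?D (p + s *\<^sub>R v) = h * ?DD (p + s *\<^sub>R v + t *\<^sub>R w)" by auto
    have eq: "(f (p + h *\<^sub>R v + h *\<^sub>R w) - f (p + h *\<^sub>R v) - f (p + h *\<^sub>R w) + f p) / h\<^sup>2
       = ?DD (p + s *\<^sub>R v + t *\<^sub>R w)"
      using s(3) t(3) h(1) by (simp add: field_simps power2_eq_square add.assoc add.commute add.left_commute)
    have "dist (p + s *\<^sub>R v + t *\<^sub>R w) p = norm (s *\<^sub>R v + t *\<^sub>R w)"
      by (simp add: dist_norm)
    also have "\<dots> \<le> s * norm v + t * norm w"
      using s(1) t(1) by (intro order_trans[OF norm_triangle_ineq]) simp
    also have "\<dots> \<le> h * norm v + h * norm w"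
      using s t by (intro add_mono mult_right_mono) auto
    also have "\<dots> < h * (norm v + norm w + 1)" using h by (simp add: algebra_simps)
    also have "\<dots> \<le> \<delta> * (norm v + norm w + 1)" using h by (intro mult_right_mono) auto
    also have "\<dots> = r" unfolding \<delta>_def by (simp add: add_nonneg_pos order_less_imp_not_eq2)
    finally show ?thesis unfolding eq using r(2) by (simp add: dist_real_def)
  qed
  ultimately show ?thesis by blast
qed

text \<open>Both mixed derivatives are limits of the same quotient, since the second difference is
  symmetric in v and w.\<close>

lemma frechet_derivative_sym_real:
  fixes f :: "'a::euclidean_space \<Rightarrow> real"
  assumes f: "Ck 2 f"
  shows "frechet_derivative (\<lambda>p. frechet_derivative f (at p) v) (at p) w
    = frechet_derivative (\<lambda>p. frechet_derivative f (at p) w) (at p) v" (is "?a = ?b")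
proof (rule ccontr)
  assume "?a \<noteq> ?b"
  then have e: "\<bar>?a - ?b\<bar> / 2 > 0" by simp
  define q where "q h = (f (p + h *\<^sub>R v + h *\<^sub>R w) - f (p + h *\<^sub>R v) - f (p + h *\<^sub>R w) + f p) / h\<^sup>2" for h
  have q2: "q h = (f (p + h *\<^sub>R w + h *\<^sub>R v) - f (p + h *\<^sub>R w) - f (p + h *\<^sub>R v) + f p) / h\<^sup>2" for h
    by (simp add: q_def algebra_simps)
  obtain d1 where d1: "d1 > 0" "\<And>h. 0 < h \<Longrightarrow> h < d1 \<Longrightarrow> \<bar>q h - ?a\<bar> < \<bar>?a - ?b\<bar> / 2"
    using second_difference_limit[OF f e, of p v w] unfolding q_def by blast
  obtain d2 where d2: "d2 > 0" "\<And>h. 0 < h \<Longrightarrow> h < d2 \<Longrightarrow> \<bar>q h - ?b\<bar> < \<bar>?a - ?b\<bar> / 2"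
    using second_difference_limit[OF f e, of p w v] unfolding q2 by blast
  define h where "h = min d1 d2 / 2"
  have "0 < h" "h < d1" "h < d2" using d1(1) d2(1) by (auto simp: h_def min_def)
  then show False using d1(2)[of h] d2(2)[of h] by (auto simp: abs_if split: if_splits)
qed

lemma frechet_derivative_bounded_linear_compose:
  "bounded_linear h \<Longrightarrow> f differentiable (at p) \<Longrightarrow>
    frechet_derivative (\<lambda>p. h (f p)) (at p) v = h (frechet_derivative f (at p) v)"
  by (rule frechet_derivative_apply[OF bounded_linear.has_derivative[OF _ has_derivative_frechet]])

lemma frechet_derivative_sym:
  fixes f :: "'a::euclidean_space \<Rightarrow> complex"
  assumes f: "smooth f"
  shows "frechet_derivative (\<lambda>p. frechet_derivative f (at p) v) (at p) w
    = frechet_derivative (\<lambda>p. frechet_derivative f (at p) w) (at p) v"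
proof -
  have *: "h (frechet_derivative (\<lambda>p. frechet_derivative f (at p) v) (at p) w)
    = h (frechet_derivative (\<lambda>p. frechet_derivative f (at p) w) (at p) v)"
    if h: "bounded_linear h" for h :: "complex \<Rightarrow> real"
  proof -
    have "smooth (\<lambda>p. h (f p))" by (rule smooth_bounded_linear_compose[OF h f])
    then have "Ck 2 (\<lambda>p. h (f p))" unfolding smooth_def by (rule spec)
    note sym = frechet_derivative_sym_real[OF this, of v p w]
    have 1: "(\<lambda>p. frechet_derivative (\<lambda>p. h (f p)) (at p) v) = (\<lambda>p. h (frechet_derivative f (at p) v))" for v
      by (intro ext frechet_derivative_bounded_linear_compose h smooth_differentiable f)
    have 2: "frechet_derivative (\<lambda>p. h (frechet_derivative f (at p) v)) (at p) w
        = h (frechet_derivative (\<lambda>p. frechet_derivative f (at p) v) (at p) w)" for v w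
      by (rule frechet_derivative_bounded_linear_compose[OF h smooth_differentiable[OF smooth_frechet[OF f]]])
    show ?thesis using sym unfolding 1 2 .
  qed
  show ?thesis using *[OF bounded_linear_Re] *[OF bounded_linear_Im] by (rule complex_eqI)
qed

section \<open>The ring of smooth functions on the Heisenberg group\<close>

abbreviation (input) DD where "DD f v w p \<equiv> frechet_derivative (\<lambda>p. frechet_derivative f (at p) v) (at p) w"

lemma frechet_derivative_mult:
  fixes f g :: "'a::euclidean_space \<Rightarrow> 'b::real_normed_algebra"
  assumes "f differentiable (at p)" "g differentiable (at p)"
  shows "frechet_derivative (\<lambda>p. f p * g p) (at p) v
    = frechet_derivative f (at p) v * g p + f p * frechet_derivative g (at p) v"
  using frechet_derivative_apply[OF has_derivative_mult[OF assms[THEN has_derivative_frechet]]]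
  by (simp add: add.commute)

lemma frechet_derivative_add:
  assumes "f differentiable (at p)" "g differentiable (at p)"
  shows "frechet_derivative (\<lambda>p. f p + g p) (at p) v
    = frechet_derivative f (at p) v + frechet_derivative g (at p) v"
  using frechet_derivative_apply[OF has_derivative_add[OF assms[THEN has_derivative_frechet]]] .

lemma bounded_linear_cnj_component: "bounded_linear (\<lambda>p::'n::finite heis. cnj (fst p $ a))"
  by (intro bounded_linear_compose[OF bounded_linear_cnj] bounded_linear_compose[OF bounded_linear_vec_nth] bounded_linear_fst)

lemma bounded_linear_component: "bounded_linear (\<lambda>p::'n::finite heis. fst p $ a)"
  by (intro bounded_linear_compose[OF bounded_linear_vec_nth] bounded_linear_fst)

text \<open>A sum of products of constants, coordinates and directional derivatives is the shape to
  which the closure rules and the product rule apply by unification.\<close>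

lemma Z_eq: "Z a f = (\<lambda>p. (1/2) * frechet_derivative f (at p) (axis a 1, 0)
    + (- \<i>/2) * frechet_derivative f (at p) (axis a \<i>, 0)
    + \<i> * (cnj (fst p $ a) * frechet_derivative f (at p) (0, 1)))"
  by (auto simp: Z_def d_z_def d_t_def field_simps)

lemma Zbar_eq: "Zbar a f = (\<lambda>p. (1/2) * frechet_derivative f (at p) (axis a 1, 0)
    + (\<i>/2) * frechet_derivative f (at p) (axis a \<i>, 0)
    + (- \<i>) * (fst p $ a * frechet_derivative f (at p) (0, 1)))"
  by (auto simp: Zbar_def d_zbar_def d_t_def field_simps)

lemma smooth_Z: "smooth f \<Longrightarrow> smooth (Z a f)"
  unfolding Z_eq
  by (rule smooth_add[OF smooth_add[OF smooth_mult[OF smooth_const smooth_frechet] smooth_mult[OF smooth_const smooth_frechet]]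
        smooth_mult[OF smooth_const smooth_mult[OF smooth_bounded_linear[OF bounded_linear_cnj_component] smooth_frechet]]])

lemma smooth_Zbar: "smooth f \<Longrightarrow> smooth (Zbar a f)"
  unfolding Zbar_eq
  by (rule smooth_add[OF smooth_add[OF smooth_mult[OF smooth_const smooth_frechet] smooth_mult[OF smooth_const smooth_frechet]]
        smooth_mult[OF smooth_const smooth_mult[OF smooth_bounded_linear[OF bounded_linear_component] smooth_frechet]]])

lemma smooth_d_t: "smooth f \<Longrightarrow> smooth (d_t f)"
  unfolding d_t_def by (rule smooth_frechet)

lemma
  assumes "f differentiable (at p)" "g differentiable (at p)"
  shows Z_add: "Z a (\<lambda>p. f p + g p) p = Z a f p + Z a g p"
    and Zbar_add: "Zbar a (\<lambda>p. f p + g p) p = Zbar a f p + Zbar a g p"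
    and d_t_add: "d_t (\<lambda>p. f p + g p) p = d_t f p + d_t g p"
    and Z_mult: "Z a (\<lambda>p. f p * g p) p = Z a f p * g p + f p * Z a g p"
    and Zbar_mult: "Zbar a (\<lambda>p. f p * g p) p = Zbar a f p * g p + f p * Zbar a g p"
    and d_t_mult: "d_t (\<lambda>p. f p * g p) p = d_t f p * g p + f p * d_t g p"
  using assms
  by (auto simp: Z_def Zbar_def d_t_def d_z_def d_zbar_def frechet_derivative_add frechet_derivative_mult
      add_divide_distrib diff_divide_distrib algebra_simps)

lemma
  shows Z_const: "Z a (\<lambda>p. c) p = 0"
    and Zbar_const: "Zbar a (\<lambda>p. c) p = 0"
    and d_t_const: "d_t (\<lambda>p. c) p = 0"
  by (auto simp: Z_def Zbar_def d_t_def d_z_def d_zbar_def)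

lemma
  assumes "f differentiable (at p)"
  shows Zbar_cnj: "Zbar a (\<lambda>p. cnj (f p)) p = cnj (Z a f p)"
    and Z_cnj: "Z a (\<lambda>p. cnj (f p)) p = cnj (Zbar a f p)"
    and d_t_cnj: "d_t (\<lambda>p. cnj (f p)) p = cnj (d_t f p)"
  using assms
  by (auto simp: Z_def Zbar_def d_t_def d_z_def d_zbar_def
      frechet_derivative_bounded_linear_compose[OF bounded_linear_cnj])

lemma
  assumes "f differentiable (at p)" "(h has_field_derivative h') (at (f p))"
  shows Z_compose: "Z a (\<lambda>p. h (f p)) p = h' * Z a f p"
    and Zbar_compose: "Zbar a (\<lambda>p. h (f p)) p = h' * Zbar a f p"
    and d_t_compose: "d_t (\<lambda>p. h (f p)) p = h' * d_t f p"
proof -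
  have "frechet_derivative (\<lambda>p. h (f p)) (at p) v = h' * frechet_derivative f (at p) v" for v
    by (rule frechet_derivative_apply[OF has_derivative_field_compose[OF has_derivative_frechet]]) (use assms in auto)
  then show "Z a (\<lambda>p. h (f p)) p = h' * Z a f p" "Zbar a (\<lambda>p. h (f p)) p = h' * Zbar a f p"
    "d_t (\<lambda>p. h (f p)) p = h' * d_t f p"
    by (auto simp: Z_def Zbar_def d_t_def d_z_def d_zbar_def algebra_simps)
qed

lemma frechet_derivative_Z:
  assumes f: "smooth f"
  shows "frechet_derivative (Z a f) (at p) v = (DD f (axis a 1, 0) v p - \<i> * DD f (axis a \<i>, 0) v p) / 2
    + \<i> * (cnj (fst v $ a) * frechet_derivative f (at p) (0, 1) + cnj (fst p $ a) * DD f (0, 1) v p)"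
proof -
  note d = has_derivative_frechet[OF smooth_differentiable[OF smooth_frechet[OF f]]]
  show ?thesis unfolding Z_eq
    apply (rule trans[OF frechet_derivative_apply])
     apply (rule has_derivative_add[OF has_derivative_add[OF has_derivative_mult_right[OF d] has_derivative_mult_right[OF d]]
         has_derivative_mult_right[OF has_derivative_mult[OF bounded_linear_imp_has_derivative[OF bounded_linear_cnj_component] d]]])
    by (simp add: field_simps)
qed

lemma frechet_derivative_Zbar:
  assumes f: "smooth f"
  shows "frechet_derivative (Zbar a f) (at p) v = (DD f (axis a 1, 0) v p + \<i> * DD f (axis a \<i>, 0) v p) / 2
    - \<i> * (fst v $ a * frechet_derivative f (at p) (0, 1) + fst p $ a * DD f (0, 1) v p)"
proof -
  note d = has_derivative_frechet[OF smooth_differentiable[OF smooth_frechet[OF f]]]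
  show ?thesis unfolding Zbar_eq
    apply (rule trans[OF frechet_derivative_apply])
     apply (rule has_derivative_add[OF has_derivative_add[OF has_derivative_mult_right[OF d] has_derivative_mult_right[OF d]]
         has_derivative_mult_right[OF has_derivative_mult[OF bounded_linear_imp_has_derivative[OF bounded_linear_component] d]]])
    by (simp add: field_simps)
qed

lemma axis_nth_eq: "axis a x $ b = (if a = b then x else 0)"
  by (auto simp: axis_def)

text \<open>Second derivatives of f commute, so a commutator can come only from differentiating
  coefficients. Z_a acts on z_b, and Zbar_b on the conjugate of z_a, only when a = b, and the two
  contributions add up to 2 i T. Z does not see conjugate coordinates, and no coefficient depends on
  t, so the other two commutators vanish.\<close>

lemma
  assumes f: "smooth f"
  shows Zbar_Z: "Zbar b (Z a f) p = Z a (Zbar b f) p + (if a = b then 2 * \<i> * d_t f p else 0)"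
    and Z_Z: "Z a (Z b f) p = Z b (Z a f) p"
    and d_t_Z: "d_t (Z a f) p = Z a (d_t f) p"
proof -
  \<comment> \<open>These instances are oriented: they bring mixed derivatives to a single order,
    the t direction innermost, then a, then b.\<close>
  note s = frechet_derivative_sym[OF f, of "(axis b 1, 0)" p "(axis a 1, 0)"]
    frechet_derivative_sym[OF f, of "(axis b 1, 0)" p "(axis a \<i>, 0)"]
    frechet_derivative_sym[OF f, of "(axis b \<i>, 0)" p "(axis a 1, 0)"]
    frechet_derivative_sym[OF f, of "(axis b \<i>, 0)" p "(axis a \<i>, 0)"]
    frechet_derivative_sym[OF f, of "(axis b 1, 0)" p "(0, 1)"]
    frechet_derivative_sym[OF f, of "(axis b \<i>, 0)" p "(0, 1)"]
    frechet_derivative_sym[OF f, of "(axis a 1, 0)" p "(0, 1)"]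
    frechet_derivative_sym[OF f, of "(axis a \<i>, 0)" p "(0, 1)"]
  show "Zbar b (Z a f) p = Z a (Zbar b f) p + (if a = b then 2 * \<i> * d_t f p else 0)"
    unfolding Zbar_eq[of b "Z a f"] Z_eq[of a "Zbar b f"] frechet_derivative_Z[OF f] frechet_derivative_Zbar[OF f] s d_t_def
    by (auto simp: axis_nth_eq field_simps)
  show "Z a (Z b f) p = Z b (Z a f) p"
    unfolding Z_eq[of a "Z b f"] Z_eq[of b "Z a f"] frechet_derivative_Z[OF f] s
    by (auto simp: axis_nth_eq field_simps)
  show "d_t (Z a f) p = Z a (d_t f) p"
    unfolding d_t_def Z_eq[of a "\<lambda>p. frechet_derivative f (at p) (0, 1)"] frechet_derivative_Z[OF f] s
    by (auto simp: axis_nth_eq field_simps)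
qed

text \<open>Packing smoothness into a type makes the differentiation rules unconditional ring
  identities.\<close>

typedef ('n::finite) sfun = "{f :: 'n heis \<Rightarrow> complex. smooth f}"
  morphisms ev sfun
  by (auto intro!: exI[of _ "\<lambda>p. 0"] smooth_const)

setup_lifting type_definition_sfun

lemma smooth_ev: "smooth (ev f)"
  using ev by blast

lemma ev_sfun: "smooth f \<Longrightarrow> ev (sfun f) = f"
  by (simp add: sfun_inverse)

instantiation sfun :: (finite) comm_ring_1
begin

lift_definition zero_sfun :: "'a sfun" is "\<lambda>p. 0" by (rule smooth_const)
lift_definition one_sfun :: "'a sfun" is "\<lambda>p. 1" by (rule smooth_const)
lift_definition plus_sfun :: "'a sfun \<Rightarrow> 'a sfun \<Rightarrow> 'a sfun" is "\<lambda>f g p. f p + g p" by (rule smooth_add)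
lift_definition minus_sfun :: "'a sfun \<Rightarrow> 'a sfun \<Rightarrow> 'a sfun" is "\<lambda>f g p. f p - g p" by (rule smooth_diff)
lift_definition uminus_sfun :: "'a sfun \<Rightarrow> 'a sfun" is "\<lambda>f p. - f p" by (rule smooth_minus)
lift_definition times_sfun :: "'a sfun \<Rightarrow> 'a sfun \<Rightarrow> 'a sfun" is "\<lambda>f g p. f p * g p" by (rule smooth_mult)

instance
  by (standard; transfer) (auto simp: algebra_simps fun_eq_iff)

end

lift_definition sZ :: "'n \<Rightarrow> 'n::finite sfun \<Rightarrow> 'n sfun" is Z by (rule smooth_Z)
lift_definition sZb :: "'n \<Rightarrow> 'n::finite sfun \<Rightarrow> 'n sfun" is Zbar by (rule smooth_Zbar)
lift_definition sT :: "'n::finite sfun \<Rightarrow> 'n sfun" is d_t by (rule smooth_d_t)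
lift_definition scnj :: "'n::finite sfun \<Rightarrow> 'n sfun" is "\<lambda>f p. cnj (f p)"
  by (rule smooth_bounded_linear_compose[OF bounded_linear_cnj])
lift_definition sconst :: "complex \<Rightarrow> 'n::finite sfun" is "\<lambda>c p. c" by (rule smooth_const)

lemma sfun_eqI: "(\<And>p. ev f p = ev g p) \<Longrightarrow> f = g"
  by (metis ev_inject ext)

lemma
  shows ev_zero: "ev 0 p = 0" and ev_one: "ev 1 p = 1"
    and ev_add: "ev (f + g) p = ev f p + ev g p"
    and ev_diff: "ev (f - g) p = ev f p - ev g p"
    and ev_minus: "ev (- f) p = - ev f p"
    and ev_mult: "ev (f * g) p = ev f p * ev g p"
    and ev_scnj: "ev (scnj f) p = cnj (ev f p)"
    and ev_sconst: "ev (sconst k) p = k"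
    and ev_sZ: "ev (sZ a f) p = Z a (ev f) p"
    and ev_sZb: "ev (sZb a f) p = Zbar a (ev f) p"
    and ev_sT: "ev (sT f) p = d_t (ev f) p"
  by (transfer, simp)+

lemma ev_of_nat: "ev (of_nat k) p = of_nat k"
  by (induction k) (auto simp: ev_zero ev_one ev_add)

lemma ev_numeral: "ev (numeral k) p = numeral k"
  using ev_of_nat[of "numeral k"] by simp

lemma ev_sum: "ev (sum f S) p = (\<Sum>x\<in>S. ev (f x) p)"
  by (induction S rule: infinite_finite_induct) (auto simp: ev_zero ev_add)

lemmas ev_simps = ev_zero ev_one ev_add ev_diff ev_minus ev_mult ev_scnj ev_sconst ev_of_nat ev_numeral ev_sum

interpretation heis: cr_calculus "sZ :: 'n::finite \<Rightarrow> 'n sfun \<Rightarrow> 'n sfun" sZb sT scnj "sconst \<i>"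
proof
  fix a b :: 'n and x y :: "'n sfun"
  note d = smooth_differentiable
  show "sZ a (x + y) = sZ a x + sZ a y"
    by transfer (auto simp: Z_add d)
  show "sZ a (x * y) = sZ a x * y + x * sZ a y"
    by transfer (auto simp: Z_mult d)
  show "sT (x + y) = sT x + sT y"
    by transfer (auto simp: d_t_add d)
  show "sT (x * y) = sT x * y + x * sT y"
    by transfer (auto simp: d_t_mult d)
  show "scnj (x + y) = scnj x + scnj y" "scnj (x * y) = scnj x * scnj y" "scnj (scnj x) = x"
    by (transfer, simp)+
  show "scnj (sZ a x) = sZb a (scnj x)"
    by transfer (auto simp: Zbar_cnj d)
  show "scnj (sT x) = sT (scnj x)"
    by transfer (auto simp: d_t_cnj d)
  show "sconst \<i> * sconst \<i> = (- 1 :: 'n sfun)" "scnj (sconst \<i>) = - sconst \<i>"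
    by (transfer, simp)+
  show "sZ a (sconst \<i>) = 0" by transfer (auto simp: Z_const)
  show "sT (sconst \<i>) = 0" by transfer (auto simp: d_t_const)
  show "sZb b (sZ a x) = sZ a (sZb b x) + (if a = b then 2 * sconst \<i> * sT x else 0)"
    by (rule sfun_eqI) (auto simp: ev_simps ev_sZ[abs_def] ev_sZb[abs_def] ev_sT[abs_def] Zbar_Z[OF smooth_ev])
  show "sZ a (sZ b x) = sZ b (sZ a x)"
    by transfer (auto simp: Z_Z)
  show "sT (sZ a x) = sZ a (sT x)"
    by transfer (auto simp: d_t_Z)
qed

section \<open>Integration by parts and cutoffs\<close>

text \<open>From exponent two on, the truncated power is C^1: at 0 its difference quotient is at
  most |h|^(k + 1).\<close>

lemma has_real_derivative_max0_power:
  "((\<lambda>x::real. max 0 x ^ Suc (Suc k)) has_real_derivative real (Suc (Suc k)) * max 0 x ^ Suc k) (at x)"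
proof -
  consider "x > 0" | "x < 0" | "x = 0" by linarith
  then show ?thesis
  proof cases
    case 1
    have "((\<lambda>x::real. x ^ Suc (Suc k)) has_real_derivative real (Suc (Suc k)) * max 0 x ^ Suc k) (at x)"
      using DERIV_pow[of "Suc (Suc k)" x] 1 by (simp add: max_def)
    then show ?thesis
      by (rule has_field_derivative_transform_within[of _ _ _ _ x]) (use 1 in \<open>auto simp: dist_real_def max_def abs_if split: if_splits\<close>)
  next
    case 2
    have "((\<lambda>x::real. 0) has_real_derivative real (Suc (Suc k)) * max 0 x ^ Suc k) (at x)"
      using 2 by (auto simp: max_def)
    then show ?thesis
      by (rule has_field_derivative_transform_within[of _ _ _ _ "- x"]) (use 2 in \<open>auto simp: dist_real_def max_def abs_if split: if_splits\<close>)
  next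
    case 3
    have "((\<lambda>h::real. max 0 h ^ Suc (Suc k) / h) \<longlongrightarrow> 0) (at 0)"
    proof (rule Lim_null_comparison)
      show "((\<lambda>h::real. \<bar>h\<bar> ^ Suc k) \<longlongrightarrow> 0) (at 0)"
        by (rule tendsto_eq_intros | simp)+
      show "\<forall>\<^sub>F h::real in at 0. norm (max 0 h ^ Suc (Suc k) / h) \<le> \<bar>h\<bar> ^ Suc k"
      proof (intro always_eventually allI)
        fix h :: real
        show "norm (max 0 h ^ Suc (Suc k) / h) \<le> \<bar>h\<bar> ^ Suc k"
        proof (cases "h > 0")
          case False
          then have "norm (max 0 h ^ Suc (Suc k) / h) = 0" by simp
          then show ?thesis using zero_le_power[OF abs_ge_zero, of h "Suc k"] by linarith
        qed simp
      qed
    qed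
    then show ?thesis using 3 by (simp add: DERIV_def)
  qed
qed

text \<open>The derivative is the limit of difference quotients with step 1 / (k + 1), whose
  integrals vanish by translation invariance. They are dominated by a bound for the derivative on
  the ball of radius r + |v|, which contains their supports because the step is at most 1.\<close>

lemma integral_frechet_derivative_compact_support:
  fixes F :: "'a::euclidean_space \<Rightarrow> real"
  assumes F: "Ck (Suc 0) F" and supp: "\<And>x. norm x > r \<Longrightarrow> F x = 0"
  shows "integrable lborel (\<lambda>x. frechet_derivative F (at x) v)"
    and "integral\<^sup>L lborel (\<lambda>x. frechet_derivative F (at x) v) = 0"
proof -
  let ?D = "\<lambda>x. frechet_derivative F (at x) v"
  have d: "\<And>x. F differentiable (at x)" and cD: "continuous_on UNIV ?D"
    using F by auto
  have cF: "continuous_on UNIV F" using Ck_Suc_imp_Ck[OF F] by simp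
  have D0: "?D x = 0" if x: "norm x > r" for x
  proof -
    have "open {x::'a. norm x > r}" by (intro open_Collect_less continuous_intros)
    then obtain \<epsilon> where \<epsilon>: "\<epsilon> > 0" "ball x \<epsilon> \<subseteq> {x. norm x > r}" by (rule openE[of _ x]) (use x in auto)
    have "((\<lambda>x. 0) has_derivative (\<lambda>v. 0)) (at x)" by simp
    then have "(F has_derivative (\<lambda>v. 0)) (at x)"
      by (rule has_derivative_transform_within[OF _ \<epsilon>(1)]) (use \<epsilon>(2) supp in \<open>auto simp: dist_commute subset_iff\<close>)
    from frechet_derivative_apply[OF this] show ?thesis .
  qed
  have "bounded (?D ` cball 0 r)"
    by (intro compact_imp_bounded compact_continuous_image continuous_on_subset[OF cD]) auto
  then obtain B0 where "\<And>x. x \<in> cball 0 r \<Longrightarrow> \<bar>?D x\<bar> \<le> B0"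
    unfolding bounded_iff by force
  \<comment> \<open>Outside the ball the derivative is 0, so its bound must be nonnegative; the
    bound \<open>B0\<close> need not be, as the ball is empty for r < 0.\<close>
  then have B: "\<bar>?D x\<bar> \<le> max B0 0" for x
    using D0[of x] by (cases "norm x > r") (auto simp: le_max_iff_disj)
  define B where "B = max B0 0"
  let ?q = "\<lambda>(k::nat) x. (F (x + (1 / Suc k) *\<^sub>R v) - F x) * Suc k"
  let ?w = "\<lambda>x. B * indicator (cball (0::'a) (r + norm v)) x"
  have iw: "integrable lborel ?w"
    using emeasure_lborel_cball_finite[of "0::'a" "r + norm v"]
    by (intro integrable_mult_right integrable_real_indicator) auto
  have iF: "integrable lborel F"
  proof -
    have "integrable lborel (\<lambda>x. indicator (cball 0 r) x *\<^sub>R F x)"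
      by (rule borel_integrable_compact) (auto intro: continuous_on_subset[OF cF])
    moreover have "(\<lambda>x. indicator (cball 0 r) x *\<^sub>R F x) = F"
      using supp by (auto simp: indicator_def fun_eq_iff)
    ultimately show ?thesis by simp
  qed
  have itr: "integrable lborel (\<lambda>x. F (x + u))" "integral\<^sup>L lborel (\<lambda>x. F (x + u)) = integral\<^sup>L lborel F" for u
  proof -
    have eq: "distr lborel borel ((+) u) = (lborel :: 'a measure)" by (simp add: lborel_distr_plus)
    have "integrable (distr lborel borel ((+) u)) F" unfolding eq by (rule iF)
    then show "integrable lborel (\<lambda>x. F (x + u))"
      by (subst (asm) integrable_distr_eq) (auto simp: add.commute borel_measurable_continuous_onI[OF cF])
    have "integral\<^sup>L lborel F = integral\<^sup>L (distr lborel borel ((+) u)) F" unfolding eq ..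
    also have "\<dots> = integral\<^sup>L lborel (\<lambda>x. F (x + u))"
      by (subst integral_distr) (auto simp: add.commute borel_measurable_continuous_onI[OF cF])
    finally show "integral\<^sup>L lborel (\<lambda>x. F (x + u)) = integral\<^sup>L lborel F" by simp
  qed
  have lim: "(\<lambda>k. ?q k x) \<longlonglongrightarrow> ?D x" for x
  proof -
    have "((\<lambda>s. F (x + s *\<^sub>R v)) has_real_derivative ?D x) (at 0)"
      using has_real_derivative_along_line[of F x v 0] d by simp
    then have "((\<lambda>h. (F (x + h *\<^sub>R v) - F x) / h) \<longlongrightarrow> ?D x) (at 0)" by (simp add: DERIV_def)
    moreover have "filterlim (\<lambda>k. 1 / real (Suc k)) (at 0) sequentially"
      using LIMSEQ_inverse_real_of_nat
      by (auto simp: filterlim_at inverse_eq_divide)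
    ultimately have "(\<lambda>k. (F (x + (1 / real (Suc k)) *\<^sub>R v) - F x) / (1 / real (Suc k))) \<longlonglongrightarrow> ?D x"
      by (rule filterlim_compose)
    then show ?thesis by simp
  qed
  have bound: "norm (?q k x) \<le> ?w x" for k x
  proof (cases "norm x \<le> r + norm v")
    case True
    have "0 < 1 / real (Suc k)" by simp
    from MVT2[OF this has_real_derivative_along_line[OF d]]
    obtain s where "F (x + (1 / real (Suc k)) *\<^sub>R v) - F (x + 0 *\<^sub>R v) = (1 / real (Suc k) - 0) * ?D (x + s *\<^sub>R v)" by blast
    then have "?q k x = ?D (x + s *\<^sub>R v)" by (simp add: field_simps)
    then show ?thesis using B[of "x + s *\<^sub>R v"] True by (simp add: B_def)
  next
    case False
    have "norm ((1 / real (Suc k)) *\<^sub>R v) \<le> norm v"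
      by (simp add: divide_le_eq mult_le_cancel_left1)
    then have "norm (x + (1 / real (Suc k)) *\<^sub>R v) > r"
      using False norm_triangle_ineq4[of "x + (1 / real (Suc k)) *\<^sub>R v" "(1 / real (Suc k)) *\<^sub>R v"] by simp
    moreover have "norm x > r" using False norm_ge_zero[of v] by linarith
    ultimately show ?thesis using supp False by simp
  qed
  have m: "?D \<in> borel_measurable lborel" "\<And>k. ?q k \<in> borel_measurable lborel"
  proof -
    show "?D \<in> borel_measurable lborel" using borel_measurable_continuous_onI[OF cD] by simp
    have "(\<lambda>x. F (x + u)) \<in> borel_measurable lborel" for u using itr(1)[of u] by auto
    then show "?q k \<in> borel_measurable lborel" for k using iF by auto
  qed
  have q0: "integral\<^sup>L lborel (?q k) = 0" for k
    using itr iF by simp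
  show "integrable lborel ?D"
    by (rule integrable_dominated_convergence[where s = "\<lambda>k. ?q k", OF m iw]) (use lim bound in auto)
  have "(\<lambda>k. integral\<^sup>L lborel (?q k)) \<longlonglongrightarrow> integral\<^sup>L lborel ?D"
    by (rule integral_dominated_convergence[where s = "\<lambda>k. ?q k", OF m iw]) (use lim bound in auto)
  then show "integral\<^sup>L lborel ?D = 0" unfolding q0 by (simp add: LIMSEQ_const_iff)
qed

text \<open>The coefficient z_a does not depend on t and can be moved under the t derivative. The
  integrand thus becomes a combination of directional derivatives of real functions of compact
  support.\<close>

lemma integral_Re_Zbar_compact_support:
  fixes H :: "'n::finite heis \<Rightarrow> complex"
  assumes H: "Ck (Suc 0) H" and supp: "\<And>x. norm x > r \<Longrightarrow> H x = 0"
  shows "integrable lborel (\<lambda>p. Re (Zbar a H p))" "integral\<^sup>L lborel (\<lambda>p. Re (Zbar a H p)) = 0"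
proof -
  let ?H1 = "\<lambda>p. Re (H p)" and ?H2 = "\<lambda>p. Im (H p)" and ?H3 = "\<lambda>p. Im (fst p $ a * H p)"
  have C: "Ck (Suc 0) ?H1" "Ck (Suc 0) ?H2" "Ck (Suc 0) ?H3"
    by (rule Ck_bounded_linear_compose[OF bounded_linear_Re H] Ck_bounded_linear_compose[OF bounded_linear_Im H]
       Ck_bounded_linear_compose[OF bounded_linear_Im Ck_mult[OF Ck_bounded_linear[OF bounded_linear_component] H]])+
  have d: "H differentiable (at p)" for p by (rule Ck_differentiable[OF H])
  have dz: "(\<lambda>p::'n heis. fst p $ a) differentiable (at p)" for p
    using bounded_linear_imp_has_derivative[OF bounded_linear_component] differentiable_def by blast
  have z: "frechet_derivative (\<lambda>p::'n heis. fst p $ a) (at p) (0, 1) = 0" for p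
    by (subst frechet_derivative_apply[OF bounded_linear_imp_has_derivative[OF bounded_linear_component]]) simp
  have eq: "Re (Zbar a H p) = frechet_derivative ?H1 (at p) (axis a 1, 0) / 2
     - frechet_derivative ?H2 (at p) (axis a \<i>, 0) / 2 + frechet_derivative ?H3 (at p) (0, 1)" for p
  proof -
    have "frechet_derivative ?H3 (at p) (0, 1) = Im (fst p $ a * frechet_derivative H (at p) (0, 1))"
      using frechet_derivative_bounded_linear_compose[OF bounded_linear_Im differentiable_mult[OF dz d]]
      by (simp add: frechet_derivative_mult[OF dz d] z)
    then show ?thesis
      unfolding Zbar_eq frechet_derivative_bounded_linear_compose[OF bounded_linear_Re d]
        frechet_derivative_bounded_linear_compose[OF bounded_linear_Im d]
      by simp
  qed
  note I = integral_frechet_derivative_compact_support[of _ r]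
  have i: "integrable lborel (\<lambda>p. frechet_derivative ?H1 (at p) v)" "integral\<^sup>L lborel (\<lambda>p. frechet_derivative ?H1 (at p) v) = 0"
      "integrable lborel (\<lambda>p. frechet_derivative ?H2 (at p) v)" "integral\<^sup>L lborel (\<lambda>p. frechet_derivative ?H2 (at p) v) = 0"
      "integrable lborel (\<lambda>p. frechet_derivative ?H3 (at p) v)" "integral\<^sup>L lborel (\<lambda>p. frechet_derivative ?H3 (at p) v) = 0" for v
    by (rule I[OF C(1)] I[OF C(2)] I[OF C(3)]; simp add: supp)+
  show "integrable lborel (\<lambda>p. Re (Zbar a H p))" "integral\<^sup>L lborel (\<lambda>p. Re (Zbar a H p)) = 0"
    unfolding eq using i by simp_all
qed

text \<open>Radius R in z and R^2 in t is the scaling of the dilations; the volume R^(2 n) R^2 is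
  where the homogeneous dimension enters.\<close>

lemma measure_cylinder:
  fixes R :: real
  assumes "R \<ge> 0"
  shows "emeasure lborel (cball (0::complex^'n::finite) R \<times> cball (0::real) (R\<^sup>2)) < \<infinity>"
    and "measure lborel (cball (0::complex^'n::finite) R \<times> cball (0::real) (R\<^sup>2))
      = 2 * unit_ball_vol (2 * real CARD('n)) * R ^ hom_dim TYPE('n)"
proof -
  have e: "emeasure lborel (cball (0::complex^'n) R \<times> cball (0::real) (R\<^sup>2))
     = emeasure lborel (cball (0::complex^'n) R) * emeasure lborel (cball (0::real) (R\<^sup>2))"
    by (subst lborel_prod[symmetric], subst lborel.emeasure_pair_measure_Times) auto
  show "emeasure lborel (cball (0::complex^'n) R \<times> cball (0::real) (R\<^sup>2)) < \<infinity>"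
    unfolding e using emeasure_lborel_cball_finite[of "0::complex^'n" R] emeasure_lborel_cball_finite[of "0::real" "R\<^sup>2"]
    by (simp add: ennreal_mult_less_top)
  have "measure lborel (cball (0::complex^'n) R) = unit_ball_vol (2 * real CARD('n)) * R ^ (2 * CARD('n))"
    using content_cball[of R "0::complex^'n"] assms by (simp add: mult.commute)
  moreover have "measure lborel (cball (0::real) (R\<^sup>2)) = 2 * R\<^sup>2"
    by (simp add: cball_eq_atLeastAtMost)
  ultimately show "measure lborel (cball (0::complex^'n) R \<times> cball (0::real) (R\<^sup>2))
      = 2 * unit_ball_vol (2 * real CARD('n)) * R ^ hom_dim TYPE('n)"
    unfolding measure_def e by (simp add: enn2real_mult hom_dim_def power_add power2_eq_square)
qed


text \<open>A power of the truncation of 1 - (|z|^4 + t^2) / R^4. The exponent stays free because a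
  derivative lowers it by one, and a large exponent makes that loss harmless in the absorption
  argument.\<close>

definition cutoff :: "nat \<Rightarrow> real \<Rightarrow> 'n::finite heis \<Rightarrow> real" where
  "cutoff k R p = max 0 (1 - ((fst p \<bullet> fst p)\<^sup>2 + (snd p)\<^sup>2) / R ^ 4) ^ k"

lemma cutoff_nonneg: "cutoff k R p \<ge> 0"
  by (simp add: cutoff_def)

lemma cutoff_eq_0:
  assumes R: "R > 0" and p: "p \<notin> cball 0 R \<times> cball 0 (R\<^sup>2)" and k: "k > 0"
  shows "cutoff k R p = 0"
proof -
  have "(fst p \<bullet> fst p)\<^sup>2 + (snd p)\<^sup>2 \<ge> R ^ 4"
  proof (cases "norm (fst p) > R")
    case True
    then have "R ^ 4 \<le> norm (fst p) ^ 4" using R by (intro power_mono) auto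
    also have "norm (fst p) ^ 4 = (fst p \<bullet> fst p)\<^sup>2"
      by (simp add: dot_square_norm flip: power_mult)
    finally show ?thesis by (simp add: add_increasing2)
  next
    case False
    then have "\<bar>snd p\<bar> > R\<^sup>2" using p by (cases p) (auto simp: not_less)
    then have "(R\<^sup>2)\<^sup>2 \<le> \<bar>snd p\<bar>\<^sup>2" by (intro power_mono) auto
    then show ?thesis by (simp add: add_increasing flip: power_mult)
  qed
  then have "1 - ((fst p \<bullet> fst p)\<^sup>2 + (snd p)\<^sup>2) / R ^ 4 \<le> 0"
    using R by (simp add: divide_simps)
  then show ?thesis using k by (simp add: cutoff_def max_def)
qed

lemma cutoff_has_derivative:
  "(cutoff (Suc (Suc k)) R has_derivative (\<lambda>v. - (real (Suc (Suc k)) / R ^ 4 * cutoff (Suc k) R p)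
     * (4 * (fst p \<bullet> fst p) * (fst p \<bullet> fst v) + 2 * snd p * snd v))) (at p)"
proof -
  define c where "c = 1 / R ^ 4"
  let ?\<psi> = "\<lambda>p. 1 - ((fst p \<bullet> fst p)\<^sup>2 + (snd p)\<^sup>2) * c"
  have "(?\<psi> has_derivative (\<lambda>v. - (4 * (fst p \<bullet> fst p) * (fst p \<bullet> fst v) + 2 * snd p * snd v) * c)) (at p)"
    by (auto intro!: derivative_eq_intros simp: inner_commute algebra_simps)
  from has_derivative_field_compose[OF this has_real_derivative_max0_power]
  have "((\<lambda>p. max 0 (?\<psi> p) ^ Suc (Suc k)) has_derivative (\<lambda>v. - (real (Suc (Suc k)) * c * max 0 (?\<psi> p) ^ Suc k)
     * (4 * (fst p \<bullet> fst p) * (fst p \<bullet> fst v) + 2 * snd p * snd v))) (at p)"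
    by (rule has_derivative_eq_rhs) (simp add: fun_eq_iff algebra_simps)
  then show ?thesis by (simp add: cutoff_def[abs_def] c_def)
qed

lemma continuous_on_cutoff: "continuous_on A (cutoff k R)"
proof (cases "R = 0")
  case True
  then show ?thesis by (simp add: cutoff_def[abs_def])
next
  case False
  then show ?thesis unfolding cutoff_def[abs_def] by (intro continuous_intros) auto
qed

lemma Ck_cutoff: "Ck (Suc 0) (cutoff (Suc (Suc k)) R :: 'n::finite heis \<Rightarrow> real)"
proof (rule Ck_SucI[OF cutoff_has_derivative])
  fix v :: "'n heis"
  have "continuous_on UNIV (\<lambda>p. - (c * cutoff (Suc k) R p)
     * (4 * (fst p \<bullet> fst p) * (fst p \<bullet> fst v) + 2 * snd p * snd v))" for c
    by (intro continuous_intros continuous_on_cutoff)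
  then show "Ck 0 (\<lambda>p. - (real (Suc (Suc k)) / R ^ 4 * cutoff (Suc k) R p)
     * (4 * (fst p \<bullet> fst p) * (fst p \<bullet> fst v) + 2 * snd p * snd v))"
    unfolding Ck.simps(1) .
qed

text \<open>Zbar_a (|z|^4 + t^2) = 2 (|z|^2 - i t) z_a, a vector of length at most 2 R^3 on the
  support, against R^4 in the denominator. The conjugates match the second factor in
  \<open>Re_sum_mult_le\<close>.\<close>

lemma norm_Zbar_cutoff:
  fixes p :: "'n::finite heis"
  assumes R: "R > 0"
  shows "norm (\<chi> a. cnj (Zbar a (\<lambda>p. complex_of_real (cutoff (Suc (Suc k)) R p)) p))
    \<le> 2 * real (Suc (Suc k)) / R * cutoff (Suc k) R p"
proof -
  define \<kappa> where "\<kappa> = real (Suc (Suc k)) / R ^ 4 * cutoff (Suc k) R p"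
  have \<kappa>: "\<kappa> \<ge> 0" using R by (auto simp: \<kappa>_def cutoff_nonneg)
  let ?A = "fst p \<bullet> fst p"
  have d: "cutoff (Suc (Suc k)) R differentiable (at p)"
    using cutoff_has_derivative differentiable_def by blast
  have "Zbar a (\<lambda>p. complex_of_real (cutoff (Suc (Suc k)) R p)) p
     = - (complex_of_real (2 * \<kappa>) * (Complex ?A (- snd p))) * (fst p $ a)" for a
    unfolding Zbar_eq frechet_derivative_bounded_linear_compose[OF bounded_linear_of_real d]
      frechet_derivative_apply[OF cutoff_has_derivative] \<kappa>_def[symmetric]
    by (simp add: complex_eq_iff inner_axis inner_complex_def algebra_simps)
  then have "cnj (Zbar a (\<lambda>p. complex_of_real (cutoff (Suc (Suc k)) R p)) p)
     = cnj (- (complex_of_real (2 * \<kappa>) * (Complex ?A (- snd p)))) * cnj (fst p $ a)" for a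
    by simp
  then have "norm (\<chi> a. cnj (Zbar a (\<lambda>p. complex_of_real (cutoff (Suc (Suc k)) R p)) p))
     = 2 * \<kappa> * norm (Complex ?A (- snd p)) * norm (fst p)"
    using \<kappa> by (simp add: norm_vec_def norm_mult L2_set_right_distrib[symmetric])
  also have "\<dots> \<le> 2 * \<kappa> * R\<^sup>2 * R"
  proof (cases "\<kappa> = 0")
    case False
    then have *: "cutoff (Suc k) R p \<noteq> 0" using R by (auto simp: \<kappa>_def)
    have pos: "((fst p \<bullet> fst p)\<^sup>2 + (snd p)\<^sup>2) / R ^ 4 < 1"
    proof (rule ccontr)
      assume "\<not> ?thesis"
      then have "max 0 (1 - ((fst p \<bullet> fst p)\<^sup>2 + (snd p)\<^sup>2) / R ^ 4) = 0" by simp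
      then show False using * by (simp add: cutoff_def)
    qed
    then have "(fst p \<bullet> fst p)\<^sup>2 + (snd p)\<^sup>2 < R ^ 4" using R by (simp add: divide_simps)
    then have "(fst p \<bullet> fst p)\<^sup>2 + (snd p)\<^sup>2 \<le> (R\<^sup>2)\<^sup>2" by (simp flip: power_mult)
    then have 1: "norm (Complex ?A (- snd p)) \<le> R\<^sup>2"
      by (simp add: complex_norm real_le_lsqrt)
    have "p \<in> cball 0 R \<times> cball 0 (R\<^sup>2)" using cutoff_eq_0[OF R, of p "Suc k"] * by auto
    then have 2: "norm (fst p) \<le> R" by (cases p) auto
    show ?thesis using 1 2 \<kappa> R by (intro mult_mono) auto
  qed simp
  also have "\<dots> = 2 * real (Suc (Suc k)) / R * cutoff (Suc k) R p"
    using R by (simp add: \<kappa>_def field_simps power2_eq_square power4_eq_xxxx)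
  finally show ?thesis .
qed

text \<open>Young's inequality by cases: either the left side is at most \<epsilon> x, or x^(1/m) <
  k / \<epsilon>, and then inserting x <= (k / \<epsilon>)^m gives the second term.\<close>

lemma powr_absorb:
  fixes x k \<epsilon> m :: real
  assumes "x > 0" "k > 0" "\<epsilon> > 0" "m > 1"
  shows "k * x powr (1 - 1 / m) \<le> \<epsilon> * x + \<epsilon> * (k / \<epsilon>) powr m"
proof (cases "k * x powr (1 - 1 / m) \<le> \<epsilon> * x")
  case True
  then show ?thesis using assms by (simp add: add_increasing2)
next
  case False
  have x: "x = x powr (1 - 1 / m) * x powr (1 / m)"
    using assms by (simp flip: powr_add)
  have "\<epsilon> * x powr (1 / m) * x powr (1 - 1 / m) < k * x powr (1 - 1 / m)"
    using False x by (simp add: mult.commute mult.assoc)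
  then have "x powr (1 / m) < k / \<epsilon>" using assms by (simp add: field_simps)
  then have "(x powr (1 / m)) powr m \<le> (k / \<epsilon>) powr m"
    using assms by (intro powr_mono2) auto
  then have xM: "x \<le> (k / \<epsilon>) powr m" using assms by (simp add: powr_powr)
  have "k * x powr (1 - 1 / m) \<le> k * ((k / \<epsilon>) powr m) powr (1 - 1 / m)"
    using assms xM by (intro mult_left_mono powr_mono2) auto
  also have "((k / \<epsilon>) powr m) powr (1 - 1 / m) = (k / \<epsilon>) powr (m - 1)"
    using assms by (simp add: powr_powr algebra_simps)
  also have "k * (k / \<epsilon>) powr (m - 1) = \<epsilon> * (k / \<epsilon>) powr m"
    using assms by (simp add: powr_diff)
  finally show ?thesis using assms by (simp add: add_increasing)
qed


section \<open>A nonexistence criterion by testing with cutoffs\<close>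

lemma cutoff_le_1: "R > 0 \<Longrightarrow> cutoff k R p \<le> 1"
  unfolding cutoff_def by (intro power_le_one) auto

lemma cutoff_mono:
  assumes "0 < R" "R \<le> R'"
  shows "cutoff k R p \<le> cutoff k R' p"
proof -
  have "((fst p \<bullet> fst p)\<^sup>2 + (snd p)\<^sup>2) / R' ^ 4 \<le> ((fst p \<bullet> fst p)\<^sup>2 + (snd p)\<^sup>2) / R ^ 4"
    using assms by (intro divide_left_mono power_mono mult_pos_pos) auto
  then show ?thesis unfolding cutoff_def by (intro power_mono) auto
qed

lemma Re_sum_mult_le:
  fixes v w :: "'n::finite \<Rightarrow> complex"
  shows "\<bar>Re (\<Sum>a\<in>UNIV. v a * w a)\<bar> \<le> norm (\<chi> a. v a) * norm (\<chi> a. cnj (w a))"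
proof -
  have "Re (\<Sum>a\<in>UNIV. v a * w a) = (\<chi> a. v a) \<bullet> (\<chi> a. cnj (w a))"
    by (simp add: inner_vec_def inner_complex_def)
  then show ?thesis using Cauchy_Schwarz_ineq2 by metis
qed

lemma integrable_compact_support:
  fixes F :: "'a::euclidean_space \<Rightarrow> real"
  assumes "continuous_on UNIV F" "compact K" "\<And>x. x \<notin> K \<Longrightarrow> F x = 0"
  shows "integrable lborel F"
proof -
  have "integrable lborel (\<lambda>x. indicator K x *\<^sub>R F x)"
    by (rule borel_integrable_compact[OF assms(2)]) (use assms(1) in \<open>auto intro: continuous_on_subset\<close>)
  moreover have "(\<lambda>x. indicator K x *\<^sub>R F x) = F"
    using assms(3) by (auto simp: indicator_def fun_eq_iff)
  ultimately show ?thesis by simp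
qed

lemma integral_pos_of_continuous:
  fixes F :: "'a::euclidean_space \<Rightarrow> real"
  assumes F: "continuous_on UNIV F" "\<And>x. F x \<ge> 0" "F y > 0" and i: "integrable lborel F"
  shows "integral\<^sup>L lborel F > 0"
proof -
  have "isCont F y" using F(1) by (simp add: continuous_on_eq_continuous_at)
  then obtain d where d: "d > 0" "\<And>x. dist x y < d \<Longrightarrow> dist (F x) (F y) < F y / 2"
    using F(3) unfolding continuous_at_eps_delta by (meson half_gt_zero)
  have ge: "F y / 2 * indicator (ball y d) x \<le> F x" for x
  proof (cases "dist x y < d")
    case True
    from d(2)[OF True] have "F y / 2 \<le> F x"
      unfolding dist_real_def abs_less_iff by linarith
    then show ?thesis using True by (simp add: dist_commute)
  qed (use F(2) in \<open>auto simp: dist_commute\<close>)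
  have "0 < F y / 2 * measure lborel (ball y d)"
    using d(1) F(3) by (intro mult_pos_pos) (auto simp: content_ball_pos)
  also have "\<dots> = integral\<^sup>L lborel (\<lambda>x. F y / 2 * indicator (ball y d) x)"
    by simp
  also have "\<dots> \<le> integral\<^sup>L lborel F"
    using emeasure_lborel_ball_finite[of y d]
    by (intro integral_mono i ge integrable_mult_right integrable_real_indicator) auto
  finally show ?thesis .
qed

text \<open>The bound on W loses one factor X^(1/m) against X, and one derivative of the cutoff
  costs 1/R; absorption turns this into R^(- m), to be compared with the volume R^Q. Only C^1 is
  asked of W, because one of the fields contains b |b|.\<close>

proposition no_divergence_supersolution:
  fixes W :: "'n::finite \<Rightarrow> 'n heis \<Rightarrow> complex" and X :: "'n heis \<Rightarrow> real"
  assumes W: "\<And>a. Ck (Suc 0) (W a)" and X: "continuous_on UNIV X" "\<And>p. X p > 0" and c: "c > 0"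
    and div: "\<And>p. c * X p \<le> Re (\<Sum>a\<in>UNIV. Zbar a (W a) p)"
    and bound: "\<And>p. norm (\<chi> a. W a p) \<le> C * X p powr (1 - 1 / m)"
    and m: "m > real (hom_dim TYPE('n))"
  shows False
proof -
  \<comment> \<open>N >= m gives N (1 - 1/m) <= N - 1, so \<eta>^(N - 1), which comes from
    differentiating \<eta>^N with 0 < \<eta> <= 1, is at most (\<eta>^N)^(1 - 1/m). The product with
    X^(1 - 1/m) is then a power of \<eta>^N X.\<close>
  define N where "N = nat \<lceil>m\<rceil>"
  have m1: "m > 1" using m by (simp add: hom_dim_def)
  have N: "real N \<ge> m" "N \<ge> 2" using m1 unfolding N_def by linarith+
  obtain j where j: "N = Suc (Suc j)" using N(2) using that[of "N - 2"] by simp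
  \<comment> \<open>C may be 0; raising it to at least 1 gives k > 0, as \<open>powr_absorb\<close>
    demands.\<close>
  define C' where "C' = max C 1"
  define k where "k = 2 * C' * real N"
  have C': "C' \<ge> 1" "C \<le> C'" by (auto simp: C'_def)
  have k: "k > 0" unfolding k_def using C'(1) N(2) by (intro mult_pos_pos) linarith+
  let ?S = "\<lambda>R. cball (0::complex^'n) R \<times> cball (0::real) (R\<^sup>2)"
  let ?\<phi> = "\<lambda>R (p :: 'n heis). complex_of_real (cutoff N R p)"
  \<comment> \<open>The remainder of \<open>powr_absorb\<close> for the constant k / R and
    \<epsilon> = c / 2, without the factor c / 2; it decays like R^(- m).\<close>
  define M where "M R = (k / R / (c / 2)) powr m" for R
  have pointwise: "Re (\<Sum>a\<in>UNIV. Zbar a (\<lambda>p. ?\<phi> R p * W a p) p)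
      \<ge> c / 2 * (cutoff N R p * X p) - c / 2 * M R * indicator (?S R) p" if R: "R > 0" for R p
  proof (cases "cutoff (Suc j) R p = 0")
    case True
    have d: "?\<phi> R differentiable (at p)" "W a differentiable (at p)" for a
      unfolding j
      by (rule Ck_differentiable[OF Ck_bounded_linear_compose[OF bounded_linear_of_real Ck_cutoff]] Ck_differentiable[OF W])+
    have "Zbar a (?\<phi> R) p = 0" for a
    proof -
      have "norm (\<chi> a. cnj (Zbar a (?\<phi> R) p)) \<le> 0"
        using norm_Zbar_cutoff[OF R, of j p] True by (simp add: j)
      then have "(\<chi> a. cnj (Zbar a (?\<phi> R) p)) $ a = 0" by simp
      then show ?thesis by simp
    qed
    moreover have "cutoff N R p = 0" using True by (auto simp: cutoff_def j)
    ultimately show ?thesis using c by (simp add: Zbar_mult d M_def)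
  next
    case False
    have d: "?\<phi> R differentiable (at p)" "W a differentiable (at p)" for a
      unfolding j
      by (rule Ck_differentiable[OF Ck_bounded_linear_compose[OF bounded_linear_of_real Ck_cutoff]] Ck_differentiable[OF W])+
    define \<eta> where "\<eta> = cutoff 1 R p"
    have \<eta>: "0 < \<eta>" "\<eta> \<le> 1" using False cutoff_le_1[OF R] cutoff_nonneg[of 1 R p] by (auto simp: \<eta>_def cutoff_def)
    have cut: "cutoff i R p = \<eta> ^ i" for i by (simp add: \<eta>_def cutoff_def)
    have x: "cutoff N R p * X p > 0" using \<eta> X(2) by (simp add: cut)
    have pS: "p \<in> ?S R" using cutoff_eq_0[OF R, of p "Suc j"] False by auto
    have "Re (\<Sum>a\<in>UNIV. Zbar a (\<lambda>p. ?\<phi> R p * W a p) p)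
      = Re (\<Sum>a\<in>UNIV. W a p * Zbar a (?\<phi> R) p) + cutoff N R p * Re (\<Sum>a\<in>UNIV. Zbar a (W a) p)"
      by (simp add: Zbar_mult d sum.distrib sum_distrib_left mult.commute)
    moreover have "cutoff N R p * Re (\<Sum>a\<in>UNIV. Zbar a (W a) p) \<ge> c * (cutoff N R p * X p)"
      using mult_left_mono[OF div cutoff_nonneg] by (simp add: mult.left_commute)
    moreover have "\<bar>Re (\<Sum>a\<in>UNIV. W a p * Zbar a (?\<phi> R) p)\<bar> \<le> c / 2 * (cutoff N R p * X p) + c / 2 * M R"
    proof -
      have "\<bar>Re (\<Sum>a\<in>UNIV. W a p * Zbar a (?\<phi> R) p)\<bar>
         \<le> norm (\<chi> a. W a p) * norm (\<chi> a. cnj (Zbar a (?\<phi> R) p))"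
        by (rule Re_sum_mult_le)
      also have "\<dots> \<le> (C' * X p powr (1 - 1 / m)) * (2 * real N / R * cutoff (Suc j) R p)"
      proof (rule mult_mono)
        show "norm (\<chi> a. W a p) \<le> C' * X p powr (1 - 1 / m)"
          by (rule order_trans[OF bound]) (use C' in \<open>auto intro: mult_right_mono\<close>)
      qed (use norm_Zbar_cutoff[OF R, of j p] C' in \<open>auto simp: j\<close>)
      also have "\<dots> = k / R * (\<eta> ^ Suc j * X p powr (1 - 1 / m))"
        by (simp add: k_def cut)
      also have "\<dots> \<le> k / R * (cutoff N R p * X p) powr (1 - 1 / m)"
      proof (rule mult_left_mono)
        have "\<eta> ^ Suc j = \<eta> powr real (Suc j)" unfolding powr_realpow[OF \<eta>(1)] ..
        also have "\<dots> \<le> \<eta> powr (real N * (1 - 1 / m))"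
        proof (rule powr_mono')
          have "real N / m \<ge> 1" using N m1 by simp
          moreover have "real N * (1 - 1 / m) = real N - real N / m" by (simp add: right_diff_distrib)
          moreover have "real N = real (Suc j) + 1" using j by simp
          ultimately show "real N * (1 - 1 / m) \<le> real (Suc j)" by linarith
        qed (use \<eta> in auto)
        also have "\<dots> = (\<eta> ^ N) powr (1 - 1 / m)" using \<eta> by (simp add: powr_realpow[symmetric] powr_powr)
        finally show "\<eta> ^ Suc j * X p powr (1 - 1 / m) \<le> (cutoff N R p * X p) powr (1 - 1 / m)"
          using \<eta> X(2)[of p] by (simp add: cut powr_mult mult_right_mono)
      qed (use k R in auto)
      also have "\<dots> \<le> c / 2 * (cutoff N R p * X p) + c / 2 * M R"
        unfolding M_def by (rule powr_absorb) (use x k R c m1 in auto)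
      finally show ?thesis .
    qed
    ultimately show ?thesis using pS by simp
  qed
  have cpt: "compact (?S R)" for R by (intro compact_Times compact_cball)
  have out: "cutoff N R p = 0" if "R > 0" "p \<notin> ?S R" for R p
    using cutoff_eq_0[OF that] N by auto
  have iX: "integrable lborel (\<lambda>p. cutoff N R p * X p)" if R: "R > 0" for R
    by (rule integrable_compact_support[OF _ cpt[of R]])
      (auto intro!: continuous_intros continuous_on_cutoff X(1) simp: out[OF R] simp del: mem_Times_iff)
  have bound2: "integral\<^sup>L lborel (\<lambda>p. cutoff N R p * X p) \<le> M R * measure lborel (?S R)" if R: "R > 0" for R
  proof -
    let ?H = "\<lambda>a p. ?\<phi> R p * W a p"
    obtain r where r: "\<And>x. x \<in> ?S R \<Longrightarrow> norm x \<le> r"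
      using compact_imp_bounded[OF cpt] unfolding bounded_iff by blast
    have H: "Ck (Suc 0) (?H a)" for a
      unfolding j by (rule Ck_mult[OF Ck_bounded_linear_compose[OF bounded_linear_of_real Ck_cutoff] W])
    have H0: "?H a x = 0" if "norm x > r" for a x
      using out[OF R, of x] r[of x] that by force
    note I = integral_Re_Zbar_compact_support[OF H H0]
    have fin: "integrable lborel (indicator (?S R) :: 'n heis \<Rightarrow> real)"
      using measure_cylinder(1)[of R] R by (intro integrable_real_indicator) (auto simp: closed_Times borel_closed)
    have "integral\<^sup>L lborel (\<lambda>p. c / 2 * (cutoff N R p * X p) - c / 2 * M R * indicator (?S R) p)
       \<le> integral\<^sup>L lborel (\<lambda>p. \<Sum>a\<in>UNIV. Re (Zbar a (?H a) p))"
    proof (rule integral_mono)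
      show "integrable lborel (\<lambda>p. c / 2 * (cutoff N R p * X p) - c / 2 * M R * indicator (?S R) p)"
        using iX[OF R] fin by (intro Bochner_Integration.integrable_diff integrable_mult_right)
      show "integrable lborel (\<lambda>p. \<Sum>a\<in>UNIV. Re (Zbar a (?H a) p))"
        by (intro Bochner_Integration.integrable_sum I)
    qed (use pointwise[OF R] in simp)
    also have "\<dots> = 0" using I by simp
    also have "integral\<^sup>L lborel (\<lambda>p. c / 2 * (cutoff N R p * X p) - c / 2 * M R * indicator (?S R) p)
       = c / 2 * (integral\<^sup>L lborel (\<lambda>p. cutoff N R p * X p) - M R * measure lborel (?S R))"
      using iX[OF R] fin by (subst Bochner_Integration.integral_diff) (auto simp: algebra_simps)
    finally show ?thesis using c by (simp add: mult_le_0_iff)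
  qed
  \<comment> \<open>The cutoffs increase with R, so the integral at scale 1 is a fixed positive
    lower bound for all R >= 1.\<close>
  define I1 where "I1 = integral\<^sup>L lborel (\<lambda>p. cutoff N 1 p * X p)"
  have "I1 > 0" unfolding I1_def
  proof (rule integral_pos_of_continuous[OF _ _ _ iX])
    show "cutoff N 1 0 * X 0 > 0" using X(2)[of 0] by (simp add: cutoff_def)
  qed (auto intro!: continuous_intros continuous_on_cutoff X(1) mult_nonneg_nonneg cutoff_nonneg less_imp_le[OF X(2)])
  define B where "B = (2 * k / c) powr m * (2 * unit_ball_vol (2 * real CARD('n)))"
  have I1_le: "I1 \<le> B * R powr (real (hom_dim TYPE('n)) - m)" if R: "R \<ge> 1" for R
  proof -
    have "I1 \<le> integral\<^sup>L lborel (\<lambda>p. cutoff N R p * X p)"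
      unfolding I1_def using R
      by (intro integral_mono iX mult_right_mono cutoff_mono less_imp_le[OF X(2)]) auto
    also have "\<dots> \<le> M R * measure lborel (?S R)" using R by (intro bound2) auto
    also have "\<dots> = M R * (2 * unit_ball_vol (2 * real CARD('n)) * R ^ hom_dim TYPE('n))"
      using R by (subst measure_cylinder) auto
    also have "M R = (2 * k / c) powr m * R powr (- m)"
      using R k c by (simp add: M_def powr_divide powr_minus divide_simps powr_mult)
    also have "R ^ hom_dim TYPE('n) = R powr real (hom_dim TYPE('n))"
      using R by (simp add: powr_realpow)
    also have "(2 * k / c) powr m * R powr (- m) * (2 * unit_ball_vol (2 * real CARD('n)) * R powr real (hom_dim TYPE('n)))
        = B * (R powr real (hom_dim TYPE('n)) * R powr (- m))" by (simp add: B_def)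
    also have "R powr real (hom_dim TYPE('n)) * R powr (- m) = R powr (real (hom_dim TYPE('n)) - m)"
      by (simp flip: powr_add)
    finally show ?thesis .
  qed
  have "((\<lambda>R. B * R powr (real (hom_dim TYPE('n)) - m)) \<longlongrightarrow> B * 0) at_top"
    using m by (intro tendsto_mult tendsto_const tendsto_neg_powr filterlim_ident) auto
  moreover have "\<forall>\<^sub>F R in at_top. I1 \<le> B * R powr (real (hom_dim TYPE('n)) - m)"
    by (rule eventually_mono[OF eventually_ge_at_top[of 1]]) (rule I1_le)
  ultimately have "I1 \<le> B * 0"
    by (intro tendsto_lowerbound) auto
  then show False using \<open>I1 > 0\<close> by simp
qed

section \<open>Pointwise inequalities\<close>

text \<open>Applied to \<open>D2\<close> and \<open>E2\<close> with the gradient as w, it bounds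
  |D|^2 and |E|^2 by a times the squared norms of the tensors.\<close>

lemma row_Cauchy_Schwarz:
  fixes M :: "'n::finite \<Rightarrow> 'n \<Rightarrow> complex" and w :: "'n \<Rightarrow> complex"
  shows "(\<Sum>x\<in>UNIV. (norm (\<Sum>y\<in>UNIV. M x y * w y))\<^sup>2)
    \<le> (\<Sum>y\<in>UNIV. (norm (w y))\<^sup>2) * (\<Sum>x\<in>UNIV. \<Sum>y\<in>UNIV. (norm (M x y))\<^sup>2)"
proof -
  have "(norm (\<Sum>y\<in>UNIV. M x y * w y))\<^sup>2 \<le> (\<Sum>y\<in>UNIV. (norm (w y))\<^sup>2) * (\<Sum>y\<in>UNIV. (norm (M x y))\<^sup>2)" for x
  proof -
    have "norm (\<Sum>y\<in>UNIV. M x y * w y) \<le> (\<Sum>y\<in>UNIV. \<bar>norm (M x y)\<bar> * \<bar>norm (w y)\<bar>)"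
      by (rule order_trans[OF norm_sum]) (simp add: norm_mult)
    also have "\<dots> \<le> L2_set (\<lambda>y. norm (M x y)) UNIV * L2_set (\<lambda>y. norm (w y)) UNIV"
      by (rule L2_set_mult_ineq)
    finally have "(norm (\<Sum>y\<in>UNIV. M x y * w y))\<^sup>2
       \<le> (L2_set (\<lambda>y. norm (M x y)) UNIV * L2_set (\<lambda>y. norm (w y)) UNIV)\<^sup>2"
      by (intro power_mono) auto
    also have "\<dots> = (\<Sum>y\<in>UNIV. (norm (w y))\<^sup>2) * (\<Sum>y\<in>UNIV. (norm (M x y))\<^sup>2)"
      by (simp add: L2_set_def power_mult_distrib sum_nonneg mult.commute)
    finally show ?thesis .
  qed
  then show ?thesis by (simp add: sum_distrib_left sum_mono)
qed

text \<open>Cauchy-Schwarz gives D . v <= a sqrt N, and P a sqrt N <= N + P^2 a^2 / 4 completes the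
  square.\<close>

lemma weighted_inner_bound:
  fixes D v :: "'v::real_inner"
  assumes v: "v \<bullet> v = a" and D: "D \<bullet> D \<le> a * N" and "N \<ge> 0" "P \<ge> 0"
  shows "P * (D \<bullet> v) \<le> N + P\<^sup>2 * a\<^sup>2 / 4"
proof -
  have a: "a \<ge> 0" using v inner_ge_zero[of v] by simp
  have "D \<bullet> v \<le> norm D * norm v" using Cauchy_Schwarz_ineq2[of D v] by linarith
  also have "norm D \<le> sqrt (a * N)" using D by (simp add: norm_eq_sqrt_inner)
  also have "norm v = sqrt a" using v by (simp add: norm_eq_sqrt_inner)
  finally have "D \<bullet> v \<le> sqrt (a * N) * sqrt a" using a by (simp add: mult_right_mono)
  also have "\<dots> = a * sqrt N" using a by (simp add: real_sqrt_mult)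
  finally have "P * (D \<bullet> v) \<le> P * (a * sqrt N)" using assms by (intro mult_left_mono)
  moreover have "0 \<le> (sqrt N - P * a / 2)\<^sup>2" by simp
  moreover have "(sqrt N - P * a / 2)\<^sup>2 = N + P\<^sup>2 * a\<^sup>2 / 4 - P * (a * sqrt N)"
    using assms(3) by (simp add: power2_diff power_mult_distrib field_simps)
  ultimately show ?thesis by linarith
qed

text \<open>Three separate estimates, with P standing for - p. The quadratic form in D, E, G without
  the D . E term dominates 1/5 of the squares. That term is paid by a (nd + ne) >= |D|^2 + |E|^2.
  The remaining e (nd + ne) pays for D . v and E . v at a cost of P^2 a^2 / 4 each, which leaves (P
  - P^2 / 2) e a^2; this is positive exactly for 0 < P < 2.\<close>

lemma jerison_lee_coercive:
  fixes D E G v :: "'v::real_inner" and a b e n P :: real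
  assumes v: "v \<bullet> v = a" and e: "e > 0" and P: "0 < P" "P < 2" and n: "n \<ge> 1"
    and D: "D \<bullet> D \<le> a * nd" "nd \<ge> 0" and E: "E \<bullet> E \<le> a * ne" "ne \<ge> 0"
  defines "\<kappa> \<equiv> min (1 / 5) (P - P\<^sup>2 / 2)"
  shows "\<kappa> * (D \<bullet> D + E \<bullet> E + G \<bullet> G + e * a\<^sup>2 + a * e\<^sup>2 + e * b\<^sup>2)
    \<le> (a + e) * (nd + ne) + D \<bullet> D + E \<bullet> E + 3 * (G \<bullet> G) + 2 * (D \<bullet> E) + 2 * (D \<bullet> G) - 2 * (E \<bullet> G)
      + P * e * ((2 * n - 1) * a * (a + e) + 3 * n * b\<^sup>2 - D \<bullet> v - E \<bullet> v)"
proof -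
  have a: "a \<ge> 0" using v inner_ge_zero[of v] by simp
  have \<kappa>: "\<kappa> > 0" "\<kappa> \<le> 1 / 5" "\<kappa> \<le> P - P\<^sup>2 / 2" "\<kappa> \<le> P"
  proof -
    have "P * P < P * 2" using P by simp
    then show "\<kappa> > 0" by (simp add: \<kappa>_def power2_eq_square)
    show "\<kappa> \<le> 1 / 5" "\<kappa> \<le> P - P\<^sup>2 / 2"
      unfolding \<kappa>_def by (rule min.cobounded1 min.cobounded2)+
    then show "\<kappa> \<le> P" using zero_le_power2[of P] by linarith
  qed
  have 1: "\<kappa> * (D \<bullet> D + E \<bullet> E + G \<bullet> G) \<le> D \<bullet> D + E \<bullet> E + 3 * (G \<bullet> G) + 2 * (D \<bullet> G) - 2 * (E \<bullet> G)"
  proof -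
    have "\<kappa> * (D \<bullet> D + E \<bullet> E + G \<bullet> G) \<le> 1 / 5 * (D \<bullet> D + E \<bullet> E + G \<bullet> G)"
      using \<kappa> by (intro mult_right_mono) auto
    also have "\<dots> \<le> D \<bullet> D + E \<bullet> E + 3 * (G \<bullet> G) + 2 * (D \<bullet> G) - 2 * (E \<bullet> G)"
    proof -
      \<comment> \<open>One fifth of the two squares adds up to 4/5 (|D|^2 + |E|^2) + 2 D . G - 2 E
        . G + 5/2 |G|^2, and 5/2 <= 3 - 1/5.\<close>
      have "0 \<le> (2 *\<^sub>R D + (5 / 2) *\<^sub>R G) \<bullet> (2 *\<^sub>R D + (5 / 2) *\<^sub>R G)"
      "0 \<le> (2 *\<^sub>R E - (5 / 2) *\<^sub>R G) \<bullet> (2 *\<^sub>R E - (5 / 2) *\<^sub>R G)" "0 \<le> G \<bullet> G" by (rule inner_ge_zero)+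
    then have "0 \<le> 4 * (D \<bullet> D) + 10 * (D \<bullet> G) + 25 / 4 * (G \<bullet> G)"
      "0 \<le> 4 * (E \<bullet> E) - 10 * (E \<bullet> G) + 25 / 4 * (G \<bullet> G)" "0 \<le> G \<bullet> G"
      by (simp_all add: inner_left_distrib inner_right_distrib inner_diff_left inner_diff_right inner_commute)
      then show ?thesis by argo
    qed
    finally show ?thesis .
  qed
  have 2: "0 \<le> a * (nd + ne) + 2 * (D \<bullet> E)"
  proof -
    have "0 \<le> (D + E) \<bullet> (D + E)" by (rule inner_ge_zero)
    then show ?thesis using D(1) E(1) by (simp add: inner_left_distrib inner_right_distrib inner_commute distrib_left)
  qed
  have 3: "\<kappa> * (a\<^sup>2 + a * e + b\<^sup>2)
     \<le> nd + ne + P * ((2 * n - 1) * a * (a + e) + 3 * n * b\<^sup>2 - D \<bullet> v - E \<bullet> v)"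
  proof -
    have "P * (D \<bullet> v) \<le> nd + P\<^sup>2 * a\<^sup>2 / 4" "P * (E \<bullet> v) \<le> ne + P\<^sup>2 * a\<^sup>2 / 4"
      using weighted_inner_bound[OF v D] weighted_inner_bound[OF v E] P by auto
    moreover have "P * (a * (a + e)) \<le> P * ((2 * n - 1) * (a * (a + e)))"
      using P a e n by (intro mult_left_mono mult_right_mono[of 1 "2 * n - 1", simplified]) auto
    moreover have "P * b\<^sup>2 \<le> P * (3 * n * b\<^sup>2)"
      using P n by (intro mult_left_mono mult_right_mono[of 1 "3 * n", simplified]) auto
    moreover have "\<kappa> * a\<^sup>2 \<le> (P - P\<^sup>2 / 2) * a\<^sup>2" "\<kappa> * (a * e) \<le> P * (a * e)" "\<kappa> * b\<^sup>2 \<le> P * b\<^sup>2"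
      using \<kappa> a e by (auto intro!: mult_right_mono)
    ultimately show ?thesis by (simp add: algebra_simps power2_eq_square)
  qed
  from mult_left_mono[OF 3, of e] 1 2 e show ?thesis
    by (simp add: algebra_simps power2_eq_square)
qed

text \<open>The last three lines of the right side are the divergences, divided by the weight, of
  the added fields. They contribute n a^3, n e^3 and n |b|^3, and their other terms are bounded by
  multiples of \<open>Q\<close> and by small parts of the cubes. The third also costs 80 a^3; the
  factor 1/320 reduces this to a^3 / 4, half of the a^3 / 2 gained from the first. What it leaves of
  |b|^3 is 1/640.\<close>

lemma cubic_coercive:
  fixes D E G v :: "'v::real_inner" and a b e n p :: real
  assumes v: "v \<bullet> v = a" and e: "e > 0" and p: "p \<le> 0" and n: "n \<ge> 1" and \<kappa>: "\<kappa> > 0"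
    and S: "\<kappa> * (D \<bullet> D + E \<bullet> E + G \<bullet> G + e * a\<^sup>2 + a * e\<^sup>2 + e * b\<^sup>2) \<le> S"
  defines "\<delta> \<equiv> \<kappa> / (4 * n + 20)"
  shows "\<delta> / 640 * (D \<bullet> D + E \<bullet> E + G \<bullet> G + a ^ 3 + \<bar>b\<bar> ^ 3 + e ^ 3)
    \<le> S + \<delta> * (n * a ^ 3 - (n + 2) * e * a\<^sup>2 + 2 * a * (D \<bullet> v + E \<bullet> v))
      + \<delta> * (n * e ^ 3 - (n + 2 + 2 * p) * a * e\<^sup>2)
      + \<delta> / 320 * (n * \<bar>b\<bar> ^ 3 + 2 * \<bar>b\<bar> * (G \<bullet> v - (a + e) * a))"
proof -
  define Q where "Q = D \<bullet> D + E \<bullet> E + G \<bullet> G + e * a\<^sup>2 + a * e\<^sup>2 + e * b\<^sup>2"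
  define \<beta> where "\<beta> = \<bar>b\<bar>"
  have a: "a \<ge> 0" using v inner_ge_zero[of v] by simp
  have pos: "D \<bullet> D \<ge> 0" "E \<bullet> E \<ge> 0" "G \<bullet> G \<ge> 0" "e * a\<^sup>2 \<ge> 0" "a * e\<^sup>2 \<ge> 0" "e * b\<^sup>2 \<ge> 0" "\<beta> \<ge> 0" "a ^ 3 \<ge> 0" "e ^ 3 \<ge> 0" "\<beta> ^ 3 \<ge> 0"
    using a e by (auto simp: \<beta>_def)
  have \<delta>: "\<delta> > 0" "\<delta> * (4 * n + 20) = \<kappa>" using \<kappa> n by (auto simp: \<delta>_def)
  have inner: "\<bar>t * (H \<bullet> v)\<bar> \<le> H \<bullet> H + t\<^sup>2 * a / 4" for t :: real and H :: 'v
  proof -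
    have "0 \<le> (H + (t / 2) *\<^sub>R v) \<bullet> (H + (t / 2) *\<^sub>R v)" "0 \<le> (H - (t / 2) *\<^sub>R v) \<bullet> (H - (t / 2) *\<^sub>R v)"
      by (rule inner_ge_zero)+
    then have "0 \<le> H \<bullet> H + t * (H \<bullet> v) + t\<^sup>2 * a / 4" "0 \<le> H \<bullet> H - t * (H \<bullet> v) + t\<^sup>2 * a / 4"
      by (simp_all add: inner_left_distrib inner_right_distrib inner_diff_left inner_diff_right inner_commute v
         power2_eq_square algebra_simps)
    then show ?thesis by linarith
  qed
  have t1: "a ^ 3 / 2 - (n + 4) * Q \<le> n * a ^ 3 - (n + 2) * e * a\<^sup>2 + 2 * a * (D \<bullet> v + E \<bullet> v)"
  proof -
    have i: "\<bar>2 * a * (H \<bullet> v)\<bar> \<le> 4 * (H \<bullet> H) + a ^ 3 / 4" for H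
      using inner[of a "2 *\<^sub>R H"] by (simp add: power2_eq_square power3_eq_cube algebra_simps)
    have "(n + 2) * (e * a\<^sup>2) + 4 * (D \<bullet> D) + 4 * (E \<bullet> E) \<le> (n + 4) * Q"
    proof -
      have "(n + 2) * (e * a\<^sup>2) \<le> (n + 4) * (e * a\<^sup>2)" "4 * (D \<bullet> D) \<le> (n + 4) * (D \<bullet> D)" "4 * (E \<bullet> E) \<le> (n + 4) * (E \<bullet> E)"
        using n pos by (auto intro!: mult_right_mono)
      moreover have "0 \<le> (n + 4) * (G \<bullet> G)" "0 \<le> (n + 4) * (a * e\<^sup>2)" "0 \<le> (n + 4) * (e * b\<^sup>2)"
        using n pos by auto
      ultimately show ?thesis unfolding Q_def distrib_left by linarith
    qed
    moreover have "1 * a ^ 3 \<le> n * a ^ 3" using n pos by (intro mult_right_mono) auto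
    ultimately show ?thesis using i[of D] i[of E] by (simp add: algebra_simps)
  qed
  have t2: "e ^ 3 - (n + 2) * Q \<le> n * e ^ 3 - (n + 2 + 2 * p) * a * e\<^sup>2"
  proof -
    have "1 * e ^ 3 \<le> n * e ^ 3" using n pos by (intro mult_right_mono) auto
    moreover have "(n + 2 + 2 * p) * (a * e\<^sup>2) \<le> (n + 2) * (a * e\<^sup>2)" using p pos by (intro mult_right_mono) auto
    moreover have "(n + 2) * (a * e\<^sup>2) \<le> (n + 2) * Q" using n pos by (intro mult_left_mono) (auto simp: Q_def)
    ultimately show ?thesis by (simp add: algebra_simps)
  qed
  have t3: "\<beta> ^ 3 / 2 - 80 * a ^ 3 - 2 * Q \<le> n * \<beta> ^ 3 + 2 * \<beta> * (G \<bullet> v - (a + e) * a)"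
  proof -
    have i: "\<bar>2 * \<beta> * (G \<bullet> v)\<bar> \<le> G \<bullet> G + \<beta>\<^sup>2 * a"
      using inner[of "2 * \<beta>" G] by (simp add: power2_eq_square)
    have "\<beta>\<^sup>2 * a + 2 * \<beta> * a\<^sup>2 \<le> \<beta> ^ 3 / 2 + 80 * a ^ 3"
    \<comment> \<open>For a small compared with |b| the terms are absorbed by |b|^3. Otherwise |b|
      <= 8 a, and they are at most (64 + 16) a^3.\<close>
    proof (cases "a \<le> \<beta> / 8")
      case True
      have "\<beta>\<^sup>2 * a \<le> \<beta>\<^sup>2 * (\<beta> / 8)" using True by (intro mult_left_mono) auto
      moreover have "a\<^sup>2 \<le> (\<beta> / 8)\<^sup>2" using True a by (intro power_mono) auto
      then have "2 * \<beta> * a\<^sup>2 \<le> 2 * \<beta> * (\<beta> / 8)\<^sup>2" using pos by (intro mult_left_mono) auto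
      moreover have "\<beta>\<^sup>2 * (\<beta> / 8) = \<beta> ^ 3 / 8" "2 * \<beta> * (\<beta> / 8)\<^sup>2 = \<beta> ^ 3 / 32"
        by (simp_all add: power2_eq_square power3_eq_cube)
      ultimately show ?thesis using pos by linarith
    next
      case False
      then have "\<beta> \<le> 8 * a" by simp
      then have "\<beta>\<^sup>2 * a \<le> (8 * a)\<^sup>2 * a" "2 * \<beta> * a\<^sup>2 \<le> 2 * (8 * a) * a\<^sup>2"
        using pos(7) a by (intro mult_right_mono power_mono; simp)+
      moreover have "(8 * a)\<^sup>2 * a = 64 * a ^ 3" "2 * (8 * a) * a\<^sup>2 = 16 * a ^ 3"
        by (simp_all add: power2_eq_square power3_eq_cube)
      ultimately show ?thesis using pos by linarith
    qed
    moreover have "2 * \<beta> * (e * a) \<le> e * a\<^sup>2 + e * b\<^sup>2"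
    proof -
      have "0 \<le> e * (a - \<beta>)\<^sup>2" using e by simp
      then show ?thesis by (simp add: power2_diff algebra_simps \<beta>_def)
    qed
    moreover have "1 * \<beta> ^ 3 \<le> n * \<beta> ^ 3" using n pos by (intro mult_right_mono) auto
    moreover have "G \<bullet> G + (e * a\<^sup>2 + e * b\<^sup>2) \<le> Q" "0 \<le> Q" using pos by (auto simp: Q_def)
    ultimately show ?thesis using i by (simp add: algebra_simps power2_eq_square)
  qed
  have Q: "Q \<ge> 0" using pos by (simp add: Q_def)
  \<comment> \<open>The three fields use up (n + 4) + (n + 2) + 1/160 of the factor 4 n + 20; the
    rest covers the Q / 640 kept for |D|^2 + |E|^2 + |G|^2.\<close>
  have "\<delta> * ((n + 4) * Q) + \<delta> * ((n + 2) * Q) + \<delta> / 320 * (2 * Q) + \<delta> / 640 * Q \<le> \<delta> * (4 * n + 20) * Q"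
  proof -
    have "(n + 4) * Q + (n + 2) * Q + 1 / 320 * (2 * Q) + 1 / 640 * Q \<le> (4 * n + 20) * Q"
      using Q n by (simp add: algebra_simps)
    from mult_left_mono[OF this, of \<delta>] \<delta>(1) show ?thesis by (simp add: algebra_simps)
  qed
  then have kQ: "\<delta> * ((n + 4) * Q) + \<delta> * ((n + 2) * Q) + \<delta> / 320 * (2 * Q) + \<delta> / 640 * Q \<le> S"
    using S unfolding Q_def[symmetric] \<delta>(2) by linarith
  have kD: "\<delta> / 640 * (D \<bullet> D + E \<bullet> E + G \<bullet> G) \<le> \<delta> / 640 * Q"
    using \<delta> pos by (intro mult_left_mono) (auto simp: Q_def)
  define A B C where "A = \<delta> * a ^ 3" and "B = \<delta> * \<beta> ^ 3" and "C = \<delta> * e ^ 3"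
  have ABC: "A \<ge> 0" "B \<ge> 0" "C \<ge> 0" using \<delta> pos by (auto simp: A_def B_def C_def)
  define X1 X2 X3 where "X1 = n * a ^ 3 - (n + 2) * e * a\<^sup>2 + 2 * a * (D \<bullet> v + E \<bullet> v)"
    and "X2 = n * e ^ 3 - (n + 2 + 2 * p) * a * e\<^sup>2"
    and "X3 = n * \<beta> ^ 3 + 2 * \<beta> * (G \<bullet> v - (a + e) * a)"
  define Q1 Q2 Q3 where "Q1 = \<delta> * ((n + 4) * Q)" and "Q2 = \<delta> * ((n + 2) * Q)" and "Q3 = \<delta> / 320 * (2 * Q)"
  have "A / 2 - Q1 \<le> \<delta> * X1"
    using mult_left_mono[OF t1, of \<delta>] \<delta>(1) unfolding X1_def[symmetric] A_def Q1_def right_diff_distrib by simp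
  moreover have "C - Q2 \<le> \<delta> * X2"
    using mult_left_mono[OF t2, of \<delta>] \<delta>(1) unfolding X2_def[symmetric] C_def Q2_def right_diff_distrib by simp
  moreover have "B / 640 - A / 4 - Q3 \<le> \<delta> / 320 * X3"
    using mult_left_mono[OF t3[folded X3_def], of "\<delta> / 320"] \<delta>(1) unfolding A_def B_def Q3_def
    by (simp add: right_diff_distrib)
  moreover note kQ[folded Q1_def Q2_def Q3_def]
  ultimately have "\<delta> / 640 * (D \<bullet> D + E \<bullet> E + G \<bullet> G) + A / 640 + B / 640 + C / 640 \<le> S + \<delta> * X1 + \<delta> * X2 + \<delta> / 320 * X3"
    using kD ABC by linarith
  moreover have "\<delta> / 640 * (D \<bullet> D + E \<bullet> E + G \<bullet> G + a ^ 3 + \<beta> ^ 3 + e ^ 3)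
     = \<delta> / 640 * (D \<bullet> D + E \<bullet> E + G \<bullet> G) + A / 640 + B / 640 + C / 640"
    by (simp add: A_def B_def C_def distrib_left add_divide_distrib)
  ultimately show ?thesis unfolding \<beta>_def[symmetric] X1_def X2_def X3_def by simp
qed

text \<open>The weights in terms of \<tau> = P^(1/6): |v| <= \<tau>, the numbers a, |b|, e are at
  most \<tau>^2, and the norms of D, E, G at most \<tau>^3. Every product on the left then has
  weight 5, and 14 = 4 * 2 + 3 + 3.\<close>

lemma quintic_bound:
  fixes D E G v :: "'v::real_normed_vector" and a b e :: real
  assumes v: "(norm v)\<^sup>2 = a" and e: "e > 0"
  defines "P \<equiv> (norm D)\<^sup>2 + (norm E)\<^sup>2 + (norm G)\<^sup>2 + a ^ 3 + \<bar>b\<bar> ^ 3 + e ^ 3"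
  shows "(a + e + 2 * \<bar>b\<bar>) * (norm D + norm E) + 3 * \<bar>b\<bar> * norm G + (a\<^sup>2 + e\<^sup>2 + b\<^sup>2) * norm v \<le> 14 * P powr (5 / 6)"
    and "e \<le> P powr (1 / 3)" and "P > 0"
proof -
  have a: "a \<ge> 0" using v by auto
  have pos: "a ^ 3 \<ge> 0" "e ^ 3 > 0" "\<bar>b\<bar> ^ 3 \<ge> 0" using a e by auto
  show P: "P > 0" unfolding P_def using pos by (intro add_nonneg_pos add_nonneg_nonneg) auto
  define \<tau> where "\<tau> = P powr (1 / 6)"
  have \<tau>: "\<tau> > 0" using P by (simp add: \<tau>_def)
  have tau: "\<tau> ^ k = P powr (k / 6)" for k
    using P by (simp add: \<tau>_def powr_powr flip: powr_realpow)
  have t6: "\<tau> ^ 6 = P" using tau[of 6] P by simp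
  have t32: "(\<tau> ^ 3)\<^sup>2 = P" "(\<tau>\<^sup>2) ^ Suc 2 = P" using t6 by (simp_all flip: power_mult)
  have sq: "x \<le> \<tau> ^ 3" if "x\<^sup>2 \<le> P" for x
    by (rule power2_le_imp_le) (use that t32(1) \<tau> in simp_all)
  have cb: "x \<le> \<tau>\<^sup>2" if "x ^ 3 \<le> P" for x
  proof (rule power_le_imp_le_base)
    have "x ^ Suc 2 \<le> P" using that by (simp add: numeral_3_eq_3 numeral_2_eq_2)
    then show "x ^ Suc 2 \<le> (\<tau>\<^sup>2) ^ Suc 2" unfolding t32(2) .
  qed simp
  have D: "norm D \<le> \<tau> ^ 3" "norm E \<le> \<tau> ^ 3" "norm G \<le> \<tau> ^ 3"
    using pos by (auto intro!: sq simp: P_def)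
  have A: "a \<le> \<tau>\<^sup>2" "\<bar>b\<bar> \<le> \<tau>\<^sup>2" "e \<le> \<tau>\<^sup>2"
    using pos by (auto intro!: cb simp: P_def)
  have V: "norm v \<le> \<tau>" by (rule power2_le_imp_le) (use A(1) v \<tau> in \<open>simp_all only: less_imp_le\<close>)
  have "(a + e + 2 * \<bar>b\<bar>) * (norm D + norm E) \<le> (\<tau>\<^sup>2 + \<tau>\<^sup>2 + 2 * \<tau>\<^sup>2) * (\<tau> ^ 3 + \<tau> ^ 3)"
    using D A \<tau> by (intro mult_mono add_mono mult_left_mono) auto
  moreover have "3 * \<bar>b\<bar> * norm G \<le> 3 * \<tau>\<^sup>2 * \<tau> ^ 3"
    using D A \<tau> by (intro mult_mono mult_left_mono) auto
  moreover have "(a\<^sup>2 + e\<^sup>2 + b\<^sup>2) * norm v \<le> ((\<tau>\<^sup>2)\<^sup>2 + (\<tau>\<^sup>2)\<^sup>2 + (\<tau>\<^sup>2)\<^sup>2) * \<tau>"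
  proof -
    have "\<bar>b\<bar>\<^sup>2 \<le> (\<tau>\<^sup>2)\<^sup>2" using A by (intro power_mono) auto
    then have "b\<^sup>2 \<le> (\<tau>\<^sup>2)\<^sup>2" by simp
    then show ?thesis using A V a e \<tau> by (intro mult_mono add_mono power_mono[of a] power_mono[of e]) auto
  qed
  moreover have "(\<tau>\<^sup>2 + \<tau>\<^sup>2 + 2 * \<tau>\<^sup>2) * (\<tau> ^ 3 + \<tau> ^ 3) + 3 * \<tau>\<^sup>2 * \<tau> ^ 3
     + ((\<tau>\<^sup>2)\<^sup>2 + (\<tau>\<^sup>2)\<^sup>2 + (\<tau>\<^sup>2)\<^sup>2) * \<tau> = 14 * \<tau> ^ 5"
    by (simp add: eval_nat_numeral algebra_simps)
  ultimately have "(a + e + 2 * \<bar>b\<bar>) * (norm D + norm E) + 3 * \<bar>b\<bar> * norm G + (a\<^sup>2 + e\<^sup>2 + b\<^sup>2) * norm v \<le> 14 * \<tau> ^ 5"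
    by linarith
  then show "(a + e + 2 * \<bar>b\<bar>) * (norm D + norm E) + 3 * \<bar>b\<bar> * norm G + (a\<^sup>2 + e\<^sup>2 + b\<^sup>2) * norm v \<le> 14 * P powr (5 / 6)"
    using tau[of 5] by simp
  show "e \<le> P powr (1 / 3)" using A(3) tau[of 2] by simp
qed

section \<open>Absence of positive solutions\<close>

lemma sum_cnj_inner:
  fixes v w :: "'n::finite \<Rightarrow> complex"
  shows "(\<Sum>x\<in>UNIV. v x * cnj (w x) + w x * cnj (v x)) = complex_of_real (2 * ((\<chi> x. v x) \<bullet> (\<chi> x. w x)))"
    and "(\<Sum>x\<in>UNIV. v x * cnj (v x)) = complex_of_real ((\<chi> x. v x) \<bullet> (\<chi> x. v x))"
    and "Re (\<Sum>x\<in>UNIV. v x * cnj (w x)) = (\<chi> x. v x) \<bullet> (\<chi> x. w x)"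
  by (auto simp: complex_eq_iff inner_vec_def inner_complex_def sum_distrib_left algebra_simps)

lemma norm_vec_scale: "norm (\<chi> x. z * (w x :: complex)) = cmod z * norm (\<chi> x::'n::finite. w x)"
  by (simp add: norm_vec_def norm_mult L2_set_right_distrib[symmetric])

text \<open>t |t| is the difference of the truncated squares of t and - t.\<close>

lemma has_real_derivative_mult_abs: "((\<lambda>t::real. t * \<bar>t\<bar>) has_real_derivative 2 * \<bar>t\<bar>) (at t)"
proof -
  have d: "((\<lambda>t::real. max 0 t ^ 2) has_real_derivative 2 * max 0 t) (at t)" for t
    using has_real_derivative_max0_power[of 0 t] by (simp add: numeral_2_eq_2)
  have "((\<lambda>t::real. max 0 t ^ 2 - max 0 (- t) ^ 2) has_real_derivative 2 * max 0 t - 2 * max 0 (- t) * (- 1)) (at t)"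
    by (intro DERIV_diff d DERIV_chain2[where f = "\<lambda>t. max 0 t ^ 2"] DERIV_minus DERIV_ident)
  moreover have "(\<lambda>t::real. max 0 t ^ 2 - max 0 (- t) ^ 2) = (\<lambda>t. t * \<bar>t\<bar>)"
    by (auto simp: max_def power2_eq_square abs_if fun_eq_iff)
  moreover have "2 * max 0 t - 2 * max 0 (- t) * (- 1) = 2 * \<bar>t\<bar>" by (auto simp: max_def abs_if)
  ultimately show ?thesis by simp
qed

lemma Ck_mult_abs:
  fixes r :: "'a::euclidean_space \<Rightarrow> real"
  assumes "Ck (Suc 0) r"
  shows "Ck (Suc 0) (\<lambda>p. r p * \<bar>r p\<bar>)"
proof (rule Ck_Suc_compose[OF assms has_real_derivative_mult_abs])
  show "Ck 0 (\<lambda>p. 2 * \<bar>r p\<bar>)" using Ck_Suc_imp_Ck[OF assms] by (simp add: continuous_on_mult_left continuous_on_rabs)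
qed

text \<open>\<open>Zbar_compose\<close> requires complex differentiability of the outer function,
  which t |t| does not offer; hence a chain rule for real outer functions.\<close>

lemma Zbar_real_compose:
  fixes r :: "'n::finite heis \<Rightarrow> real"
  assumes r: "r differentiable (at p)" and h: "(h has_real_derivative h') (at (r p))"
  shows "Zbar a (\<lambda>p. complex_of_real (h (r p))) p = complex_of_real h' * Zbar a (\<lambda>p. complex_of_real (r p)) p"
    and "(\<lambda>p. complex_of_real (h (r p))) differentiable (at p)"
proof -
  note d = bounded_linear.has_derivative[OF bounded_linear_of_real has_derivative_field_compose[OF has_derivative_frechet[OF r] h]]
  show "(\<lambda>p. complex_of_real (h (r p))) differentiable (at p)"
    using d differentiable_def by blast
  have "frechet_derivative (\<lambda>p. complex_of_real (h (r p))) (at p) v = complex_of_real h' * frechet_derivative (\<lambda>p. complex_of_real (r p)) (at p) v" for v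
    unfolding frechet_derivative_apply[OF d] frechet_derivative_bounded_linear_compose[OF bounded_linear_of_real r] by simp
  then show "Zbar a (\<lambda>p. complex_of_real (h (r p))) p = complex_of_real h' * Zbar a (\<lambda>p. complex_of_real (r p)) p"
    by (simp add: Zbar_eq algebra_simps)
qed

text \<open>The Laplacian of exp (n f) is exp (n f) times a quadratic expression in derivatives of
  f; dividing by 2 n exp (n f) leaves the locale's equation. Replacing Z Zb by Zb Z costs one
  commutator per index, whose sum is the T F term. The parameter s becomes the p of the
  locale.\<close>

lemma cr_equation_sfun:
  fixes f :: "'n::finite heis \<Rightarrow> real" and s :: real
  assumes f: "smooth f"
    and eq: "\<And>p. - heis_laplacian (\<lambda>p. exp (real CARD('n) * f p)) p
      = complex_of_real (2 * (real CARD('n))\<^sup>2 * exp ((real CARD('n) + 2 + s) * f p))"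
  defines "F \<equiv> sfun (\<lambda>p. complex_of_real (f p))"
  shows "cr_equation sZ sZb sT scnj (sconst \<i>) F
     (sfun (\<lambda>p. exp (complex_of_real (2 + s) * f p)))
     (sfun (\<lambda>p. exp (complex_of_real (2 * (real CARD('n) - 1)) * f p))) (sconst (complex_of_real s)) (of_nat CARD('n))"
proof -
  define n where "n = CARD('n)"
  have sf: "smooth (\<lambda>p. complex_of_real (f p))"
    by (rule smooth_bounded_linear_compose[OF bounded_linear_of_real f])
  have evF: "ev F p = complex_of_real (f p)" for p by (simp add: F_def ev_sfun sf)
  define X where "X k = (sfun (\<lambda>p. exp (complex_of_real k * f p)) :: 'n sfun)" for k
  have sX: "smooth (\<lambda>p. exp (complex_of_real k * f p))" for k
    by (rule smooth_exp[OF smooth_mult[OF smooth_const sf]])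
  have evX: "ev (X k) = (\<lambda>p. exp (complex_of_real k * f p))" for k by (simp add: X_def ev_sfun sX)
  have evF': "ev F = (\<lambda>p. complex_of_real (f p))" using evF by auto
  have d: "(\<lambda>p. complex_of_real (f p)) differentiable (at p)" for p by (rule smooth_differentiable[OF sf])
  have e': "((\<lambda>x. exp (complex_of_real k * x)) has_field_derivative complex_of_real k * exp (complex_of_real k * x)) (at x)" for k x
    by (auto intro!: derivative_eq_intros)
  have ZX: "sZ a (X k) = sconst k * X k * sZ a F" for a k
    by (rule sfun_eqI) (simp add: ev_simps ev_sZ evX evF' Z_compose[OF d e'])
  have ZbX: "sZb a (X k) = sconst k * X k * sZb a F" for a k
    by (rule sfun_eqI) (simp add: ev_simps ev_sZb evX evF' Zbar_compose[OF d e'])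
  have TX: "sT (X k) = sconst k * X k * sT F" for k
    by (rule sfun_eqI) (simp add: ev_simps ev_sT evX evF' d_t_compose[OF d e'])
  have cX: "scnj (X k) = X k" for k
    by (rule sfun_eqI) (simp add: ev_simps evX exp_cnj)
  have cF: "scnj F = F" by (rule sfun_eqI) (simp add: ev_simps evF)
  have Zc: "sZ a (sconst k) = 0" "sZb a (sconst k) = 0" for a k
    by (rule sfun_eqI; simp add: ev_simps ev_sZ ev_sZb; transfer; simp add: Z_const Zbar_const)+
  let ?n = "real n"
  have lap: "(\<Sum>a\<in>UNIV. sZb a (sZ a (X ?n)) + sZ a (sZb a (X ?n)))
      = X ?n * (2 * of_nat n * (\<Sum>a\<in>UNIV. sZb a (sZ a F)) - 2 * sconst \<i> * of_nat n * of_nat n * sT F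
        + 2 * of_nat n * of_nat n * (\<Sum>a\<in>UNIV. sZ a F * sZb a F))"
  proof -
    have n: "(sconst (complex_of_real ?n) :: 'n sfun) = of_nat n" by (rule sfun_eqI) (simp add: ev_simps)
    have "sZb a (sZ a (X ?n)) + sZ a (sZb a (X ?n)) = X ?n * (2 * of_nat n) * sZb a (sZ a F)
        - X ?n * (2 * sconst \<i> * of_nat n * sT F) + X ?n * (2 * of_nat n * of_nat n) * (sZ a F * sZb a F)" for a
      unfolding ZX ZbX n heis.Z_mult heis.Zb_mult heis.Z_of_nat heis.Zb_of_nat heis.Zb_Z[of a a F]
      by (simp add: algebra_simps)
    then show ?thesis
      by (simp only: sum.distrib sum_subtractf flip: sum_distrib_left)
        (simp add: algebra_simps n_def)
  qed
  have lap_ev: "heis_laplacian (\<lambda>p. exp (?n * f p)) p = ev (\<Sum>a\<in>UNIV. sZb a (sZ a (X ?n)) + sZ a (sZb a (X ?n))) p" for p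
  proof -
    have "(\<lambda>p. complex_of_real (exp (?n * f p))) = ev (X ?n)" by (simp add: evX flip: exp_of_real)
    then show ?thesis
      by (simp add: heis_laplacian_def ev_sum ev_add ev_sZ[abs_def] ev_sZb[abs_def] Let_def)
  qed
  have "(\<Sum>a\<in>UNIV. sZb a (sZ a F)) = - of_nat n * ((\<Sum>a\<in>UNIV. sZ a F * sZb a F) + X (2 + s) - sconst \<i> * sT F)"
  proof (rule sfun_eqI)
    fix p
    define x where "x = exp (complex_of_real (?n * f p))"
    have x: "x \<noteq> 0" "exp (complex_of_real ((?n + 2 + s) * f p)) = x * exp (complex_of_real ((2 + s) * f p))"
      by (auto simp: x_def algebra_simps exp_add exp_diff)
    define L A b where "L = ev (\<Sum>a\<in>UNIV. sZb a (sZ a F)) p" and "A = ev (\<Sum>a\<in>UNIV. sZ a F * sZb a F) p"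
      and "b = ev (sT F) p"
    have "heis_laplacian (\<lambda>p. exp (?n * f p)) p = x * (2 * of_nat n * L - 2 * \<i> * of_nat n * of_nat n * b + 2 * of_nat n * of_nat n * A)"
      unfolding lap_ev lap by (simp add: ev_mult ev_add ev_diff ev_sconst ev_of_nat ev_numeral evX x_def L_def A_def b_def)
    moreover have "heis_laplacian (\<lambda>p. exp (?n * f p)) p = - (2 * of_nat n * of_nat n * (x * exp (complex_of_real ((2 + s) * f p))))"
      using arg_cong[OF eq[of p], of uminus] unfolding n_def[symmetric] x(2)[symmetric] unfolding exp_of_real
      by (simp add: power2_eq_square)
    ultimately have "x * (2 * of_nat n * L - 2 * \<i> * of_nat n * of_nat n * b + 2 * of_nat n * of_nat n * A)
      = x * (- (2 * of_nat n * of_nat n * exp (complex_of_real ((2 + s) * f p))))" by (simp add: algebra_simps)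
    then have "2 * of_nat n * L - 2 * \<i> * of_nat n * of_nat n * b + 2 * of_nat n * of_nat n * A
      = - (2 * of_nat n * of_nat n * exp (complex_of_real ((2 + s) * f p)))"
      by (rule mult_left_cancel[THEN iffD1, OF x(1)])
    then have "(2 * of_nat n) * L = (2 * of_nat n) * (- of_nat n * (A + exp (complex_of_real ((2 + s) * f p)) - \<i> * b))"
      by (simp add: algebra_simps)
    moreover have "2 * complex_of_nat n \<noteq> 0" by (simp add: n_def)
    ultimately have "L = - of_nat n * (A + exp (complex_of_real ((2 + s) * f p)) - \<i> * b)" using mult_left_cancel by blast
    then show "ev (\<Sum>a\<in>UNIV. sZb a (sZ a F)) p
       = ev (- of_nat n * ((\<Sum>a\<in>UNIV. sZ a F * sZb a F) + X (2 + s) - sconst \<i> * sT F)) p"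
      unfolding L_def A_def b_def by (simp add: ev_mult ev_add ev_diff ev_minus ev_sconst ev_of_nat evX)
  qed
  note equation = this
  have c2: "sconst (complex_of_real (2 + s)) = 2 + (sconst (complex_of_real s) :: 'n sfun)"
    "sconst (complex_of_real (2 * (?n - 1))) = (2 * (of_nat n - 1) :: 'n sfun)"
    by (rule sfun_eqI; simp add: ev_simps)+
  show ?thesis
    unfolding X_def[symmetric] n_def[symmetric]
    by unfold_locales (simp_all add: cF cX ZX TX c2[symmetric] Zc equation n_def[symmetric] ev_simps sfun_eqI)
qed

text \<open>The ring identities are evaluated pointwise. They become statements on real numbers and
  on complex vectors regarded as elements of a real inner product space, which is the setting of the
  pointwise inequalities.\<close>

lemma no_log_solution:
  fixes f :: "'n::finite heis \<Rightarrow> real" and s :: real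
  assumes f: "smooth f" and s: "- 2 < s" "s < 0"
    and eq: "\<And>p. - heis_laplacian (\<lambda>p. exp (real CARD('n) * f p)) p
      = complex_of_real (2 * (real CARD('n))\<^sup>2 * exp ((real CARD('n) + 2 + s) * f p))"
  shows False
proof -
  define n where "n = real CARD('n)"
  have n: "n \<ge> 1" by (simp add: n_def Suc_leI)
  define F where "F = sfun (\<lambda>p. complex_of_real (f p))"
  define e where "e = (sfun (\<lambda>p. exp (complex_of_real (2 + s) * f p)) :: 'n sfun)"
  define \<Psi> where "\<Psi> = (sfun (\<lambda>p. exp (complex_of_real (2 * (real CARD('n) - 1)) * f p)) :: 'n sfun)"
  interpret E: cr_equation sZ sZb sT scnj "sconst \<i>" F e \<Psi> "sconst (complex_of_real s)" "of_nat CARD('n)"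
    unfolding F_def e_def \<Psi>_def by (rule cr_equation_sfun[OF f eq])
  \<comment> \<open>instantiated here, this equation has identical sides and makes the simplifier loop\<close>
  note [simp del] = E.of_nat_card
  define er where "er p = exp ((2 + s) * f p)" for p
  define \<psi> where "\<psi> p = exp (2 * (n - 1) * f p)" for p
  have sf: "smooth (\<lambda>p. complex_of_real (f p))"
    by (rule smooth_bounded_linear_compose[OF bounded_linear_of_real f])
  have ev_e: "ev e p = complex_of_real (er p)" for p
    unfolding e_def ev_sfun[OF smooth_exp[OF smooth_mult[OF smooth_const sf]]] er_def by (simp flip: exp_of_real)
  have ev_\<Psi>: "ev \<Psi> p = complex_of_real (\<psi> p)" for p
    unfolding \<Psi>_def ev_sfun[OF smooth_exp[OF smooth_mult[OF smooth_const sf]]] \<psi>_def n_def by (simp flip: exp_of_real)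
  have ev_n: "ev (of_nat CARD('n)) p = complex_of_real n" for p by (simp add: ev_of_nat n_def)
  define v where "v p = (\<chi> x. ev (sZ x F) p)" for p
  define Dv where "Dv p = (\<chi> x. ev (E.D x) p)" for p
  define Ev where "Ev p = (\<chi> x. ev (E.E x) p)" for p
  define Gv where "Gv p = (\<chi> x. ev (E.G x) p)" for p
  define a where "a p = v p \<bullet> v p" for p
  define b where "b p = Re (ev (sT F) p)" for p
  define nd where "nd p = (\<Sum>x\<in>UNIV. \<Sum>y\<in>UNIV. (cmod (ev (E.D2 x y) p))\<^sup>2)" for p
  define ne where "ne p = (\<Sum>x\<in>UNIV. \<Sum>y\<in>UNIV. (cmod (ev (E.E2 x y) p))\<^sup>2)" for p
  have ev_fb: "ev (sZb x F) p = cnj (ev (sZ x F) p)" for x p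
    using ev_scnj[of "sZ x F" p] unfolding heis.c_Z E.c_F .
  have ev_b: "ev (sT F) p = complex_of_real (b p)" for p
    using ev_scnj[of "sT F" p] unfolding heis.c_T E.c_F by (simp add: b_def complex_eq_iff)
  have ev_A: "ev E.A p = complex_of_real (a p)" for p
    unfolding E.A_def ev_sum ev_mult ev_fb sum_cnj_inner(2) a_def v_def ..
  have ev_d: "Re (ev E.d p) = Dv p \<bullet> v p" "Re (ev E.\<epsilon> p) = Ev p \<bullet> v p" "Re (ev E.\<gamma> p) = Gv p \<bullet> v p" for p
    unfolding E.d_def E.\<epsilon>_def E.\<gamma>_def ev_sum ev_mult ev_fb sum_cnj_inner(3) Dv_def Ev_def Gv_def v_def by simp_all
  have ev_ND: "ev E.ND p = complex_of_real (nd p)" "ev E.NE p = complex_of_real (ne p)" for p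
    unfolding E.ND_def E.NE_def nd_def ne_def ev_sum ev_mult ev_scnj by (simp_all add: complex_norm_square flip: of_real_power)
  have ev_g: "ev E.g p = complex_of_real (a p + er p) - \<i> * complex_of_real (b p)" for p
    by (simp add: E.g_def ev_add ev_diff ev_mult ev_sconst ev_A ev_e ev_b)
  have pos: "er p > 0" "\<psi> p > 0" for p by (simp_all add: er_def \<psi>_def)
  have nn: "nd p \<ge> 0" "ne p \<ge> 0" for p by (auto simp: nd_def ne_def intro!: sum_nonneg)
  have rowD: "Dv p \<bullet> Dv p \<le> a p * nd p" for p
    using row_Cauchy_Schwarz[of "\<lambda>x y. ev (E.D2 x y) p" "\<lambda>y. ev (sZb y F) p"]
    by (simp add: Dv_def E.D_def ev_sum ev_mult ev_fb nd_def a_def v_def inner_vec_def flip: power2_norm_eq_inner)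
  have rowE: "Ev p \<bullet> Ev p \<le> a p * ne p" for p
    using row_Cauchy_Schwarz[of "\<lambda>x y. ev (E.E2 x y) p" "\<lambda>y. ev (sZ y F) p"]
    by (simp add: Ev_def E.E_def ev_sum ev_mult ev_fb ne_def a_def v_def inner_vec_def flip: power2_norm_eq_inner)
  \<comment> \<open>Half of the bracket in \<open>div_V\<close>, arranged as in
    \<open>jerison_lee_coercive\<close> with P = - s.\<close>
  define S where "S p = (a p + er p) * (nd p + ne p) + Dv p \<bullet> Dv p + Ev p \<bullet> Ev p + 3 * (Gv p \<bullet> Gv p)
      + 2 * (Dv p \<bullet> Ev p) + 2 * (Dv p \<bullet> Gv p) - 2 * (Ev p \<bullet> Gv p)
      + (- s) * er p * ((2 * n - 1) * a p * (a p + er p) + 3 * n * (b p)\<^sup>2 - Dv p \<bullet> v p - Ev p \<bullet> v p)" for p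
  have divV: "Re (ev (\<Sum>x\<in>UNIV. sZb x (E.V x)) p) = \<psi> p * S p" for p
  proof -
    let ?X = "\<Sum>x\<in>UNIV. sZb x (E.V x)"
    have 1: "ev (\<Sum>x\<in>UNIV. E.D x * scnj (E.D x)) p = complex_of_real (Dv p \<bullet> Dv p)"
      "ev (\<Sum>x\<in>UNIV. E.E x * scnj (E.E x)) p = complex_of_real (Ev p \<bullet> Ev p)"
      "ev (\<Sum>x\<in>UNIV. E.G x * scnj (E.G x)) p = complex_of_real (Gv p \<bullet> Gv p)"
      "ev (\<Sum>x\<in>UNIV. E.D x * scnj (E.E x) + E.E x * scnj (E.D x)) p = complex_of_real (2 * (Dv p \<bullet> Ev p))"
      "ev (\<Sum>x\<in>UNIV. E.D x * scnj (E.G x) + E.G x * scnj (E.D x)) p = complex_of_real (2 * (Dv p \<bullet> Gv p))"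
      "ev (\<Sum>x\<in>UNIV. E.E x * scnj (E.G x) + E.G x * scnj (E.E x)) p = complex_of_real (2 * (Ev p \<bullet> Gv p))"
      unfolding Dv_def Ev_def Gv_def ev_sum ev_mult ev_add ev_scnj sum_cnj_inner by (rule refl)+
    have "Re (ev (t + scnj t) p) = 2 * Re (ev t p)" for t by (simp add: ev_add ev_scnj)
    then have "Re (ev (?X + scnj ?X) p) = 2 * Re (ev ?X p)" .
    moreover have "Re (ev (?X + scnj ?X) p) = 2 * (\<psi> p * S p)"
      unfolding E.div_V ev_mult ev_add ev_diff 1 ev_A ev_e ev_\<Psi> ev_ND ev_b ev_n ev_scnj ev_sconst
      by (simp add: S_def ev_d ev_simps power2_eq_square algebra_simps n_def)
    ultimately show ?thesis by simp
  qed
  define \<kappa> where "\<kappa> = min (1 / 5) (- s - (- s)\<^sup>2 / 2)"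
  have \<kappa>: "0 < \<kappa>" "\<kappa> \<le> 1 / 5"
  proof -
    have "0 < (- s) * (2 + s)" using s by (intro mult_pos_pos) auto
    then show "0 < \<kappa>" by (simp add: \<kappa>_def power2_eq_square algebra_simps)
    show "\<kappa> \<le> 1 / 5" unfolding \<kappa>_def by (rule min.cobounded1)
  qed
  define \<delta> where "\<delta> = \<kappa> / (4 * n + 20)"
  have \<delta>: "0 < \<delta>" "\<delta> \<le> 1" using \<kappa> n by (auto simp: \<delta>_def field_simps)
  define P where "P p = (norm (Dv p))\<^sup>2 + (norm (Ev p))\<^sup>2 + (norm (Gv p))\<^sup>2 + a p ^ 3 + \<bar>b p\<bar> ^ 3 + er p ^ 3" for p
  \<comment> \<open>\<open>F1\<close> is smooth and stays in the ring. The third added field is kept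
    apart as b |b| times \<open>F2\<close>, since b |b| is only C^1. The factor 1 in
    \<open>F2\<close> is the w of \<open>div_weighted_gradient\<close>.\<close>
  define F1 where "F1 x = E.V x + sconst (complex_of_real \<delta>) * (\<Psi> * (E.A * E.A) * sZ x F)
     - sconst (complex_of_real \<delta>) * (\<Psi> * (e * e) * sZ x F)" for x
  define F2 where "F2 x = sconst (- \<i> * complex_of_real (\<delta> / 320)) * (\<Psi> * 1 * sZ x F)" for x
  define W where "W x p = ev (F1 x) p + complex_of_real (b p * \<bar>b p\<bar>) * ev (F2 x) p" for x p
  have sb: "smooth b" unfolding b_def by (rule smooth_bounded_linear_compose[OF bounded_linear_Re smooth_ev])
  have CkW: "Ck (Suc 0) (W x)" for x
    unfolding W_def
    by (rule Ck_add[OF smooth_imp_Ck[OF smooth_ev] Ck_mult[OF Ck_bounded_linear_compose[OF bounded_linear_of_real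
          Ck_mult_abs[OF smooth_imp_Ck[OF sb]]] smooth_imp_Ck[OF smooth_ev]]])
  have divW: "Re (\<Sum>x\<in>UNIV. Zbar x (W x) p) = \<psi> p * (S p
      + \<delta> * (n * a p ^ 3 - (n + 2) * er p * (a p)\<^sup>2 + 2 * a p * (Dv p \<bullet> v p + Ev p \<bullet> v p))
      + \<delta> * (n * er p ^ 3 - (n + 2 + 2 * s) * a p * (er p)\<^sup>2)
      + \<delta> / 320 * (n * \<bar>b p\<bar> ^ 3 + 2 * \<bar>b p\<bar> * (Gv p \<bullet> v p - (a p + er p) * a p)))" for p
  proof -
    have db: "b differentiable (at p)" by (rule smooth_differentiable[OF sb])
    have Zb_b: "Zbar x (\<lambda>p. complex_of_real (b p * \<bar>b p\<bar>)) p = complex_of_real (2 * \<bar>b p\<bar>) * ev (sZb x (sT F)) p" for x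
    proof -
      have "ev (sT F) = (\<lambda>p. complex_of_real (b p))" using ev_b by auto
      then show ?thesis unfolding Zbar_real_compose(1)[OF db has_real_derivative_mult_abs] ev_sZb by simp
    qed
    have Zc: "sZb a (sconst k) = (0 :: 'n sfun)" for a k
      by (rule sfun_eqI) (simp add: ev_simps ev_sZb, transfer, simp add: Zbar_const)
    have r1: "(\<Sum>x\<in>UNIV. sZb x (E.A * E.A) * sZ x F) = 2 * E.A * (\<Sum>x\<in>UNIV. sZb x E.A * sZ x F)"
      by (simp add: heis.Zb_mult sum_distrib_left algebra_simps)
    have div1: "Re (ev (\<Sum>x\<in>UNIV. sZb x (\<Psi> * (E.A * E.A) * sZ x F)) p)
       = \<psi> p * (n * a p ^ 3 - (n + 2) * er p * (a p)\<^sup>2 + 2 * a p * (Dv p \<bullet> v p + Ev p \<bullet> v p))"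
      unfolding E.div_weighted_gradient r1 E.Zb_A_f ev_mult ev_add ev_diff ev_scnj ev_sconst ev_numeral ev_one ev_A ev_e ev_\<Psi> ev_g ev_n
      by (simp add: ev_d) (simp add: algebra_simps power2_eq_square power3_eq_cube)
    have r2: "(\<Sum>x\<in>UNIV. sZb x (e * e) * sZ x F) = 2 * e * (\<Sum>x\<in>UNIV. sZb x e * sZ x F)"
      by (simp add: heis.Zb_mult sum_distrib_left algebra_simps)
    have div2: "Re (ev (\<Sum>x\<in>UNIV. sZb x (\<Psi> * (e * e) * sZ x F)) p)
       = - \<psi> p * (n * er p ^ 3 - (n + 2 + 2 * s) * a p * (er p)\<^sup>2)"
      unfolding E.div_weighted_gradient r2 E.Zb_e_f ev_mult ev_add ev_diff ev_scnj ev_sconst ev_numeral ev_one ev_A ev_e ev_\<Psi> ev_g ev_n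
      by (simp add: ev_d) (simp add: algebra_simps power2_eq_square power3_eq_cube)
    have "Zbar x (W x) p = ev (sZb x (F1 x)) p + (complex_of_real (2 * \<bar>b p\<bar>) * ev (sZb x (sT F)) p * ev (F2 x) p
       + complex_of_real (b p * \<bar>b p\<bar>) * ev (sZb x (F2 x)) p)" for x
    proof -
      have d: "ev (F1 x) differentiable (at p)" "ev (F2 x) differentiable (at p)"
        "(\<lambda>p. complex_of_real (b p * \<bar>b p\<bar>)) differentiable (at p)"
        by (rule smooth_differentiable[OF smooth_ev] Zbar_real_compose(2)[OF db has_real_derivative_mult_abs])+
      show ?thesis unfolding W_def[abs_def] Zbar_add[OF d(1) differentiable_mult[OF d(3,2)]] Zbar_mult[OF d(3,2)] Zb_b ev_sZb ..
    qed
    then have "(\<Sum>x\<in>UNIV. Zbar x (W x) p) = ev (\<Sum>x\<in>UNIV. sZb x (F1 x)) p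
       + complex_of_real (2 * \<bar>b p\<bar>) * ev (\<Sum>x\<in>UNIV. sZb x (sT F) * F2 x) p
       + complex_of_real (b p * \<bar>b p\<bar>) * ev (\<Sum>x\<in>UNIV. sZb x (F2 x)) p"
      by (simp add: sum.distrib sum_distrib_left ev_sum ev_mult mult_ac)
    moreover have "Re (ev (\<Sum>x\<in>UNIV. sZb x (F1 x)) p) = \<psi> p * (S p
      + \<delta> * (n * a p ^ 3 - (n + 2) * er p * (a p)\<^sup>2 + 2 * a p * (Dv p \<bullet> v p + Ev p \<bullet> v p))
      + \<delta> * (n * er p ^ 3 - (n + 2 + 2 * s) * a p * (er p)\<^sup>2))"
    proof -
      have "(\<Sum>x\<in>UNIV. sZb x (F1 x)) = (\<Sum>x\<in>UNIV. sZb x (E.V x))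
          + sconst (complex_of_real \<delta>) * (\<Sum>x\<in>UNIV. sZb x (\<Psi> * (E.A * E.A) * sZ x F))
          - sconst (complex_of_real \<delta>) * (\<Sum>x\<in>UNIV. sZb x (\<Psi> * (e * e) * sZ x F))"
        unfolding F1_def heis.Zb_diff heis.Zb_add heis.Zb_mult[of _ "sconst _"] Zc
        by (simp add: sum.distrib sum_subtractf sum_distrib_left)
      then show ?thesis
        by (simp add: ev_add ev_diff ev_mult ev_sconst divV div1 div2 del: ev_sum) (simp add: algebra_simps)
    qed
    moreover have "Re (complex_of_real (2 * \<bar>b p\<bar>) * ev (\<Sum>x\<in>UNIV. sZb x (sT F) * F2 x) p)
       = \<psi> p * (\<delta> / 320 * (2 * \<bar>b p\<bar> * (Gv p \<bullet> v p - (a p + er p) * a p)))"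
    proof -
      have k: "sconst (- \<i> * complex_of_real (\<delta> / 320)) = - (sconst (complex_of_real (\<delta> / 320)) * sconst \<i> :: 'n sfun)"
        by (rule sfun_eqI) (simp add: ev_simps)
      have "(\<Sum>x\<in>UNIV. sZb x (sT F) * F2 x) = - (sconst (complex_of_real (\<delta> / 320)) * \<Psi> * (sconst \<i> * (\<Sum>x\<in>UNIV. sZb x (sT F) * sZ x F)))"
        unfolding F2_def k by (simp add: sum_distrib_left sum_distrib_right sum_negf mult_ac)
      also have "\<dots> = - (sconst (complex_of_real (\<delta> / 320)) * \<Psi> * (scnj E.g * E.A - scnj E.\<gamma>))"
        unfolding E.ii_Zb_b_f ..
      finally show ?thesis
        by (simp add: ev_minus ev_diff ev_mult ev_sconst ev_scnj ev_\<Psi> ev_A ev_g ev_d) (simp add: algebra_simps)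
    qed
    moreover have "Re (complex_of_real (b p * \<bar>b p\<bar>) * ev (\<Sum>x\<in>UNIV. sZb x (F2 x)) p)
       = \<psi> p * (\<delta> / 320 * (n * \<bar>b p\<bar> ^ 3))"
    proof -
      have one: "sZb x 1 = (0 :: 'n sfun)" for x :: 'n using heis.Zb_of_nat[of x 1] by simp
      have "(\<Sum>x\<in>UNIV. sZb x (F2 x)) = sconst (- \<i> * complex_of_real (\<delta> / 320)) * (\<Sum>x\<in>UNIV. sZb x (\<Psi> * 1 * sZ x F))"
        unfolding F2_def heis.Zb_mult[of _ "sconst _"] Zc by (simp add: sum_distrib_left)
      also have "(\<Sum>x\<in>UNIV. sZb x (\<Psi> * 1 * sZ x F)) = \<Psi> * (2 * (of_nat CARD('n) - 1) * E.A - of_nat CARD('n) * E.g)"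
        unfolding E.div_weighted_gradient one by simp
      finally have "Re (complex_of_real (b p * \<bar>b p\<bar>) * ev (\<Sum>x\<in>UNIV. sZb x (F2 x)) p)
         = \<psi> p * (\<delta> / 320 * (n * (b p * b p * \<bar>b p\<bar>)))"
        by (simp add: ev_diff ev_mult ev_sconst ev_\<Psi> ev_A ev_g ev_n ev_one ev_numeral)
      also have "b p * b p * \<bar>b p\<bar> = \<bar>b p\<bar> ^ 3" by (simp add: power3_eq_cube)
      finally show ?thesis .
    qed
    ultimately show ?thesis by (simp add: algebra_simps)
  qed
  \<comment> \<open>Here \<psi> = er^\<nu> <= P^(\<nu>/3), and the bound on W needs \<psi>^(1/m) <=
    P^(1/6 - 1/m). The exponents agree, (\<nu>/3) / m = 1/6 - 1/m, precisely for m = 2 (\<nu> +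
    3).\<close>
  define \<nu> where "\<nu> = 2 * (n - 1) / (2 + s)"
  define m where "m = 2 * (\<nu> + 3)"
  have \<nu>: "\<nu> \<ge> 0" "\<nu> \<ge> n - 1"
  proof -
    show "\<nu> \<ge> 0" using n s by (simp add: \<nu>_def)
    have "(n - 1) * (2 + s) \<le> (n - 1) * 2" using n s by (intro mult_left_mono) auto
    then show "\<nu> \<ge> n - 1" using s by (simp add: \<nu>_def pos_le_divide_eq mult.commute)
  qed
  have normv: "(norm (v p))\<^sup>2 = a p" for p by (simp add: a_def power2_norm_eq_inner)
  have Ppos: "P p > 0" for p using quintic_bound(3)[OF normv pos(1)] by (simp add: P_def)
  show False
  proof (rule no_divergence_supersolution[where W = W and X = "\<lambda>p. \<psi> p * P p" and c = "\<delta> / 640" and C = 14 and m = m])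
    show "Ck (Suc 0) (W x)" for x by (rule CkW)
    show "\<psi> p * P p > 0" for p using pos Ppos by simp
    show "\<delta> / 640 > 0" using \<delta> by simp
    show "m > real (hom_dim TYPE('n))" using \<nu> by (simp add: m_def hom_dim_def n_def)
    show "continuous_on UNIV (\<lambda>p. \<psi> p * P p)"
    proof -
      have c: "continuous_on UNIV (\<lambda>p. \<chi> x. ev (g x) p)" for g :: "'n \<Rightarrow> 'n sfun"
        by (intro continuous_on_vec_lambda smooth_continuous smooth_ev)
      have "continuous_on UNIV v" "continuous_on UNIV Dv" "continuous_on UNIV Ev" "continuous_on UNIV Gv"
        unfolding v_def[abs_def] Dv_def[abs_def] Ev_def[abs_def] Gv_def[abs_def] by (rule c)+
      then show ?thesis
        unfolding P_def a_def er_def \<psi>_def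
        by (intro continuous_intros smooth_continuous[OF f] smooth_continuous[OF sb])
    qed
    show "\<delta> / 640 * (\<psi> p * P p) \<le> Re (\<Sum>x\<in>UNIV. Zbar x (W x) p)" for p
    proof -
      have v: "v p \<bullet> v p = a p" by (simp add: a_def)
      have "\<kappa> * (Dv p \<bullet> Dv p + Ev p \<bullet> Ev p + Gv p \<bullet> Gv p + er p * (a p)\<^sup>2 + a p * (er p)\<^sup>2 + er p * (b p)\<^sup>2) \<le> S p"
        unfolding \<kappa>_def S_def
        by (rule jerison_lee_coercive[OF v pos(1) _ _ n rowD nn(1) rowE nn(2)]) (use s in auto)
      from cubic_coercive[OF v pos(1) _ n \<kappa>(1) this, of s]
      have "\<delta> / 640 * P p \<le> S p
      + \<delta> * (n * a p ^ 3 - (n + 2) * er p * (a p)\<^sup>2 + 2 * a p * (Dv p \<bullet> v p + Ev p \<bullet> v p))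
      + \<delta> * (n * er p ^ 3 - (n + 2 + 2 * s) * a p * (er p)\<^sup>2)
      + \<delta> / 320 * (n * \<bar>b p\<bar> ^ 3 + 2 * \<bar>b p\<bar> * (Gv p \<bullet> v p - (a p + er p) * a p))"
        using s unfolding \<delta>_def P_def power2_norm_eq_inner by simp
      from mult_left_mono[OF this less_imp_le[OF pos(2)], of p]
      show ?thesis unfolding divW by (simp only: mult_ac)
    qed
    show "norm (\<chi> x. W x p) \<le> 14 * (\<psi> p * P p) powr (1 - 1 / m)" for p
    proof -
      define z1 z2 z3 z4 where "z1 = complex_of_real (\<psi> p) * Complex (a p + er p) (- 2 * b p)"
        and "z2 = complex_of_real (\<psi> p) * Complex (a p + er p) (2 * b p)"
        and "z3 = complex_of_real (\<psi> p) * Complex 0 (- 3 * b p)"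
        and "z4 = complex_of_real (\<psi> p) * Complex (\<delta> * (a p)\<^sup>2 - \<delta> * (er p)\<^sup>2) (- \<delta> / 320 * (b p * \<bar>b p\<bar>))"
      have W: "W x p = z1 * Dv p $ x + z2 * Ev p $ x + z3 * Gv p $ x + z4 * v p $ x" for x
      proof -
        have "Complex (a p + er p) (- 2 * b p) = complex_of_real (a p + er p) - 2 * \<i> * complex_of_real (b p)"
          "Complex (a p + er p) (2 * b p) = complex_of_real (a p + er p) + 2 * \<i> * complex_of_real (b p)"
          "Complex 0 (- 3 * b p) = - 3 * \<i> * complex_of_real (b p)"
          "Complex (\<delta> * (a p)\<^sup>2 - \<delta> * (er p)\<^sup>2) (- \<delta> / 320 * (b p * \<bar>b p\<bar>))
            = complex_of_real (\<delta> * (a p)\<^sup>2 - \<delta> * (er p)\<^sup>2) - \<i> * complex_of_real (\<delta> / 320 * (b p * \<bar>b p\<bar>))"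
          by (simp_all add: complex_eq_iff)
        note c = this
        show ?thesis
          unfolding W_def F1_def F2_def E.V_def ev_add ev_diff ev_mult ev_sconst ev_numeral ev_one ev_A ev_e ev_b ev_\<Psi>
            z1_def z2_def z3_def z4_def c Dv_def Ev_def Gv_def v_def vec_lambda_beta
          by (simp add: algebra_simps power2_eq_square)
      qed
      have "(\<chi> x. W x p) = (\<chi> x. z1 * Dv p $ x) + (\<chi> x. z2 * Ev p $ x) + (\<chi> x. z3 * Gv p $ x) + (\<chi> x. z4 * v p $ x)"
        by (simp add: vec_eq_iff W)
      then have "norm (\<chi> x. W x p) \<le> norm (\<chi> x. z1 * Dv p $ x) + norm (\<chi> x. z2 * Ev p $ x) + norm (\<chi> x. z3 * Gv p $ x) + norm (\<chi> x. z4 * v p $ x)"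
        by (simp add: norm_triangle_le norm_triangle_mono)
      also have "\<dots> = cmod z1 * norm (Dv p) + cmod z2 * norm (Ev p) + cmod z3 * norm (Gv p) + cmod z4 * norm (v p)"
        by (simp add: norm_vec_scale)
      also have "\<dots> \<le> \<psi> p * (a p + er p + 2 * \<bar>b p\<bar>) * norm (Dv p) + \<psi> p * (a p + er p + 2 * \<bar>b p\<bar>) * norm (Ev p)
          + \<psi> p * (3 * \<bar>b p\<bar>) * norm (Gv p) + \<psi> p * ((a p)\<^sup>2 + (er p)\<^sup>2 + (b p)\<^sup>2) * norm (v p)"
      proof -
        have cm: "cmod (complex_of_real (\<psi> p) * Complex t t') \<le> \<psi> p * (\<bar>t\<bar> + \<bar>t'\<bar>)" for t t'
          using pos(2)[of p] complex_norm_square cmod_le[of "Complex t t'"] by (simp add: norm_mult mult_left_mono)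
        have a: "a p \<ge> 0" by (simp add: a_def)
        have "\<bar>\<delta> * (a p)\<^sup>2 - \<delta> * (er p)\<^sup>2\<bar> + \<bar>- \<delta> / 320 * (b p * \<bar>b p\<bar>)\<bar> \<le> (a p)\<^sup>2 + (er p)\<^sup>2 + (b p)\<^sup>2"
        proof -
          have "\<delta> * (a p)\<^sup>2 \<le> 1 * (a p)\<^sup>2" "\<delta> * (er p)\<^sup>2 \<le> 1 * (er p)\<^sup>2" "\<delta> / 320 * (b p)\<^sup>2 \<le> 1 * (b p)\<^sup>2"
            using \<delta> by (intro mult_right_mono; simp)+
          moreover have "\<delta> * (a p)\<^sup>2 \<ge> 0" "\<delta> * (er p)\<^sup>2 \<ge> 0" using \<delta> by simp_all
          moreover have "\<bar>- \<delta> / 320 * (b p * \<bar>b p\<bar>)\<bar> = \<delta> / 320 * (b p)\<^sup>2"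
            using \<delta> by (simp add: abs_mult power2_eq_square)
          ultimately show ?thesis by linarith
        qed
        then have "cmod z4 \<le> \<psi> p * ((a p)\<^sup>2 + (er p)\<^sup>2 + (b p)\<^sup>2)"
          unfolding z4_def by (intro order_trans[OF cm] mult_left_mono less_imp_le[OF pos(2)])
        moreover have "cmod z1 \<le> \<psi> p * (a p + er p + 2 * \<bar>b p\<bar>)" "cmod z2 \<le> \<psi> p * (a p + er p + 2 * \<bar>b p\<bar>)" "cmod z3 \<le> \<psi> p * (3 * \<bar>b p\<bar>)"
          unfolding z1_def z2_def z3_def using a pos(1)[of p]
          by (auto intro!: order_trans[OF cm] mult_left_mono less_imp_le[OF pos(2)] simp: abs_mult)
        ultimately show ?thesis by (intro add_mono mult_right_mono) auto
      qed
      also have "\<dots> = \<psi> p * ((a p + er p + 2 * \<bar>b p\<bar>) * (norm (Dv p) + norm (Ev p)) + 3 * \<bar>b p\<bar> * norm (Gv p)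
          + ((a p)\<^sup>2 + (er p)\<^sup>2 + (b p)\<^sup>2) * norm (v p))"
        by (simp add: algebra_simps)
      also have "\<dots> \<le> \<psi> p * (14 * P p powr (5 / 6))"
        using quintic_bound(1)[OF normv pos(1), of p] pos(2)[of p] unfolding P_def by (intro mult_left_mono) auto
      also have "\<dots> \<le> 14 * (\<psi> p * P p) powr (1 - 1 / m)"
      proof -
        have "\<psi> p = er p powr \<nu>"
          using s by (simp add: \<psi>_def er_def powr_def \<nu>_def)
        also have "\<dots> \<le> (P p powr (1 / 3)) powr \<nu>"
          using quintic_bound(2)[OF normv pos(1), of p] \<nu> pos(1)[of p] by (intro powr_mono2) (auto simp: P_def)
        finally have "\<psi> p powr (1 / m) \<le> (P p powr (\<nu> / 3)) powr (1 / m)"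
          using \<nu> pos(2)[of p] by (intro powr_mono2) (auto simp: m_def powr_powr)
        also have "\<dots> = P p powr (1 / 6 - 1 / m)"
          using \<nu> by (simp add: powr_powr m_def field_simps)
        finally have *: "\<psi> p powr (1 / m) \<le> P p powr (1 / 6 - 1 / m)" .
        have "\<psi> p * P p powr (5 / 6) = \<psi> p powr (1 / m) * (\<psi> p powr (1 - 1 / m) * P p powr (5 / 6))"
          using pos(2)[of p] by (simp flip: powr_add mult.assoc)
        also have "\<dots> \<le> P p powr (1 / 6 - 1 / m) * (\<psi> p powr (1 - 1 / m) * P p powr (5 / 6))"
          by (rule mult_right_mono[OF *]) simp
        also have "\<dots> = \<psi> p powr (1 - 1 / m) * (P p powr (1 / 6 - 1 / m) * P p powr (5 / 6))"
          by (rule mult.left_commute)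
        also have "P p powr (1 / 6 - 1 / m) * P p powr (5 / 6) = P p powr (1 - 1 / m)"
          by (simp flip: powr_add)
        also have "\<psi> p powr (1 - 1 / m) * P p powr (1 - 1 / m) = (\<psi> p * P p) powr (1 - 1 / m)"
          using pos(2)[of p] Ppos[of p] by (simp add: powr_mult)
        finally show ?thesis by simp
      qed
      finally show ?thesis .
    qed
  qed
qed

section \<open>Positivity of nonnegative solutions\<close>

text \<open>If it were negative, the first derivative, which is 0 at the minimum, would be negative
  just after p, and the mean value theorem would give a smaller value nearby.\<close>

lemma second_derivative_local_min:
  fixes \<phi> :: "'a::euclidean_space \<Rightarrow> real"
  assumes \<phi>: "smooth \<phi>" and d: "d > 0" and min: "\<And>x. dist p x < d \<Longrightarrow> \<phi> p \<le> \<phi> x"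
  shows "frechet_derivative (\<lambda>p. frechet_derivative \<phi> (at p) v) (at p) v \<ge> 0"
proof (rule ccontr)
  assume "\<not> ?thesis"
  then have neg: "frechet_derivative (\<lambda>p. frechet_derivative \<phi> (at p) v) (at p) v < 0" by simp
  let ?h = "\<lambda>s. \<phi> (p + s *\<^sub>R v)" and ?h' = "\<lambda>s. frechet_derivative \<phi> (at (p + s *\<^sub>R v)) v"
  have h: "(?h has_real_derivative ?h' s) (at s)" for s
    by (rule has_real_derivative_along_line[OF smooth_differentiable[OF \<phi>]])
  have h': "(?h' has_real_derivative frechet_derivative (\<lambda>p. frechet_derivative \<phi> (at p) v) (at p) v) (at 0)"
    using has_real_derivative_along_line[of "\<lambda>p. frechet_derivative \<phi> (at p) v" p v 0]
      smooth_differentiable[OF smooth_frechet[OF \<phi>]] by simp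
  define r where "r = d / (norm v + 1)"
  have r: "r > 0" using d by (simp add: r_def add_nonneg_pos)
  have near: "dist p (p + s *\<^sub>R v) < d" if "\<bar>s\<bar> < r" for s
  proof -
    have "\<bar>s\<bar> * norm v \<le> \<bar>s\<bar> * (norm v + 1)" by (intro mult_left_mono) auto
    also have "\<dots> < r * (norm v + 1)" using that by (intro mult_strict_right_mono) (auto simp: add_nonneg_pos)
    also have "\<dots> = d" using norm_ge_zero[of v] by (simp add: r_def add_nonneg_eq_0_iff)
    finally show ?thesis by (simp add: dist_norm)
  qed
  have h0: "?h' 0 = 0"
    by (rule DERIV_local_min[OF h r]) (use min near in auto)
  obtain k where k: "k > 0" "\<And>t. t > 0 \<Longrightarrow> t < k \<Longrightarrow> ?h' t < 0"
    using DERIV_neg_dec_right[OF h' neg] h0 by auto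
  define s where "s = min r k / 2"
  have s: "0 < s" "s < r" "s < k" using r k by (auto simp: s_def)
  obtain t where t: "0 < t" "t < s" "?h s - ?h 0 = (s - 0) * ?h' t"
    using MVT2[OF s(1) h] by blast
  have "s * ?h' t < 0" using k(2)[of t] t s by (intro mult_pos_neg) auto
  then have "?h s < ?h 0" using t(3) by simp
  moreover have "\<phi> p \<le> ?h s" using s by (intro min near) auto
  ultimately show False by simp
qed

lemma frechet_derivative_combination:
  fixes f :: "'a::euclidean_space \<Rightarrow> real"
  assumes f: "smooth f"
  shows "DD f (e + c *\<^sub>R t) (e + c *\<^sub>R t) p = DD f e e p + c * DD f e t p + c * DD f t e p + c\<^sup>2 * DD f t t p"
proof -
  have 1: "frechet_derivative f (at p) (e + c *\<^sub>R t) = frechet_derivative f (at p) e + c * frechet_derivative f (at p) t" for p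
    using linear_frechet_derivative[OF smooth_differentiable[OF f], of p] by (simp add: linear_add linear_scale)
  note d = smooth_differentiable[OF smooth_frechet[OF f]]
  have 2: "DD f (e + c *\<^sub>R t) w p = DD f e w p + c * DD f t w p" for w
    unfolding 1
    using frechet_derivative_apply[OF has_derivative_add[OF has_derivative_frechet[OF d] has_derivative_mult_right[OF has_derivative_frechet[OF d]]]] .
  have 3: "DD f v (e + c *\<^sub>R t) p = DD f v e p + c * DD f v t p" for v
    using linear_frechet_derivative[OF d, of v p] by (simp add: linear_add linear_scale)
  show ?thesis unfolding 2 3 by (simp add: algebra_simps power2_eq_square)
qed

text \<open>The Laplacian is half the sum of squares of the real fields d/dx + 2 y d/dt and d/dy - 2
  x d/dt. Each annihilates its own coefficient, so at a given point the squares are second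
  derivatives in frozen directions and are nonnegative at a local minimum.\<close>

lemma heis_laplacian_eq_second_derivatives:
  fixes u :: "'n::finite heis \<Rightarrow> real"
  assumes u: "smooth u"
  shows "heis_laplacian u p = complex_of_real (1 / 2 * (\<Sum>a\<in>UNIV.
    DD u ((axis a 1, 0) + (2 * Im (fst p $ a)) *\<^sub>R (0, 1)) ((axis a 1, 0) + (2 * Im (fst p $ a)) *\<^sub>R (0, 1)) p +
    DD u ((axis a \<i>, 0) + (- 2 * Re (fst p $ a)) *\<^sub>R (0, 1)) ((axis a \<i>, 0) + (- 2 * Re (fst p $ a)) *\<^sub>R (0, 1)) p))"
proof -
  let ?f = "\<lambda>p. complex_of_real (u p)"
  have f: "smooth ?f" by (rule smooth_bounded_linear_compose[OF bounded_linear_of_real u])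
  have "(\<lambda>p. frechet_derivative ?f (at p) v) = (\<lambda>p. complex_of_real (frechet_derivative u (at p) v))" for v
    by (intro ext frechet_derivative_bounded_linear_compose bounded_linear_of_real smooth_differentiable u)
  then have DD: "DD ?f v w p = complex_of_real (DD u v w p)" for v w
    by (simp add: frechet_derivative_bounded_linear_compose[OF bounded_linear_of_real smooth_differentiable[OF smooth_frechet[OF u]]])
  have "Zbar a (Z a ?f) p + Z a (Zbar a ?f) p = complex_of_real (1 / 2 * (
    DD u ((axis a 1, 0) + (2 * Im (fst p $ a)) *\<^sub>R (0, 1)) ((axis a 1, 0) + (2 * Im (fst p $ a)) *\<^sub>R (0, 1)) p +
    DD u ((axis a \<i>, 0) + (- 2 * Re (fst p $ a)) *\<^sub>R (0, 1)) ((axis a \<i>, 0) + (- 2 * Re (fst p $ a)) *\<^sub>R (0, 1)) p))" for a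
  proof -
    have "DD u v w p = DD u w v p" for v w
      using frechet_derivative_sym[OF f, of v p w] unfolding DD by simp
    note s = this[of "(axis a \<i>, 0)" "(axis a 1, 0)"] this[of "(0, 1)" "(axis a 1, 0)"] this[of "(0, 1)" "(axis a \<i>, 0)"]
    show ?thesis
      unfolding frechet_derivative_combination[OF u] Zbar_eq[of a "Z a ?f"] Z_eq[of a "Zbar a ?f"]
        frechet_derivative_Z[OF f] frechet_derivative_Zbar[OF f] DD s
      by (simp add: axis_nth_eq complex_eq_iff field_simps power2_eq_square)
  qed
  then show ?thesis
    unfolding heis_laplacian_def Let_def by (simp only: sum_distrib_left of_real_sum)
qed

lemma heis_laplacian_sfun:
  assumes "\<And>p. ev U p = complex_of_real (u p)"
  shows "heis_laplacian u p = ev (\<Sum>a\<in>UNIV. sZb a (sZ a U) + sZ a (sZb a U)) p"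
proof -
  have "(\<lambda>p. complex_of_real (u p)) = ev U" using assms by auto
  then show ?thesis
    by (simp add: heis_laplacian_def ev_sum ev_add ev_sZ[abs_def] ev_sZb[abs_def] Let_def)
qed

lemma
  assumes L: "bounded_linear L"
  shows Z_affine: "Z a (\<lambda>p. L p - k) p = (L (axis a 1, 0) - \<i> * L (axis a \<i>, 0)) / 2 + \<i> * cnj (fst p $ a) * L (0, 1)"
    and Zbar_affine: "Zbar a (\<lambda>p. L p - k) p = (L (axis a 1, 0) + \<i> * L (axis a \<i>, 0)) / 2 - \<i> * (fst p $ a) * L (0, 1)"
proof -
  have "((\<lambda>p. L p - k) has_derivative L) (at p)" for p
    using has_derivative_diff[OF bounded_linear_imp_has_derivative[OF L] has_derivative_const] by simp
  note d = frechet_derivative_apply[OF this]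
  show "Z a (\<lambda>p. L p - k) p = (L (axis a 1, 0) - \<i> * L (axis a \<i>, 0)) / 2 + \<i> * cnj (fst p $ a) * L (0, 1)"
    "Zbar a (\<lambda>p. L p - k) p = (L (axis a 1, 0) + \<i> * L (axis a \<i>, 0)) / 2 - \<i> * (fst p $ a) * L (0, 1)"
    by (auto simp: Z_def Zbar_def d_z_def d_zbar_def d_t_def d)
qed

text \<open>The coordinates |z|^2 and t of the left translate of \<open>p\<close> which moves \<open>p0\<close> to the origin.\<close>

definition gauge_z :: "'n::finite heis \<Rightarrow> 'n heis \<Rightarrow> real" where
  "gauge_z p0 p = (norm (fst p - fst p0))\<^sup>2"

definition gauge_t :: "'n::finite heis \<Rightarrow> 'n heis \<Rightarrow> real" where
  "gauge_t p0 p = snd p - snd p0 + 2 * Im (\<Sum>b\<in>UNIV. cnj (fst p0 $ b) * fst p $ b)"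

definition gauge4 :: "'n::finite heis \<Rightarrow> 'n heis \<Rightarrow> real" where
  "gauge4 p0 p = (gauge_z p0 p)\<^sup>2 + (gauge_t p0 p)\<^sup>2"

text \<open>The fields are left invariant, so in the translated coordinates w and \<tau> they act as
  at the origin. With \<zeta> = |w|^2 + i \<tau> the derivatives of \<rho> factor through \<zeta>
  and its conjugate. The Laplacian of the barrier vanishes wherever w = 0; that of |w|^2 is a
  positive constant and will supply strictness.\<close>

lemma barrier_laplacian:
  fixes p0 :: "'n::finite heis" and k :: real
  shows "smooth (\<lambda>p. exp (- k * gauge4 p0 p))" "smooth (gauge_z p0)"
    and "heis_laplacian (\<lambda>p. exp (- k * gauge4 p0 p)) p
      = complex_of_real (4 * k * gauge_z p0 p * exp (- k * gauge4 p0 p) * (2 * k * gauge4 p0 p - (real CARD('n) + 2)))"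
    and "heis_laplacian (gauge_z p0) p = complex_of_real (2 * real CARD('n))"
proof -
  define Lt where "Lt p = complex_of_real (snd p + 2 * Im (\<Sum>b\<in>UNIV. cnj (fst p0 $ b) * fst p $ b))" for p :: "'n heis"
  have Lt: "bounded_linear Lt"
    unfolding Lt_def
    by (intro bounded_linear_compose[OF bounded_linear_of_real] bounded_linear_add bounded_linear_snd
      bounded_linear_const_mult bounded_linear_compose[OF bounded_linear_Im] bounded_linear_sum bounded_linear_component)
  define w where "w b = (sfun (\<lambda>p. fst p $ b - fst p0 $ b) :: 'n sfun)" for b
  define \<tau> where "\<tau> = (sfun (\<lambda>p. Lt p - complex_of_real (snd p0)) :: 'n sfun)"
  have ev_w: "ev (w b) = (\<lambda>p. fst p $ b - fst p0 $ b)" for b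
    unfolding w_def by (rule ev_sfun[OF smooth_diff[OF smooth_bounded_linear[OF bounded_linear_component] smooth_const]])
  have ev_\<tau>: "ev \<tau> = (\<lambda>p. Lt p - complex_of_real (snd p0))"
    unfolding \<tau>_def by (rule ev_sfun[OF smooth_diff[OF smooth_bounded_linear[OF Lt] smooth_const]])
  have Zw: "sZ a (w b) = (if a = b then 1 else 0)" "sZb a (w b) = 0" for a b
    by (rule sfun_eqI; simp add: ev_sZ ev_sZb ev_w Z_affine[OF bounded_linear_component] Zbar_affine[OF bounded_linear_component]
      axis_nth_eq ev_zero ev_one)+
  have c\<tau>: "scnj \<tau> = \<tau>" by (rule sfun_eqI) (simp add: ev_scnj ev_\<tau> Lt_def)
  have Z\<tau>: "sZ a \<tau> = sconst \<i> * scnj (w a)" for a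
  proof (rule sfun_eqI)
    fix p
    have "(\<Sum>b\<in>UNIV. cnj (fst p0 $ b) * (if a = b then x else 0)) = cnj (fst p0 $ a) * x" for x
      by (simp add: if_distrib[of "\<lambda>t. _ * t"] cong: if_cong)
    then have L: "Lt (axis a x, 0) = complex_of_real (2 * Im (cnj (fst p0 $ a) * x))" "Lt (0, 1) = 1" for x
      unfolding Lt_def fst_conv snd_conv axis_nth_eq by simp_all
    show "ev (sZ a \<tau>) p = ev (sconst \<i> * scnj (w a)) p"
      unfolding ev_sZ ev_\<tau> Z_affine[OF Lt] L ev_mult ev_sconst ev_scnj ev_w by (simp add: complex_eq_iff)
  qed
  have Zb\<tau>: "sZb a \<tau> = - sconst \<i> * w a" for a
    using heis.c_Z[of a \<tau>] unfolding Z\<tau> c\<tau> by (simp add: heis.c_mult)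
  define A where "A = (\<Sum>b\<in>UNIV. w b * scnj (w b))"
  have Zcw: "sZ a (scnj (w b)) = 0" "sZb a (scnj (w b)) = (if a = b then 1 else 0)" for a b
    using heis.c_Zb[of a "w b"] heis.c_Z[of a "w b"] unfolding Zw by (auto simp: if_distrib[of scnj] cong: if_cong)
  have ZA: "sZ a A = scnj (w a)" "sZb a A = w a" for a
    unfolding A_def heis.Z_sum heis.Zb_sum heis.Z_mult heis.Zb_mult Zw Zcw by (simp_all add: sum_if_eq)
  have ev_A: "ev A p = complex_of_real (gauge_z p0 p)" for p
    unfolding A_def gauge_z_def ev_sum ev_mult ev_scnj power2_norm_eq_inner sum_cnj_inner(2)
    by (simp add: ev_w inner_vec_def)
  have ev_t: "ev \<tau> p = complex_of_real (gauge_t p0 p)" for p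
    by (simp add: ev_\<tau> Lt_def gauge_t_def)
  define \<rho> where "\<rho> = A * A + \<tau> * \<tau>"
  have ev_\<rho>: "ev \<rho> p = complex_of_real (gauge4 p0 p)" for p
    by (simp add: \<rho>_def gauge4_def ev_add ev_mult ev_A ev_t power2_eq_square)
  define \<zeta> \<zeta>' where "\<zeta> = A + sconst \<i> * \<tau>" and "\<zeta>' = A - sconst \<i> * \<tau>"
  have Z\<rho>: "sZ a \<rho> = 2 * (scnj (w a) * \<zeta>)" "sZb a \<rho> = 2 * (w a * \<zeta>')" for a
    unfolding \<rho>_def heis.Z_add heis.Zb_add heis.Z_mult heis.Zb_mult ZA Z\<tau> Zb\<tau> \<zeta>_def \<zeta>'_def by (simp_all add: algebra_simps)
  have Zzeta: "sZb a \<zeta> = 2 * w a" "sZ a \<zeta>' = 2 * scnj (w a)" for a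
    unfolding \<zeta>_def \<zeta>'_def heis.Z_diff heis.Zb_add heis.Z_mult heis.Zb_mult ZA Z\<tau> Zb\<tau> by (simp_all add: heis.ii_ii)
  define B where "B = (sfun (\<lambda>p. exp (complex_of_real (- k) * ev \<rho> p)) :: 'n sfun)"
  have ev_B: "ev B = (\<lambda>p. exp (complex_of_real (- k) * ev \<rho> p))"
    unfolding B_def by (rule ev_sfun[OF smooth_exp[OF smooth_mult[OF smooth_const smooth_ev]]])
  have e': "((\<lambda>x. exp (complex_of_real (- k) * x)) has_field_derivative complex_of_real (- k) * exp (complex_of_real (- k) * x)) (at x)" for x
    by (auto intro!: derivative_eq_intros)
  have ZB: "sZ a B = sconst (complex_of_real (- k)) * B * sZ a \<rho>" "sZb a B = sconst (complex_of_real (- k)) * B * sZb a \<rho>" for a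
    by (rule sfun_eqI; unfold ev_mult ev_sconst ev_sZ ev_sZb ev_B;
        rule Z_compose[OF smooth_differentiable[OF smooth_ev] e'] Zbar_compose[OF smooth_differentiable[OF smooth_ev] e'])+
  have Zk: "sZ a (sconst z) = (0 :: 'n sfun)" "sZb a (sconst z) = (0 :: 'n sfun)" for a z
    by (rule sfun_eqI; simp add: ev_simps ev_sZ ev_sZb; transfer; simp add: Z_const Zbar_const)+
  have ev_B': "ev B p = complex_of_real (exp (- k * gauge4 p0 p))" for p
    unfolding ev_B ev_\<rho> by (simp flip: exp_of_real)
  show "smooth (\<lambda>p. exp (- k * gauge4 p0 p))"
    using smooth_bounded_linear_compose[OF bounded_linear_Re smooth_ev[of B]] by (simp add: ev_B')
  show "smooth (gauge_z p0)"
    using smooth_bounded_linear_compose[OF bounded_linear_Re smooth_ev[of A]] by (simp add: ev_A)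
  show "heis_laplacian (gauge_z p0) p = complex_of_real (2 * real CARD('n))"
    unfolding heis_laplacian_sfun[OF ev_A] ZA Zcw Zw by (simp add: ev_simps)
  define K where "K = (sconst (complex_of_real (- k)) :: 'n sfun)"
  have "sZb a (sZ a B) + sZ a (sZb a B) = (8 * K * K * B * \<zeta> * \<zeta>' + 8 * K * B) * (w a * scnj (w a)) + 2 * K * B * (\<zeta> + \<zeta>')" for a
    unfolding ZB K_def[symmetric] heis.Z_mult heis.Zb_mult Zk[of _ "complex_of_real (- k)", folded K_def] Z\<rho> ZB Zzeta Zcw Zw heis.Z_numeral heis.Zb_numeral
    by (simp add: algebra_simps)
  then have "(\<Sum>a\<in>UNIV. sZb a (sZ a B) + sZ a (sZb a B)) = (8 * K * K * B * \<zeta> * \<zeta>' + 8 * K * B) * A + of_nat CARD('n) * (2 * K * B * (\<zeta> + \<zeta>'))"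
    by (simp add: sum.distrib A_def flip: sum_distrib_left)
  \<comment> \<open>Here \<zeta> \<zeta>' = \<rho> and \<zeta> + \<zeta>' = 2 A.\<close>
  also have "\<dots> = 4 * K * B * A * (2 * K * \<rho> + 2 + of_nat CARD('n))"
    unfolding \<rho>_def \<zeta>_def \<zeta>'_def by (simp add: algebra_simps heis.ii_ii)
  finally show "heis_laplacian (\<lambda>p. exp (- k * gauge4 p0 p)) p
      = complex_of_real (4 * k * gauge_z p0 p * exp (- k * gauge4 p0 p) * (2 * k * gauge4 p0 p - (real CARD('n) + 2)))"
    unfolding heis_laplacian_sfun[OF ev_B'] by (simp only: ev_mult ev_add ev_numeral ev_of_nat ev_A ev_B' ev_\<rho>)
      (simp add: K_def ev_sconst algebra_simps)
qed

lemma heis_laplacian_diff_scale: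
  fixes u v :: "'n::finite heis \<Rightarrow> real"
  assumes u: "smooth u" and v: "smooth v"
  shows "heis_laplacian (\<lambda>p. u p - k * v p) p = heis_laplacian u p - complex_of_real k * heis_laplacian v p"
proof -
  define U V where "U = sfun (\<lambda>p. complex_of_real (u p))" and "V = sfun (\<lambda>p. complex_of_real (v p))"
  have U: "ev U p = complex_of_real (u p)" and V: "ev V p = complex_of_real (v p)" for p
    unfolding U_def V_def
    using ev_sfun[OF smooth_bounded_linear_compose[OF bounded_linear_of_real u]]
      ev_sfun[OF smooth_bounded_linear_compose[OF bounded_linear_of_real v]] by simp_all
  have UV: "ev (U - sconst (complex_of_real k) * V) p = complex_of_real (u p - k * v p)" for p
    by (simp add: ev_diff ev_mult ev_sconst U V)
  have Zk: "sZ a (sconst z) = (0 :: 'n sfun)" "sZb a (sconst z) = (0 :: 'n sfun)" for a z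
    by (rule sfun_eqI; simp add: ev_simps ev_sZ ev_sZb; transfer; simp add: Z_const Zbar_const)+
  have "(\<Sum>a\<in>UNIV. sZb a (sZ a (U - sconst (complex_of_real k) * V)) + sZ a (sZb a (U - sconst (complex_of_real k) * V)))
     = (\<Sum>a\<in>UNIV. sZb a (sZ a U) + sZ a (sZb a U)) - sconst (complex_of_real k) * (\<Sum>a\<in>UNIV. sZb a (sZ a V) + sZ a (sZb a V))"
    unfolding heis.Z_diff heis.Zb_diff heis.Z_mult heis.Zb_mult Zk heis.Z_add heis.Zb_add
    by (simp add: sum.distrib sum_subtractf sum_distrib_left algebra_simps)
  then show ?thesis
    unfolding heis_laplacian_sfun[OF U] heis_laplacian_sfun[OF V] heis_laplacian_sfun[OF UV]
    by (simp only: ev_diff ev_mult ev_sconst)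
qed

text \<open>The product of the conjugate of p0 with itself is real, so in \<open>gauge_t\<close> the
  point p can be replaced by p - p0, and Cauchy-Schwarz bounds the difference between
  \<open>gauge_t\<close> and the plain t coordinate.\<close>

lemma gauge4_bounds:
  fixes p0 p :: "'n::finite heis"
  assumes "gauge4 p0 p \<le> s\<^sup>2" "s \<ge> 0"
  shows "norm (fst p - fst p0) \<le> sqrt s" "\<bar>snd p - snd p0\<bar> \<le> s + 2 * norm (fst p0) * sqrt s"
proof -
  have "(gauge_z p0 p)\<^sup>2 \<le> s\<^sup>2" "(gauge_t p0 p)\<^sup>2 \<le> s\<^sup>2"
    using assms(1) zero_le_power2[of "gauge_z p0 p"] zero_le_power2[of "gauge_t p0 p"]
    unfolding gauge4_def by linarith+
  then have zt: "gauge_z p0 p \<le> s" "\<bar>gauge_t p0 p\<bar> \<le> s"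
    using assms(2) by (auto simp: abs_le_square_iff[symmetric] intro: power2_le_imp_le)
  then show z: "norm (fst p - fst p0) \<le> sqrt s"
    unfolding gauge_z_def by (intro real_le_rsqrt)
  let ?w = "fst p - fst p0"
  have "(\<Sum>b\<in>UNIV. cnj (fst p0 $ b) * fst p $ b) = (\<Sum>b\<in>UNIV. cnj (fst p0 $ b) * ?w $ b) + (\<Sum>b\<in>UNIV. cnj (fst p0 $ b) * fst p0 $ b)"
    by (simp add: algebra_simps flip: sum.distrib)
  then have "Im (\<Sum>b\<in>UNIV. cnj (fst p0 $ b) * fst p $ b) = Re (\<Sum>b\<in>UNIV. (- \<i> * cnj (fst p0 $ b)) * ?w $ b)"
    by (simp add: sum_distrib_left algebra_simps flip: sum_subtractf)
  also have "\<bar>\<dots>\<bar> \<le> norm (\<chi> b. - \<i> * cnj (fst p0 $ b)) * norm (\<chi> b. cnj (?w $ b))"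
    by (rule Re_sum_mult_le)
  also have "\<dots> = norm (fst p0) * norm ?w"
    by (simp add: norm_vec_def norm_mult del: complex_cnj_diff vector_minus_component)
  also have "\<dots> \<le> norm (fst p0) * sqrt s" by (rule mult_left_mono[OF z norm_ge_zero])
  finally show "\<bar>snd p - snd p0\<bar> \<le> s + 2 * norm (fst p0) * sqrt s"
    using zt(2) unfolding gauge_t_def by linarith
qed

lemma continuous_on_gauge: "continuous_on S (gauge_z p0)" "continuous_on S (gauge4 p0)"
  unfolding gauge_z_def[abs_def] gauge4_def[abs_def] gauge_t_def[abs_def]
  by (intro continuous_intros)+

lemma compact_gauge_ball: "compact {p. gauge4 p0 p \<le> R}"
proof (cases "R \<ge> 0")
  case True
  define s where "s = sqrt R"
  have s: "s \<ge> 0" "s\<^sup>2 = R" using True by (auto simp: s_def)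
  have "{p. gauge4 p0 p \<le> R} \<subseteq> cball (fst p0) (sqrt s) \<times> cball (snd p0) (s + 2 * norm (fst p0) * sqrt s)"
    using gauge4_bounds[OF _ s(1), of p0] s(2) by (auto simp: dist_norm norm_minus_commute dist_real_def abs_minus_commute)
  then have "bounded {p. gauge4 p0 p \<le> R}"
    by (rule bounded_subset[OF bounded_Times[OF bounded_cball bounded_cball]])
  moreover have "closed {p. gauge4 p0 p \<le> R}"
    by (intro closed_Collect_le continuous_intros continuous_on_gauge)
  ultimately show ?thesis by (simp add: compact_eq_bounded_closed)
next
  case False
  then have empty: "{p. gauge4 p0 p \<le> R} = {}"
    by (auto simp: gauge4_def not_le intro: less_le_trans[OF _ add_nonneg_nonneg])
  show ?thesis unfolding empty by (rule compact_empty)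
qed

lemma gauge_ball_subset_ball:
  assumes "d > 0"
  shows "\<exists>r>0. \<forall>p. gauge4 p0 p \<le> r \<longrightarrow> dist p p0 < d"
proof -
  have "((\<lambda>s. sqrt s + (s + 2 * norm (fst p0) * sqrt s)) \<longlongrightarrow> sqrt 0 + (0 + 2 * norm (fst p0) * sqrt 0)) (at_right 0)"
    by (intro tendsto_intros)
  then have "\<forall>\<^sub>F s in at_right 0. sqrt s + (s + 2 * norm (fst p0) * sqrt s) < d"
    using assms by (auto intro: order_tendstoD)
  then obtain s where s: "s > 0" "sqrt s + (s + 2 * norm (fst p0) * sqrt s) < d"
    unfolding eventually_at_right_field by (metis dense)
  have "dist p p0 < d" if "gauge4 p0 p \<le> s\<^sup>2" for p
  proof -
    have "dist p p0 \<le> norm (fst p - fst p0) + \<bar>snd p - snd p0\<bar>"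
      using norm_Pair_le[of "fst p - fst p0" "snd p - snd p0"] by (simp add: dist_norm minus_prod_def)
    then show ?thesis using gauge4_bounds[OF that] s by simp
  qed
  then show ?thesis using s(1) by (intro exI[of _ "s\<^sup>2"]) auto
qed

text \<open>If u (p1) = 0, then u - C \<phi> - \<epsilon> |w|^2 has its minimum over a gauge shell
  in the interior, where its second derivatives are nonnegative although its Laplacian is negative.
  A bounded shell suffices, because on the outer boundary u >= 0 and the barrier is smaller than at
  p1.\<close>

proposition superharmonic_positive:
  fixes u :: "'n::finite heis \<Rightarrow> real"
  assumes u: "smooth u" and nn: "\<And>p. u p \<ge> 0" and super: "\<And>p. Re (heis_laplacian u p) \<le> 0"
    and pos: "u p0 > 0"
  shows "u p1 > 0"
proof (rule ccontr)
  assume "\<not> ?thesis"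
  then have p1: "u p1 = 0" using nn[of p1] by simp
  have cu: "continuous_on UNIV u" by (rule smooth_continuous[OF u])
  define m where "m = u p0 / 2"
  have m: "m > 0" using pos by (simp add: m_def)
  have "isCont u p0" using cu continuous_on_eq_continuous_at[OF open_UNIV] by blast
  then obtain d where d: "d > 0" "\<And>p. dist p p0 < d \<Longrightarrow> dist (u p) (u p0) < m"
    using m unfolding continuous_at_eps_delta by blast
  obtain r where r: "r > 0" "\<And>p. gauge4 p0 p \<le> r \<Longrightarrow> dist p p0 < d"
    using gauge_ball_subset_ball[OF d(1)] by blast
  have um: "u p > m" if "gauge4 p0 p \<le> r" for p
    using d(2)[OF r(2)[OF that]] unfolding dist_real_def m_def abs_less_iff by linarith
  \<comment> \<open>From 2 k r = n + 2, the barrier is subharmonic wherever \<open>gauge4\<close> is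
    at least r.\<close>
  define k where "k = (real CARD('n) + 2) / (2 * r)"
  have k: "k > 0" "2 * k * r = real CARD('n) + 2" using r by (auto simp: k_def)
  define \<phi> where "\<phi> p = exp (- k * gauge4 p0 p)" for p
  \<comment> \<open>This makes C \<phi> equal to m, hence less than u, on the inner
    boundary.\<close>
  define C where "C = m * exp (k * r)"
  have C: "C > 0" using m by (simp add: C_def)
  \<comment> \<open>Adding 1 puts p1 strictly inside the outer boundary, which makes
    \<open>\<mu>\<close> positive.\<close>
  define R where "R = gauge4 p0 p1 + 1"
  have rp1: "gauge4 p0 p1 > r" using um[of p1] p1 m by (cases "gauge4 p0 p1 \<le> r") auto
  \<comment> \<open>The excess of the barrier at p1 over its value on the outer boundary;
    \<open>\<epsilon>\<close> is chosen to keep the strictness term below it throughout the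
    shell.\<close>
  define \<mu> where "\<mu> = C * \<phi> p1 - C * exp (- k * R)"
  have \<mu>: "\<mu> > 0" using C k(1) by (simp add: \<mu>_def \<phi>_def R_def)
  define \<epsilon> where "\<epsilon> = \<mu> / (2 * sqrt R)"
  have R: "R > r" "R > 0" using rp1 r(1) by (auto simp: R_def)
  have \<epsilon>: "\<epsilon> > 0" "\<epsilon> * sqrt R < \<mu>" using \<mu> R by (auto simp: \<epsilon>_def)
  define \<psi> where "\<psi> p = (u p - C * \<phi> p) - \<epsilon> * gauge_z p0 p" for p
  have s\<phi>: "smooth \<phi>" unfolding \<phi>_def by (rule barrier_laplacian(1))
  have s1: "smooth (\<lambda>p. u p - C * \<phi> p)"
    by (rule smooth_diff[OF u smooth_mult[OF smooth_const s\<phi>]])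
  have s\<psi>: "smooth \<psi>"
    unfolding \<psi>_def by (rule smooth_diff[OF s1 smooth_mult[OF smooth_const barrier_laplacian(2)]])
  let ?K = "{p. gauge4 p0 p \<le> R} \<inter> {p. r \<le> gauge4 p0 p}"
  have "compact ?K"
    by (intro compact_Int_closed compact_gauge_ball closed_Collect_le continuous_intros continuous_on_gauge)
  moreover have p1K: "p1 \<in> ?K" using rp1 by (simp add: R_def)
  ultimately obtain q where q: "q \<in> ?K" "\<And>p. p \<in> ?K \<Longrightarrow> \<psi> q \<le> \<psi> p"
    using continuous_attains_inf[of ?K \<psi>] continuous_on_subset[OF smooth_continuous[OF s\<psi>]] by blast
  have gz: "gauge_z p0 p \<ge> 0" for p by (simp add: gauge_z_def)
  have "\<psi> q \<le> \<psi> p1" using q(2)[OF p1K] .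
  also have "\<dots> \<le> - C * \<phi> p1" using p1 \<epsilon>(1) gz[of p1] by (simp add: \<psi>_def)
  finally have \<psi>q: "\<psi> q \<le> - C * \<phi> p1" .
  have Az: "\<epsilon> * gauge_z p0 p < \<mu>" if "gauge4 p0 p \<le> R" for p
  proof -
    have "gauge_z p0 p \<le> sqrt R" using that by (intro real_le_rsqrt) (auto simp: gauge4_def intro: order_trans[rotated])
    then have "\<epsilon> * gauge_z p0 p \<le> \<epsilon> * sqrt R" using \<epsilon>(1) by (intro mult_left_mono) auto
    then show ?thesis using \<epsilon>(2) by simp
  qed
  have "gauge4 p0 q \<noteq> r"
  proof
    assume *: "gauge4 p0 q = r"
    have "C * \<phi> q = m" by (simp add: C_def \<phi>_def * flip: exp_add)
    then have "\<psi> q > - \<mu>" using um[of q] Az[of q] * R by (simp add: \<psi>_def)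
    moreover have "- \<mu> \<ge> - C * \<phi> p1" using C by (simp add: \<mu>_def)
    ultimately show False using \<psi>q by simp
  qed
  moreover have "gauge4 p0 q \<noteq> R"
  proof
    assume *: "gauge4 p0 q = R"
    have "\<psi> q > - (C * exp (- k * R)) - \<mu>" using nn[of q] Az[of q] by (simp add: \<psi>_def \<phi>_def *)
    then show False using \<psi>q by (simp add: \<mu>_def)
  qed
  ultimately have qi: "q \<in> {p. gauge4 p0 p < R} \<inter> {p. r < gauge4 p0 p}" using q(1) by auto
  have "open ({p. gauge4 p0 p < R} \<inter> {p. r < gauge4 p0 p})"
    by (intro open_Int open_Collect_less continuous_intros continuous_on_gauge)
  then obtain e where e: "e > 0" "ball q e \<subseteq> {p. gauge4 p0 p < R} \<inter> {p. r < gauge4 p0 p}"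
    using qi by (rule openE)
  have "\<psi> q \<le> \<psi> p" if "dist q p < e" for p
    using e(2) that by (intro q(2)) auto
  then have "DD \<psi> v v q \<ge> 0" for v
    by (rule second_derivative_local_min[OF s\<psi> e(1)])
  then have "Re (heis_laplacian \<psi> q) \<ge> 0"
    unfolding heis_laplacian_eq_second_derivatives[OF s\<psi>] by (simp add: sum_nonneg)
  moreover have "Re (heis_laplacian \<psi> q) < 0"
  proof -
    have "heis_laplacian \<psi> q = heis_laplacian u q - complex_of_real C * heis_laplacian \<phi> q
       - complex_of_real \<epsilon> * heis_laplacian (gauge_z p0) q"
      unfolding \<psi>_def heis_laplacian_diff_scale[OF s1 barrier_laplacian(2)] heis_laplacian_diff_scale[OF u s\<phi>] ..
    moreover have "Re (complex_of_real C * heis_laplacian \<phi> q) \<ge> 0"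
    proof -
      have "2 * k * r \<le> 2 * k * gauge4 p0 q" using qi k(1) by (intro mult_left_mono) auto
      then have "0 \<le> 4 * k * gauge_z p0 q * exp (- k * gauge4 p0 q) * (2 * k * gauge4 p0 q - (real CARD('n) + 2))"
        using k gz[of q] by (intro mult_nonneg_nonneg) auto
      then show ?thesis unfolding \<phi>_def barrier_laplacian(3) using C
        by (simp only: Re_complex_of_real mult_nonneg_nonneg less_imp_le flip: of_real_mult)
    qed
    moreover have "Re (complex_of_real \<epsilon> * heis_laplacian (gauge_z p0) q) > 0"
      unfolding barrier_laplacian(4) using \<epsilon>(1) by simp
    ultimately show ?thesis using super[of q] by simp
  qed
  ultimately show False by simp
qed

text \<open>With s = n q - n - 2 the right side u^q is exp ((n + 2 + s) f), and 1 < q < 1 + 2 / n is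
  the same as - 2 < s < 0.\<close>

lemma no_positive_solution:
  fixes u :: "'n::finite heis \<Rightarrow> real" and q :: real
  assumes u: "smooth u" "\<And>p. u p > 0" and sol: "solves_heis_eq q u"
    and q: "1 < q" "q < 1 + 2 / real CARD('n)"
  shows False
proof (rule no_log_solution)
  let ?n = "real CARD('n)"
  have n: "?n > 0" by simp
  show "smooth (\<lambda>p. 1 / ?n * ln (u p))"
    by (rule smooth_mult[OF smooth_const smooth_ln[OF u]])
  have "?n * 1 < ?n * q" "?n * q < ?n * (1 + 2 / ?n)" using q n by (intro mult_strict_left_mono; simp)+
  then show "- 2 < ?n * q - ?n - 2" "?n * q - ?n - 2 < 0" by (simp_all add: distrib_left)
  have "(\<lambda>p. exp (?n * (1 / ?n * ln (u p)))) = u" using u(2) by auto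
  moreover have "exp ((?n + 2 + (?n * q - ?n - 2)) * (1 / ?n * ln (u p))) = u p powr q" for p
    using u(2)[of p] by (simp add: powr_def)
  ultimately show "- heis_laplacian (\<lambda>p. exp (?n * (1 / ?n * ln (u p)))) p
      = complex_of_real (2 * ?n\<^sup>2 * exp ((?n + 2 + (?n * q - ?n - 2)) * (1 / ?n * ln (u p))))" for p
    using sol unfolding solves_heis_eq_def by metis
qed

theorem theorem1p1:
  fixes q Q :: real
  defines "Q \<equiv> real (hom_dim TYPE('n::finite))"
  assumes "1 < q" and "q < (Q + 2) / (Q - 2)"
  shows "(\<nexists>u :: 'n heis \<Rightarrow> real. smooth u \<and> (\<forall>p. u p > 0) \<and> solves_heis_eq q u) \<and>
         (\<forall>u :: 'n heis \<Rightarrow> real.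
            smooth u \<and> (\<forall>p. u p \<ge> 0) \<and> solves_heis_eq q u \<longrightarrow> (\<forall>p. u p = 0))"
proof -
  have "(Q + 2) / (Q - 2) = 1 + 2 / real CARD('n)"
    by (simp add: Q_def hom_dim_def field_simps)
  then have q: "1 < q" "q < 1 + 2 / real CARD('n)" using assms by auto
  have no: "False" if "smooth u" "\<forall>p. u p > 0" "solves_heis_eq q u" for u :: "'n heis \<Rightarrow> real"
    using no_positive_solution[OF that(1) _ that(3) q] that(2) by blast
  have "u p = 0" if u: "smooth u" "\<forall>p. u p \<ge> 0" "solves_heis_eq q u" for u :: "'n heis \<Rightarrow> real" and p
  proof (rule ccontr)
    assume "u p \<noteq> 0"
    then have pos: "u p > 0" using spec[OF u(2), of p] by simp
    have "heis_laplacian u x = - complex_of_real (2 * (real CARD('n))\<^sup>2 * u x powr q)" for x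
      using u(3) unfolding solves_heis_eq_def by (metis minus_minus)
    then have "Re (heis_laplacian u x) \<le> 0" for x by simp
    from superharmonic_positive[OF u(1) _ this pos] u(2) have "\<forall>x. u x > 0" by blast
    then show False using no u by blast
  qed
  then show ?thesis using no by blast
qed

end
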